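(* Let $\mathrm{Ricci}=\mathrm{Ricci}_{+-}+\mathrm{Ricci}_{-+}$ be the decomposition of the Ricci tensor of the quantum projective space corresponding to $g=g_{+-}+g_{-+}$, defined with the splitting map $s_\wedge$ depending on scalars $c_{+-},c_{-+}$ with $c_{+-}+c_{-+}=1$. Then $$\mathrm{Ricci}_{-+}=-c_{+-}\,q^{(\alpha_s,\alpha_s)}\,\mathrm{qdim}(V)\,g_{-+}.$$
   Context: **Quantum group data.** Fix an integer $r\ge 1$, a real number $0<q<1$ and $s\in\{1,r\}$. $U_q(\mathfrak{sl}_{r+1})$ is the quantized enveloping algebra with generators $K_i^{\pm1},E_i,F_i$, $1\le i\le r$ (Klimyk–Schmüdgen conventions: $\Delta(K_i)=K_i\otimes K_i$, $\Delta(E_i)=E_i\otimes K_i+1\otimes E_i$, $\Delta(F_i)=F_i\otimes 1+K_i^{-1}\otimes F_i$; $K_i$ acts on a vector of weight $\mu$ by $q^{(\alpha_i,\mu)}$). Here $\alpha_i$ are the simple roots, $\omega_i$ the fundamental weights, $\rho=\sum_i\omega_i$, $w_0$ the longest Weyl group element, $(\cdot,\cdot)$ on weights is the invariant form with $(\alpha_i,\alpha_i)=2$. Put $a=(\alpha_s,\alpha_s)=2$, $w=(\omega_s,\omega_s)$, $m=(\omega_s,2\rho)=r$. $V(\lambda)$ is the simple type 1 module of highest weight $\lambda$, $V=V(\omega_s)$, and $V^*$ is its dual with $(Xf)(v)=f(S(X)v)$, $S$ the antipode. $\hat{R}_{X,Y}:X\otimes Y\to Y\otimes X$ is the braiding on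 finite-dimensional type 1 modules determined by being a module map with $\hat{R}_{V(\lambda),V(\mu)}(v\otimes u)=q^{(\lambda,w_0\mu)}u\otimes v$ for $v$ a highest weight vector of $V(\lambda)$ and $u$ a lowest weight vector of $V(\mu)$. Let $(v_i)$ be a weight basis of $V$ with weights $\lambda_i$ and dual basis $(f^i)$ of $V^*$. Define $\mathsf{E}(f^i\otimes v_j)=\delta_{ij}$, $\mathsf{E}'(v_i\otimes f^j)=q^{(\lambda_i,2\rho)}\delta_{ij}$, $\mathsf{C}=\sum_i v_i\otimes f^i$, $\mathsf{C}'=\sum_i q^{-(\lambda_i,2\rho)}f^i\otimes v_i$. Also $\mathrm{qdim}(V)=\sum_i q^{(\lambda_i,2\rho)}$. Subscripts indicate the tensor legs on which a map acts ($\mathsf{C}_n,\mathsf{C}'_n$ insert the element at legs $n,n+1$); products of maps are compositions (rightmost first), legs being renumbered after each contraction or insertion. Put $$\mathsf{S}_{123}=(\hat{R}_{V,V^*})_{23}(\hat{R}_{V,V})_{12}(\hat{R}_{V,V^*}^{-1})_{23},\quad \tilde{\mathsf{S}}_{234}=(\hat{R}_{V,V^*})_{23}(\hat{R}_{V^*,V^*}^{-1})_{34}(\hat{R}_{V,V^*}^{-1})_{23},\quad \mathsf{T}_{1234}=\mathsf{S}_{123}\tilde{\mathsf{S}}_{234}=\tilde{\mathsf{S}}_{234}\mathsf{S}_{123}$$ (acting on $V\otimes V^*\otimes V$, $V^*\otimes V\otimes V^*$, $V\otimes V^*\otimes V\otimes V^*$ at the indicated legs). **Index-free notation.** A family $x=(x^{ij})_{1\le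 i,j\le r+1}$ is identified with $\sum_{i,j}v_i\otimes f^j\otimes x^{ij}$; products of families $xy$ (also $x\otimes y$, $x\wedge y$, $(x,y)$) denote $\sum v_i\otimes f^j\otimes v_k\otimes f^l\otimes x^{ij}y^{kl}$ (resp. with $\otimes_{\mathcal{B}}$, $\wedge$, the inverse metric), and similarly for more factors. The maps above act on the $V,V^*$ legs; other maps act on components. Elements such as $g_{+-}$ below carry no legs. **Algebra and first-order calculus.** $\mathcal{B}$ is the unital algebra generated by $p^{ij}$, $1\le i,j\le r+1$, with relations $\mathsf{S}_{123}pp=q^{w}pp$, $\tilde{\mathsf{S}}_{234}pp=q^{-w}pp$, $\mathsf{E}'_{12}p=q^{m}$. The Heckenberger–Kolb first-order differential calculus is $\Omega=\Omega_+\oplus\Omega_-$, with $\Omega_+,\Omega_-$ generated as left $\mathcal{B}$-modules by $\partial p^{ij}$, resp. $\bar\partial p^{ij}$, with relations $$\tilde{\mathsf{S}}_{234}p\,\partial p=q^{-w}p\,\partial p,\quad \mathsf{E}'_{12}\partial p=0,\qquad \mathsf{S}_{123}p\,\bar\partial p=q^{w}p\,\bar\partial p,\quad \mathsf{E}'_{12}\bar\partial p=0,$$ right module structure $\partial p\,p=q^{a}\mathsf{T}_{1234}p\,\partial p$, $\bar\partial p\,p=q^{-a}\mathsf{T}_{1234}p\,\bar\partial p$, and differential $\mathrm{d}=\partial+\bar\partial$, where $\partial,\bar\partial:\mathcal{B}\to\Omega_\pm$ are the derivations with $p^{ij}\mapsto\partial p^{ij},\bar\partial p^{ij}$. **Universal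 calculus.** $\Omega^\bullet$ is the quotient of the tensor algebra $T_{\mathcal{B}}(\Omega)$ by the two-sided ideal generated by $\{\sum_i\mathrm{d}a_i\otimes\mathrm{d}b_i:\sum_i a_i\mathrm{d}b_i=0\}\subset\Omega\otimes_{\mathcal{B}}\Omega$; its product is $\wedge$, and $\mathrm{d}(a\,\mathrm{d}b)=\mathrm{d}a\wedge\mathrm{d}b$. **Metric and inverse metric.** $g=g_{+-}+g_{-+}$ with $g_{+-}=\mathsf{E}'_{12}\mathsf{E}_{23}\,\partial p\otimes\bar\partial p$ and $g_{-+}=\mathsf{E}'_{12}\mathsf{E}_{23}\,\bar\partial p\otimes\partial p$ in $\Omega\otimes_{\mathcal{B}}\Omega$ (central elements). The inverse metric is the (well-defined) $\mathcal{B}$-bimodule map $(\cdot,\cdot):\Omega\otimes_{\mathcal{B}}\Omega\to\mathcal{B}$ with $(\partial p,\partial p)=(\bar\partial p,\bar\partial p)=0$, $(\partial p,\bar\partial p)=q^{a}q^{-w-m}\mathsf{S}_{123}\mathsf{C}_3p-q^{a}q^{-m}pp$, $(\bar\partial p,\partial p)=\mathsf{C}'_2p-q^{-m}pp$. **Connection and Riemann tensor.** The quantum Levi-Civita connection is the (well-defined) linear map $\nabla:\Omega\to\Omega\otimes_{\mathcal{B}}\Omega$ with $\nabla(b\omega)=\mathrm{d}b\otimes\omega+b\nabla(\omega)$ and $$\nabla(\partial p)=q^{a}\mathsf{E}_{23}\mathsf{T}_{1234}\,\bar\partial p\otimes\partial p-q^{a}q^{-m}\,p\,g_{-+},\qquad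 \nabla(\bar\partial p)=\mathsf{E}_{23}\,\partial p\otimes\bar\partial p-q^{-m}\,p\,g_{+-}.$$ The Riemann tensor is $R_\nabla:=(\mathrm{d}\otimes\mathrm{id}-(\wedge\otimes\mathrm{id})\circ(\mathrm{id}\otimes\nabla))\circ\nabla:\Omega\to\Omega^2\otimes_{\mathcal{B}}\Omega$. **Generalized braiding.** $\sigma$ is the (well-defined) $\mathcal{B}$-bimodule map $\Omega\otimes_{\mathcal{B}}\Omega\to\Omega\otimes_{\mathcal{B}}\Omega$ given by $$\sigma(\partial p\otimes\partial p)=q^{a}\mathsf{S}_{123}\tilde{\mathsf{S}}_{234}\,\partial p\otimes\partial p,\qquad \sigma(\bar\partial p\otimes\bar\partial p)=q^{-a}\mathsf{S}_{123}\tilde{\mathsf{S}}_{234}\,\bar\partial p\otimes\bar\partial p,$$ $$\sigma(\partial p\otimes\bar\partial p)=q^{2a-2w}\mathsf{S}_{123}\tilde{\mathsf{S}}_{234}^{-1}\,\bar\partial p\otimes\partial p+(1-q^{a})q^{a}q^{-m}\,p\,g_{-+}\,p,$$ $$\sigma(\bar\partial p\otimes\partial p)=q^{2w-2a}\mathsf{S}_{123}^{-1}\tilde{\mathsf{S}}_{234}\,\partial p\otimes\bar\partial p+(1-q^{-a})q^{-m}\,p\,g_{+-}\,p.$$ **Splitting map.** For scalars with $c_{+-}+c_{-+}=1$, the $\mathcal{B}$-bimodule map $s_\wedge:\Omega^2\to\Omega\otimes_{\mathcal{B}}\Omega$ (satisfying $\wedge\circ s_\wedge=\mathrm{id}$)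 is induced from $\Omega\otimes_{\mathcal{B}}\Omega$ by: $\frac{1}{1+q^{-a}}(\mathrm{id}-q^{-a}\sigma)$ on $\Omega_+\otimes_{\mathcal{B}}\Omega_+$, $\frac{1}{1+q^{a}}(\mathrm{id}-q^{a}\sigma)$ on $\Omega_-\otimes_{\mathcal{B}}\Omega_-$, $c_{+-}\mathrm{id}-c_{-+}\sigma$ on $\Omega_+\otimes_{\mathcal{B}}\Omega_-$, $c_{-+}\mathrm{id}-c_{+-}\sigma$ on $\Omega_-\otimes_{\mathcal{B}}\Omega_+$. **Ricci tensor.** With $\Phi:=((\cdot,\cdot)\otimes\mathrm{id}\otimes\mathrm{id})\circ(\mathrm{id}\otimes s_\wedge\otimes\mathrm{id})\circ(\mathrm{id}\otimes R_\nabla)$, one puts $\mathrm{Ricci}:=\Phi(g)\in\Omega\otimes_{\mathcal{B}}\Omega$, $\mathrm{Ricci}_{+-}:=\Phi(g_{+-})$, $\mathrm{Ricci}_{-+}:=\Phi(g_{-+})$. *)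

theory Defs
  imports "HOL-Analysis.Analysis" "HOL-Library.Poly_Mapping"
begin

section \<open>Complex vector spaces, unital complex algebras, formal linear combinations\<close>

class complex_vector = ab_group_add +
  fixes scaleC :: "complex \<Rightarrow> 'a \<Rightarrow> 'a"  (infixr "*\<^sub>C" 75)
  assumes scaleC_add_right: "c *\<^sub>C (x + y) = c *\<^sub>C x + c *\<^sub>C y"
    and scaleC_add_left: "(c + d) *\<^sub>C x = c *\<^sub>C x + d *\<^sub>C x"
    and scaleC_scaleC: "c *\<^sub>C d *\<^sub>C x = (c * d) *\<^sub>C x"
    and scaleC_one: "1 *\<^sub>C x = x"

class complex_algebra_1 = complex_vector + ring_1 +
  assumes mult_scaleC_left: "(c *\<^sub>C x) * y = c *\<^sub>C (x * y)"
    and mult_scaleC_right: "x * (c *\<^sub>C y) = c *\<^sub>C (x * y)"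

lemma scaleC_zero_right: "c *\<^sub>C (0 :: 'a :: complex_vector) = 0"
  using scaleC_add_right[of c 0 "0 :: 'a"] by simp

instantiation complex :: complex_vector
begin
definition scaleC_complex :: "complex \<Rightarrow> complex \<Rightarrow> complex"
  where "scaleC_complex c x = c * x"
instance
  by standard (simp_all add: scaleC_complex_def algebra_simps)
end

instantiation poly_mapping :: (type, complex_vector) complex_vector
begin
definition scaleC_poly_mapping :: "complex \<Rightarrow> ('a \<Rightarrow>\<^sub>0 'b) \<Rightarrow> 'a \<Rightarrow>\<^sub>0 'b"
  where "scaleC_poly_mapping c f = Poly_Mapping.map (scaleC c) f"
instance
proof
  have lookup_scaleC: "Poly_Mapping.lookup (c *\<^sub>C f) k = c *\<^sub>C Poly_Mapping.lookup f k"
    for c k and f :: "'a \<Rightarrow>\<^sub>0 'b"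
    unfolding scaleC_poly_mapping_def
    by transfer (simp add: when_def scaleC_zero_right)
  fix c d :: complex and f g :: "'a \<Rightarrow>\<^sub>0 'b"
  show "c *\<^sub>C (f + g) = c *\<^sub>C f + c *\<^sub>C g"
    by (rule poly_mapping_eqI) (simp add: lookup_scaleC lookup_add scaleC_add_right)
  show "(c + d) *\<^sub>C f = c *\<^sub>C f + d *\<^sub>C f"
    by (rule poly_mapping_eqI) (simp add: lookup_scaleC lookup_add scaleC_add_left)
  show "c *\<^sub>C d *\<^sub>C f = (c * d) *\<^sub>C f"
    by (rule poly_mapping_eqI) (simp add: lookup_scaleC scaleC_scaleC)
  show "1 *\<^sub>C f = f"
    by (rule poly_mapping_eqI) (simp add: lookup_scaleC scaleC_one)
qed
end

text \<open>With concatenation as addition of exponents, \<open>'x list \<Rightarrow>\<^sub>0 complex\<close>, with the product of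
  \<^theory>\<open>HOL-Library.Poly_Mapping\<close>, is the free unital algebra on \<open>'x\<close>.\<close>

instantiation list :: (type) monoid_add
begin
definition zero_list :: "'a list" where "zero_list = []"
definition plus_list :: "'a list \<Rightarrow> 'a list \<Rightarrow> 'a list" where "plus_list = (@)"
instance
  by standard (simp_all add: zero_list_def plus_list_def)
end

definition clinear :: "('a :: complex_vector \<Rightarrow> 'b :: complex_vector) \<Rightarrow> bool" where
  "clinear h \<longleftrightarrow> (\<forall>x y. h (x + y) = h x + h y) \<and> (\<forall>c x. h (c *\<^sub>C x) = c *\<^sub>C h x)"

definition csubspace :: "'a :: complex_vector set \<Rightarrow> bool" where
  "csubspace N \<longleftrightarrow> 0 \<in> N \<and> (\<forall>x\<in>N. \<forall>y\<in>N. x + y \<in> N) \<and> (\<forall>c. \<forall>x\<in>N. c *\<^sub>C x \<in> N)"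


section \<open>Weights of type A\<close>

text \<open>A weight of \<open>sl\<close>(r+1) is given by its coordinates \<open>\<mu> 1, \<dots>, \<mu> (r+1)\<close> (with sum zero) in
  the standard realization, in which the invariant form is the Euclidean one, the simple roots
  are \<open>\<epsilon>\<^sub>i - \<epsilon>\<^sub>i\<^sub>+\<^sub>1\<close> and the Weyl group permutes the coordinates. Values of \<open>\<mu>\<close> at other arguments
  are irrelevant.\<close>

type_synonym weight = "nat \<Rightarrow> real"

definition wform :: "nat \<Rightarrow> weight \<Rightarrow> weight \<Rightarrow> real" where
  "wform r \<mu> \<nu> = (\<Sum>k = 1..r + 1. \<mu> k * \<nu> k)"

definition sroot :: "nat \<Rightarrow> weight" where
  "sroot i = (\<lambda>k. if k = i then 1 else if k = i + 1 then - 1 else 0)"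

definition fund_weight :: "nat \<Rightarrow> nat \<Rightarrow> weight" where
  "fund_weight r i = (\<lambda>k. (if k \<le> i then 1 else 0) - real i / real (r + 1))"

definition rho :: "nat \<Rightarrow> weight" where
  "rho r = (\<lambda>k. \<Sum>i = 1..r. fund_weight r i k)"

definition two_rho :: "nat \<Rightarrow> weight" where
  "two_rho r = (\<lambda>k. 2 * rho r k)"

definition longest :: "nat \<Rightarrow> weight \<Rightarrow> weight" where
  "longest r \<mu> = (\<lambda>k. \<mu> (r + 2 - k))"

definition is_weight :: "nat \<Rightarrow> weight \<Rightarrow> bool" where
  "is_weight r \<mu> \<longleftrightarrow>
     (\<Sum>k = 1..r + 1. \<mu> k) = 0 \<and> (\<forall>i\<in>{1..r}. wform r (sroot i) \<mu> \<in> \<int>)"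


section \<open>Finite-dimensional modules over the quantized enveloping algebra\<close>

text \<open>A module with a chosen basis indexed by \<open>'i\<close> is given by the matrices of the generators.\<close>

record 'i uq_module =
  Kmat :: "nat \<Rightarrow> complex^'i^'i"
  Emat :: "nat \<Rightarrow> complex^'i^'i"
  Fmat :: "nat \<Rightarrow> complex^'i^'i"

definition is_uq_module :: "real \<Rightarrow> nat \<Rightarrow> 'i::finite uq_module \<Rightarrow> bool" where
  "is_uq_module q r X \<longleftrightarrow>
    (\<forall>i\<in>{1..r}. invertible (Kmat X i)) \<and>
    (\<forall>i\<in>{1..r}. \<forall>j\<in>{1..r}.
       Kmat X i ** Kmat X j = Kmat X j ** Kmat X i \<and>
       Kmat X i ** Emat X j ** matrix_inv (Kmat X i)
         = (q powr wform r (sroot i) (sroot j)) *\<^sub>R Emat X j \<and>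
       Kmat X i ** Fmat X j ** matrix_inv (Kmat X i)
         = (q powr (- wform r (sroot i) (sroot j))) *\<^sub>R Fmat X j \<and>
       Emat X i ** Fmat X j - Fmat X j ** Emat X i
         = (if i = j then (1 / (q - inverse q)) *\<^sub>R (Kmat X i - matrix_inv (Kmat X i)) else 0) \<and>
       (i + 1 = j \<or> j + 1 = i \<longrightarrow>
         Emat X i ** Emat X i ** Emat X j - (q + inverse q) *\<^sub>R (Emat X i ** Emat X j ** Emat X i)
           + Emat X j ** Emat X i ** Emat X i = 0 \<and>
         Fmat X i ** Fmat X i ** Fmat X j - (q + inverse q) *\<^sub>R (Fmat X i ** Fmat X j ** Fmat X i)
           + Fmat X j ** Fmat X i ** Fmat X i = 0) \<and>
       (i + 1 < j \<or> j + 1 < i \<longrightarrow>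
         Emat X i ** Emat X j = Emat X j ** Emat X i \<and>
         Fmat X i ** Fmat X j = Fmat X j ** Fmat X i))"

definition has_weight :: "real \<Rightarrow> nat \<Rightarrow> 'i::finite uq_module \<Rightarrow> weight \<Rightarrow> complex^'i \<Rightarrow> bool" where
  "has_weight q r X \<mu> v \<longleftrightarrow> is_weight r \<mu> \<and> v \<noteq> 0 \<and>
     (\<forall>i\<in>{1..r}. Kmat X i *v v = (q powr wform r (sroot i) \<mu>) *\<^sub>R v)"

definition highest_vec :: "real \<Rightarrow> nat \<Rightarrow> 'i::finite uq_module \<Rightarrow> weight \<Rightarrow> complex^'i \<Rightarrow> bool" where
  "highest_vec q r X \<mu> v \<longleftrightarrow> has_weight q r X \<mu> v \<and> (\<forall>i\<in>{1..r}. Emat X i *v v = 0)"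

definition lowest_vec :: "real \<Rightarrow> nat \<Rightarrow> 'i::finite uq_module \<Rightarrow> complex^'i \<Rightarrow> bool" where
  "lowest_vec q r X u \<longleftrightarrow> (\<exists>\<nu>. has_weight q r X \<nu> u) \<and> (\<forall>i\<in>{1..r}. Fmat X i *v u = 0)"

definition is_simple :: "nat \<Rightarrow> 'i::finite uq_module \<Rightarrow> bool" where
  "is_simple r X \<longleftrightarrow>
    (\<forall>W. vec.subspace W \<and>
         (\<forall>i\<in>{1..r}. \<forall>v\<in>W. Kmat X i *v v \<in> W \<and> Emat X i *v v \<in> W \<and> Fmat X i *v v \<in> W)
         \<longrightarrow> W = {0} \<or> W = UNIV)"

definition kron :: "complex^'i^'i \<Rightarrow> complex^'j^'j \<Rightarrow> complex^('i \<times> 'j)^('i \<times> 'j)" where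
  "kron A B = (\<chi> x y. A $ fst x $ fst y * B $ snd x $ snd y)"

definition vtensor :: "complex^'i \<Rightarrow> complex^'j \<Rightarrow> complex^('i \<times> 'j)" where
  "vtensor v u = (\<chi> x. v $ fst x * u $ snd x)"

definition tensor_module ::
  "'i::finite uq_module \<Rightarrow> 'j::finite uq_module \<Rightarrow> ('i \<times> 'j) uq_module" where
  "tensor_module X Y = \<lparr>
     Kmat = (\<lambda>i. kron (Kmat X i) (Kmat Y i)),
     Emat = (\<lambda>i. kron (Emat X i) (Kmat Y i) + kron (mat 1) (Emat Y i)),
     Fmat = (\<lambda>i. kron (Fmat X i) (mat 1) + kron (matrix_inv (Kmat X i)) (Fmat Y i)) \<rparr>"

text \<open>The dual module in the dual basis: the transposes of the antipodes
  \<open>K\<^sup>-\<^sup>1\<close>, \<open>- E K\<^sup>-\<^sup>1\<close>, \<open>- K F\<close> of \<open>K\<close>, \<open>E\<close>, \<open>F\<close>.\<close>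

definition dual_module :: "'i::finite uq_module \<Rightarrow> 'i uq_module" where
  "dual_module X = \<lparr>
     Kmat = (\<lambda>i. transpose (matrix_inv (Kmat X i))),
     Emat = (\<lambda>i. transpose (- (Emat X i ** matrix_inv (Kmat X i)))),
     Fmat = (\<lambda>i. transpose (- (Kmat X i ** Fmat X i))) \<rparr>"

text \<open>The braiding \<open>X \<otimes> Y \<rightarrow> Y \<otimes> X\<close>, for simple modules \<open>X\<close> and \<open>Y\<close>. The conditions
  determine it, since the tensor of a highest and a lowest weight vector generates \<open>X \<otimes> Y\<close>.\<close>

definition is_braiding ::
  "real \<Rightarrow> nat \<Rightarrow> 'i::finite uq_module \<Rightarrow> 'j::finite uq_module \<Rightarrow>
     complex^('i \<times> 'j)^('j \<times> 'i) \<Rightarrow> bool" where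
  "is_braiding q r X Y R \<longleftrightarrow>
    (\<forall>i\<in>{1..r}.
       R ** Kmat (tensor_module X Y) i = Kmat (tensor_module Y X) i ** R \<and>
       R ** Emat (tensor_module X Y) i = Emat (tensor_module Y X) i ** R \<and>
       R ** Fmat (tensor_module X Y) i = Fmat (tensor_module Y X) i ** R) \<and>
    (\<forall>\<kappa> \<mu> v y u. highest_vec q r X \<kappa> v \<and> highest_vec q r Y \<mu> y \<and> lowest_vec q r Y u \<longrightarrow>
       R *v vtensor v u = (q powr wform r \<kappa> (longest r \<mu>)) *\<^sub>R vtensor u v)"

text \<open>\<open>VV\<close>, \<open>VD\<close>, \<open>DD\<close> are the braidings of \<open>V\<close> with \<open>V\<close>, of \<open>V\<close> with \<open>V\<^sup>*\<close>, and of \<open>V\<^sup>*\<close> with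
  \<open>V\<^sup>*\<close>, and \<open>wt i\<close> is the weight of the \<open>i\<close>-th basis vector of \<open>V\<close>.\<close>

record 'n quantum_data =
  qpar :: real
  rnk :: nat
  node :: nat
  Vmod :: "'n uq_module"
  wt :: "'n \<Rightarrow> weight"
  VV :: "complex^('n \<times> 'n)^('n \<times> 'n)"
  VD :: "complex^('n \<times> 'n)^('n \<times> 'n)"
  DD :: "complex^('n \<times> 'n)^('n \<times> 'n)"

definition is_quantum_data :: "'n::finite quantum_data \<Rightarrow> bool" where
  "is_quantum_data Q \<longleftrightarrow>
     0 < qpar Q \<and> qpar Q < 1 \<and>
     1 \<le> rnk Q \<and> CARD('n) = rnk Q + 1 \<and> node Q \<in> {1, rnk Q} \<and>
     is_uq_module (qpar Q) (rnk Q) (Vmod Q) \<and> is_simple (rnk Q) (Vmod Q) \<and>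
     (\<exists>v. highest_vec (qpar Q) (rnk Q) (Vmod Q) (fund_weight (rnk Q) (node Q)) v) \<and>
     (\<forall>i. has_weight (qpar Q) (rnk Q) (Vmod Q) (wt Q i) (axis i 1)) \<and>
     is_braiding (qpar Q) (rnk Q) (Vmod Q) (Vmod Q) (VV Q) \<and>
     is_braiding (qpar Q) (rnk Q) (Vmod Q) (dual_module (Vmod Q)) (VD Q) \<and>
     is_braiding (qpar Q) (rnk Q) (dual_module (Vmod Q)) (dual_module (Vmod Q)) (DD Q)"

definition qpow :: "'n quantum_data \<Rightarrow> real \<Rightarrow> complex" where
  "qpow Q x = complex_of_real (qpar Q powr x)"

definition a_num :: "'n quantum_data \<Rightarrow> real" where
  "a_num Q = wform (rnk Q) (sroot (node Q)) (sroot (node Q))"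

definition w_num :: "'n quantum_data \<Rightarrow> real" where
  "w_num Q = wform (rnk Q) (fund_weight (rnk Q) (node Q)) (fund_weight (rnk Q) (node Q))"

definition m_num :: "'n quantum_data \<Rightarrow> real" where
  "m_num Q = wform (rnk Q) (fund_weight (rnk Q) (node Q)) (two_rho (rnk Q))"

definition qdim :: "'n::finite quantum_data \<Rightarrow> complex" where
  "qdim Q = (\<Sum>i\<in>UNIV. qpow Q (wform (rnk Q) (wt Q i) (two_rho (rnk Q))))"


section \<open>Index-free notation\<close>

text \<open>A family with \<open>k\<close> legs is a function on index lists of length \<open>k\<close> (its values on other lists
  are irrelevant). A linear map from \<open>a\<close> legs to \<open>b\<close> legs is given by its matrix, whose first
  argument is the output index; \<open>on_legs n a b M x\<close> applies it to the legs \<open>n, \<dots>, n+a-1\<close>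
  (counted from 1) of \<open>x\<close>.\<close>

type_synonym ('n, 'x) family = "'n list \<Rightarrow> 'x"
type_synonym 'n leg_map = "'n list \<Rightarrow> 'n list \<Rightarrow> complex"

definition on_legs :: "nat \<Rightarrow> nat \<Rightarrow> nat \<Rightarrow> 'n::finite leg_map \<Rightarrow>
    ('n, 'x::complex_vector) family \<Rightarrow> ('n, 'x) family" where
  "on_legs n a b M x = (\<lambda>I. \<Sum>J | length J = a.
     M (take b (drop (n - 1) I)) J *\<^sub>C x (take (n - 1) I @ J @ drop (n - 1 + b) I))"

definition fam :: "('n \<Rightarrow> 'n \<Rightarrow> 'x) \<Rightarrow> ('n, 'x) family" where
  "fam x = (\<lambda>I. x (I ! 0) (I ! 1))"

text \<open>Product of families, the first of which has two legs.\<close>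

definition fam_prod ::
  "('x \<Rightarrow> 'y \<Rightarrow> 'z) \<Rightarrow> ('n, 'x) family \<Rightarrow> ('n, 'y) family \<Rightarrow> ('n, 'z) family" where
  "fam_prod f x y = (\<lambda>I. f (x (take 2 I)) (y (drop 2 I)))"

definition braid_map :: "complex^('n \<times> 'n)^('n \<times> 'n) \<Rightarrow> 'n::finite leg_map" where
  "braid_map R = (\<lambda>I J. R $ (I ! 0, I ! 1) $ (J ! 0, J ! 1))"

definition on23 :: "complex^('n \<times> 'n)^('n \<times> 'n) \<Rightarrow>
    ('n::finite, 'x::complex_vector) family \<Rightarrow> ('n, 'x) family" where
  "on23 R = on_legs 2 2 2 (braid_map R)"

definition S123 :: "'n::finite quantum_data \<Rightarrow>
    ('n, 'x::complex_vector) family \<Rightarrow> ('n, 'x) family" where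
  "S123 Q x = on23 (VD Q) (on_legs 1 2 2 (braid_map (VV Q)) (on23 (matrix_inv (VD Q)) x))"

definition S123_inv :: "'n::finite quantum_data \<Rightarrow>
    ('n, 'x::complex_vector) family \<Rightarrow> ('n, 'x) family" where
  "S123_inv Q x =
     on23 (VD Q) (on_legs 1 2 2 (braid_map (matrix_inv (VV Q))) (on23 (matrix_inv (VD Q)) x))"

definition St234 :: "'n::finite quantum_data \<Rightarrow>
    ('n, 'x::complex_vector) family \<Rightarrow> ('n, 'x) family" where
  "St234 Q x =
     on23 (VD Q) (on_legs 3 2 2 (braid_map (matrix_inv (DD Q))) (on23 (matrix_inv (VD Q)) x))"

definition St234_inv :: "'n::finite quantum_data \<Rightarrow>
    ('n, 'x::complex_vector) family \<Rightarrow> ('n, 'x) family" where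
  "St234_inv Q x = on23 (VD Q) (on_legs 3 2 2 (braid_map (DD Q)) (on23 (matrix_inv (VD Q)) x))"

definition T1234 :: "'n::finite quantum_data \<Rightarrow>
    ('n, 'x::complex_vector) family \<Rightarrow> ('n, 'x) family" where
  "T1234 Q x = S123 Q (St234 Q x)"

definition E23 :: "('n::finite, 'x::complex_vector) family \<Rightarrow> ('n, 'x) family" where
  "E23 = on_legs 2 2 0 (\<lambda>I J. if J ! 0 = J ! 1 then 1 else 0)"

definition E'12 :: "'n::finite quantum_data \<Rightarrow>
    ('n, 'x::complex_vector) family \<Rightarrow> ('n, 'x) family" where
  "E'12 Q = on_legs 1 2 0
     (\<lambda>I J. if J ! 0 = J ! 1 then qpow Q (wform (rnk Q) (wt Q (J ! 0)) (two_rho (rnk Q))) else 0)"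

definition C3 :: "('n::finite, 'x::complex_vector) family \<Rightarrow> ('n, 'x) family" where
  "C3 = on_legs 3 0 2 (\<lambda>I J. if I ! 0 = I ! 1 then 1 else 0)"

definition C'2 :: "'n::finite quantum_data \<Rightarrow>
    ('n, 'x::complex_vector) family \<Rightarrow> ('n, 'x) family" where
  "C'2 Q = on_legs 2 0 2
     (\<lambda>I J. if I ! 0 = I ! 1 then qpow Q (- wform (rnk Q) (wt Q (I ! 0)) (two_rho (rnk Q))) else 0)"


section \<open>Algebras, modules and bimodules by generators and relations\<close>

definition two_sided_ideal :: "'a::ring_1 set \<Rightarrow> bool" where
  "two_sided_ideal N \<longleftrightarrow> 0 \<in> N \<and> (\<forall>x\<in>N. \<forall>y\<in>N. x + y \<in> N) \<and>
     (\<forall>a. \<forall>x\<in>N. a * x \<in> N \<and> x * a \<in> N)"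

definition alg_eval :: "('x \<Rightarrow> 'b::complex_algebra_1) \<Rightarrow> ('x list \<Rightarrow>\<^sub>0 complex) \<Rightarrow> 'b" where
  "alg_eval p f = (\<Sum>u\<in>Poly_Mapping.keys f. Poly_Mapping.lookup f u *\<^sub>C prod_list (map p u))"

definition presented_algebra ::
  "('x \<Rightarrow> 'b::complex_algebra_1) \<Rightarrow> ('x list \<Rightarrow>\<^sub>0 complex) set \<Rightarrow> bool" where
  "presented_algebra p rels \<longleftrightarrow>
     range (alg_eval p) = UNIV \<and> {f. alg_eval p f = 0} = two_sided_ideal hull rels"

record ('b, 'm) bimod =
  lact :: "'b \<Rightarrow> 'm \<Rightarrow> 'm"
  ract :: "'m \<Rightarrow> 'b \<Rightarrow> 'm"

definition is_bimodule :: "('b::complex_algebra_1, 'm::complex_vector) bimod \<Rightarrow> bool" where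
  "is_bimodule M \<longleftrightarrow>
     (\<forall>b. clinear (lact M b)) \<and> (\<forall>x. clinear (\<lambda>b. lact M b x)) \<and>
     (\<forall>b. clinear (\<lambda>x. ract M x b)) \<and> (\<forall>x. clinear (ract M x)) \<and>
     (\<forall>x. lact M 1 x = x \<and> ract M x 1 = x) \<and>
     (\<forall>b c x. lact M (b * c) x = lact M b (lact M c x)) \<and>
     (\<forall>b c x. ract M x (b * c) = ract M (ract M x b) c) \<and>
     (\<forall>b c x. lact M b (ract M x c) = ract M (lact M b x) c)"

definition bimodule_map ::
  "('b, 'm::complex_vector) bimod \<Rightarrow> ('b, 'k::complex_vector) bimod \<Rightarrow> ('m \<Rightarrow> 'k) \<Rightarrow> bool" where
  "bimodule_map M K h \<longleftrightarrow> clinear h \<and>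
     (\<forall>b x. h (lact M b x) = lact K b (h x)) \<and> (\<forall>b x. h (ract M x b) = ract K (h x) b)"

definition subbimodule :: "('b, 'm::complex_vector) bimod \<Rightarrow> 'm set \<Rightarrow> bool" where
  "subbimodule M N \<longleftrightarrow> csubspace N \<and> (\<forall>b. \<forall>x\<in>N. lact M b x \<in> N \<and> ract M x b \<in> N)"

definition base_bimod :: "('b::complex_algebra_1, 'b) bimod" where
  "base_bimod = \<lparr> lact = (*), ract = (*) \<rparr>"

text \<open>\<open>'x \<Rightarrow>\<^sub>0 'b\<close> is the free left module on \<open>'x\<close>.\<close>

definition free_lact :: "'b::ring_1 \<Rightarrow> ('x \<Rightarrow>\<^sub>0 'b) \<Rightarrow> ('x \<Rightarrow>\<^sub>0 'b)" where
  "free_lact b f = Poly_Mapping.map (\<lambda>c. b * c) f"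

definition free_submodule :: "('x \<Rightarrow>\<^sub>0 'b::ring_1) set \<Rightarrow> bool" where
  "free_submodule N \<longleftrightarrow> 0 \<in> N \<and> (\<forall>x\<in>N. \<forall>y\<in>N. x + y \<in> N) \<and> (\<forall>b. \<forall>x\<in>N. free_lact b x \<in> N)"

definition left_eval ::
  "('b::complex_algebra_1, 'm::complex_vector) bimod \<Rightarrow> ('x \<Rightarrow> 'm) \<Rightarrow> ('x \<Rightarrow>\<^sub>0 'b) \<Rightarrow> 'm" where
  "left_eval M e f = (\<Sum>x\<in>Poly_Mapping.keys f. lact M (Poly_Mapping.lookup f x) (e x))"

definition presented_left_module :: "('b::complex_algebra_1, 'm::complex_vector) bimod \<Rightarrow> 'm set \<Rightarrow>
    ('x \<Rightarrow> 'm) \<Rightarrow> ('x \<Rightarrow>\<^sub>0 'b) set \<Rightarrow> bool" where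
  "presented_left_module M A e rels \<longleftrightarrow>
     range (left_eval M e) = A \<and> {f. left_eval M e f = 0} = free_submodule hull rels"

text \<open>\<open>t\<close> exhibits \<open>T\<close> as the tensor product of \<open>M\<close> and \<open>N\<close> over the base algebra: \<open>T\<close> is the
  quotient of the vector space with basis the pairs by the bilinearity and balancing relations.\<close>

definition tensor_relations :: "('b, 'm::complex_vector) bimod \<Rightarrow> ('b, 'k::complex_vector) bimod \<Rightarrow>
    ('m \<times> 'k \<Rightarrow>\<^sub>0 complex) set" where
  "tensor_relations M N =
     {Poly_Mapping.single (x + x', y) 1 - Poly_Mapping.single (x, y) 1
        - Poly_Mapping.single (x', y) 1 | x x' y. True} \<union>
     {Poly_Mapping.single (x, y + y') 1 - Poly_Mapping.single (x, y) 1
        - Poly_Mapping.single (x, y') 1 | x y y'. True} \<union>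
     {Poly_Mapping.single (c *\<^sub>C x, y) 1 - Poly_Mapping.single (x, y) c | c x y. True} \<union>
     {Poly_Mapping.single (x, c *\<^sub>C y) 1 - Poly_Mapping.single (x, y) c | c x y. True} \<union>
     {Poly_Mapping.single (ract M x b, y) 1 - Poly_Mapping.single (x, lact N b y) 1 | b x y. True}"

definition tensor_eval ::
  "('m \<Rightarrow> 'k \<Rightarrow> 't::complex_vector) \<Rightarrow> ('m \<times> 'k \<Rightarrow>\<^sub>0 complex) \<Rightarrow> 't" where
  "tensor_eval t f = (\<Sum>z\<in>Poly_Mapping.keys f. Poly_Mapping.lookup f z *\<^sub>C t (fst z) (snd z))"

definition is_tensor_product ::
  "('b::complex_algebra_1, 'm::complex_vector) bimod \<Rightarrow> ('b, 'k::complex_vector) bimod \<Rightarrow>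
     ('b, 't::complex_vector) bimod \<Rightarrow> ('m \<Rightarrow> 'k \<Rightarrow> 't) \<Rightarrow> bool" where
  "is_tensor_product M N T t \<longleftrightarrow>
     is_bimodule T \<and>
     range (tensor_eval t) = UNIV \<and>
     {f. tensor_eval t f = 0} = csubspace hull tensor_relations M N \<and>
     (\<forall>b x y. lact T b (t x y) = t (lact M b x) y) \<and>
     (\<forall>b x y. ract T (t x y) b = t x (ract N y b))"

text \<open>The linear map on the tensor product given on pure tensors by \<open>x \<otimes> y \<mapsto> f x y\<close>. It exists and
  is unique as soon as \<open>f\<close> is bilinear and balanced.\<close>

definition tensor_lift ::
  "('m \<Rightarrow> 'k \<Rightarrow> 't::complex_vector) \<Rightarrow> ('m \<Rightarrow> 'k \<Rightarrow> 'z::complex_vector) \<Rightarrow> 't \<Rightarrow> 'z" where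
  "tensor_lift t f = (THE h. clinear h \<and> (\<forall>x y. h (t x y) = f x y))"


section \<open>The Heckenberger--Kolb calculus and its universal extension\<close>

text \<open>\<open>'b\<close> is the algebra, \<open>'w\<close> the bimodule \<open>\<Omega>\<close> of one-forms, \<open>'t\<close> is \<open>\<Omega> \<otimes> \<Omega>\<close>, \<open>'v\<close> is \<open>\<Omega>\<^sup>2\<close> and
  \<open>'u\<close> is \<open>\<Omega>\<^sup>2 \<otimes> \<Omega>\<close>; \<open>quo\<close> is the quotient map \<open>\<Omega> \<otimes> \<Omega> \<rightarrow> \<Omega>\<^sup>2\<close>, \<open>del\<close> and \<open>delb\<close> are the two
  derivations with values in \<open>\<Omega>\<close>, and \<open>dd\<close> is the differential \<open>\<Omega> \<rightarrow> \<Omega>\<^sup>2\<close>.\<close>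

record ('n, 'b, 'w, 't, 'v, 'u) calculus =
  gen :: "'n \<Rightarrow> 'n \<Rightarrow> 'b"
  Om :: "('b, 'w) bimod"
  del :: "'b \<Rightarrow> 'w"
  delb :: "'b \<Rightarrow> 'w"
  OmOm :: "('b, 't) bimod"
  ten :: "'w \<Rightarrow> 'w \<Rightarrow> 't"
  Om2 :: "('b, 'v) bimod"
  quo :: "'t \<Rightarrow> 'v"
  dd :: "'w \<Rightarrow> 'v"
  Om2Om :: "('b, 'u) bimod"
  ten2 :: "'v \<Rightarrow> 'w \<Rightarrow> 'u"

definition dB :: "('n, 'b, 'w::plus, 't, 'v, 'u) calculus \<Rightarrow> 'b \<Rightarrow> 'w" where
  "dB A b = del A b + delb A b"

definition wedge :: "('n, 'b, 'w, 't, 'v, 'u) calculus \<Rightarrow> 'w \<Rightarrow> 'w \<Rightarrow> 'v" where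
  "wedge A x y = quo A (ten A x y)"

definition pfam :: "('n, 'b, 'w, 't, 'v, 'u) calculus \<Rightarrow> ('n, 'b) family" where
  "pfam A = fam (gen A)"

definition delp :: "('n, 'b, 'w, 't, 'v, 'u) calculus \<Rightarrow> ('n, 'w) family" where
  "delp A = fam (\<lambda>i j. del A (gen A i j))"

definition delbp :: "('n, 'b, 'w, 't, 'v, 'u) calculus \<Rightarrow> ('n, 'w) family" where
  "delbp A = fam (\<lambda>i j. delb A (gen A i j))"

definition algebra_relations :: "'n::finite quantum_data \<Rightarrow> (('n \<times> 'n) list \<Rightarrow>\<^sub>0 complex) set" where
  "algebra_relations Q =
    (let g = fam (\<lambda>i j. Poly_Mapping.single [(i, j)] 1); gg = fam_prod (*) g g
     in {S123 Q gg I - qpow Q (w_num Q) *\<^sub>C gg I | I. length I = 4} \<union>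
        {St234 Q gg I - qpow Q (- w_num Q) *\<^sub>C gg I | I. length I = 4} \<union>
        {E'12 Q g [] - qpow Q (m_num Q) *\<^sub>C 1})"

text \<open>The relations of \<open>\<Omega>\<^sub>+\<close> and \<open>\<Omega>\<^sub>-\<close>, as elements of the free left module on the symbols
  \<open>\<partial>p\<^sup>i\<^sup>j\<close> resp. the symbols for the antiholomorphic differentials.\<close>

definition plus_relations :: "'n::finite quantum_data \<Rightarrow>
    ('n, 'b::complex_algebra_1, 'w, 't, 'v, 'u) calculus \<Rightarrow> ('n \<times> 'n \<Rightarrow>\<^sub>0 'b) set" where
  "plus_relations Q A =
    (let e = fam (\<lambda>i j. Poly_Mapping.single (i, j) 1); pe = fam_prod free_lact (pfam A) e
     in {St234 Q pe I - qpow Q (- w_num Q) *\<^sub>C pe I | I. length I = 4} \<union> {E'12 Q e []})"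

definition minus_relations :: "'n::finite quantum_data \<Rightarrow>
    ('n, 'b::complex_algebra_1, 'w, 't, 'v, 'u) calculus \<Rightarrow> ('n \<times> 'n \<Rightarrow>\<^sub>0 'b) set" where
  "minus_relations Q A =
    (let e = fam (\<lambda>i j. Poly_Mapping.single (i, j) 1); pe = fam_prod free_lact (pfam A) e
     in {S123 Q pe I - qpow Q (w_num Q) *\<^sub>C pe I | I. length I = 4} \<union> {E'12 Q e []})"

definition Om_plus ::
  "('n, 'b::complex_algebra_1, 'w::complex_vector, 't, 'v, 'u) calculus \<Rightarrow> 'w set" where
  "Om_plus A = range (left_eval (Om A) (\<lambda>(i, j). del A (gen A i j)))"

definition Om_minus ::
  "('n, 'b::complex_algebra_1, 'w::complex_vector, 't, 'v, 'u) calculus \<Rightarrow> 'w set" where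
  "Om_minus A = range (left_eval (Om A) (\<lambda>(i, j). delb A (gen A i j)))"

definition is_derivation ::
  "('b::complex_algebra_1, 'w::complex_vector) bimod \<Rightarrow> ('b \<Rightarrow> 'w) \<Rightarrow> bool" where
  "is_derivation M D \<longleftrightarrow> clinear D \<and> (\<forall>x y. D (x * y) = ract M (D x) y + lact M x (D y))"

definition is_hk_calculus :: "'n::finite quantum_data \<Rightarrow>
    ('n, 'b::complex_algebra_1, 'w::complex_vector, 't, 'v, 'u) calculus \<Rightarrow> bool" where
  "is_hk_calculus Q A \<longleftrightarrow>
    presented_algebra (\<lambda>(i, j). gen A i j) (algebra_relations Q) \<and>
    is_bimodule (Om A) \<and>
    is_derivation (Om A) (del A) \<and> is_derivation (Om A) (delb A) \<and>
    presented_left_module (Om A) (Om_plus A) (\<lambda>(i, j). del A (gen A i j)) (plus_relations Q A) \<and>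
    presented_left_module (Om A) (Om_minus A) (\<lambda>(i, j). delb A (gen A i j)) (minus_relations Q A) \<and>
    Om_plus A \<inter> Om_minus A = {0} \<and> (\<forall>x. \<exists>y\<in>Om_plus A. \<exists>z\<in>Om_minus A. x = y + z) \<and>
    (\<forall>I. length I = 4 \<longrightarrow>
       fam_prod (ract (Om A)) (delp A) (pfam A) I
         = qpow Q (a_num Q) *\<^sub>C T1234 Q (fam_prod (lact (Om A)) (pfam A) (delp A)) I) \<and>
    (\<forall>I. length I = 4 \<longrightarrow>
       fam_prod (ract (Om A)) (delbp A) (pfam A) I
         = qpow Q (- a_num Q) *\<^sub>C T1234 Q (fam_prod (lact (Om A)) (pfam A) (delbp A)) I)"

text \<open>The ideal defining the universal calculus is generated in degree two, so its degree two part
  is the sub-bimodule of \<open>\<Omega> \<otimes> \<Omega>\<close> generated by the given elements.\<close>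

definition is_universal_calculus ::
  "('n, 'b::complex_algebra_1, 'w::complex_vector, 't::complex_vector,
     'v::complex_vector, 'u::complex_vector) calculus \<Rightarrow> bool" where
  "is_universal_calculus A \<longleftrightarrow>
    is_tensor_product (Om A) (Om A) (OmOm A) (ten A) \<and>
    is_bimodule (Om2 A) \<and> bimodule_map (OmOm A) (Om2 A) (quo A) \<and> surj (quo A) \<and>
    {x. quo A x = 0} = subbimodule (OmOm A) hull
      {\<Sum>k<n. ten A (dB A (a k)) (dB A (b k)) | (n::nat) a b.
         (\<Sum>k<n. lact (Om A) (a k) (dB A (b k))) = 0} \<and>
    clinear (dd A) \<and>
    (\<forall>a b. dd A (lact (Om A) a (dB A b)) = wedge A (dB A a) (dB A b)) \<and>
    is_tensor_product (Om2 A) (Om A) (Om2Om A) (ten2 A)"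


section \<open>Metric, connection, curvature\<close>

definition g_pm :: "'n::finite quantum_data \<Rightarrow>
    ('n, 'b, 'w, 't::complex_vector, 'v, 'u) calculus \<Rightarrow> 't" where
  "g_pm Q A = E'12 Q (E23 (fam_prod (ten A) (delp A) (delbp A))) []"

definition g_mp :: "'n::finite quantum_data \<Rightarrow>
    ('n, 'b, 'w, 't::complex_vector, 'v, 'u) calculus \<Rightarrow> 't" where
  "g_mp Q A = E'12 Q (E23 (fam_prod (ten A) (delbp A) (delp A))) []"

definition g_metric :: "'n::finite quantum_data \<Rightarrow>
    ('n, 'b, 'w, 't::complex_vector, 'v, 'u) calculus \<Rightarrow> 't" where
  "g_metric Q A = g_pm Q A + g_mp Q A"

definition is_inverse_metric :: "'n::finite quantum_data \<Rightarrow>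
    ('n, 'b::complex_algebra_1, 'w, 't::complex_vector, 'v, 'u) calculus \<Rightarrow> ('t \<Rightarrow> 'b) \<Rightarrow> bool" where
  "is_inverse_metric Q A ip \<longleftrightarrow>
    bimodule_map (OmOm A) base_bimod ip \<and>
    (let pair = fam_prod (\<lambda>x y. ip (ten A x y)); p = pfam A; pp = fam_prod (*) p p
     in \<forall>I. length I = 4 \<longrightarrow>
       pair (delp A) (delp A) I = 0 \<and>
       pair (delbp A) (delbp A) I = 0 \<and>
       pair (delp A) (delbp A) I =
         (qpow Q (a_num Q) * qpow Q (- w_num Q - m_num Q)) *\<^sub>C S123 Q (C3 p) I
         - (qpow Q (a_num Q) * qpow Q (- m_num Q)) *\<^sub>C pp I \<and>
       pair (delbp A) (delp A) I = C'2 Q p I - qpow Q (- m_num Q) *\<^sub>C pp I)"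

definition is_levi_civita :: "'n::finite quantum_data \<Rightarrow>
    ('n, 'b, 'w::complex_vector, 't::complex_vector, 'v, 'u) calculus \<Rightarrow> ('w \<Rightarrow> 't) \<Rightarrow> bool" where
  "is_levi_civita Q A nabla \<longleftrightarrow>
    clinear nabla \<and>
    (\<forall>b x. nabla (lact (Om A) b x) = ten A (dB A b) x + lact (OmOm A) b (nabla x)) \<and>
    (\<forall>I. length I = 2 \<longrightarrow>
       nabla (delp A I) =
         qpow Q (a_num Q) *\<^sub>C E23 (T1234 Q (fam_prod (ten A) (delbp A) (delp A))) I
         - (qpow Q (a_num Q) * qpow Q (- m_num Q)) *\<^sub>C lact (OmOm A) (pfam A I) (g_mp Q A) \<and>
       nabla (delbp A I) =
         E23 (fam_prod (ten A) (delp A) (delbp A)) I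
         - qpow Q (- m_num Q) *\<^sub>C lact (OmOm A) (pfam A I) (g_pm Q A))"

text \<open>\<open>wedge_id A \<omega> t\<close> is the image of \<open>\<omega> \<otimes> t\<close> under \<open>\<and> \<otimes> id\<close>, for \<open>t\<close> in \<open>\<Omega> \<otimes> \<Omega>\<close>.\<close>

definition wedge_id ::
  "('n, 'b, 'w, 't::complex_vector, 'v, 'u::complex_vector) calculus \<Rightarrow> 'w \<Rightarrow> 't \<Rightarrow> 'u" where
  "wedge_id A \<omega> = tensor_lift (ten A) (\<lambda>\<eta> \<zeta>. ten2 A (wedge A \<omega> \<eta>) \<zeta>)"

text \<open>Neither \<open>d \<otimes> id\<close> nor \<open>id \<otimes> \<nabla>\<close> is balanced over the algebra on its own; the combination
  \<open>d \<otimes> id - (\<and> \<otimes> id)(id \<otimes> \<nabla>)\<close> is, and it is this map that is lifted.\<close>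

definition riemann ::
  "('n, 'b, 'w, 't::complex_vector, 'v, 'u::complex_vector) calculus \<Rightarrow> ('w \<Rightarrow> 't) \<Rightarrow> 'w \<Rightarrow> 'u" where
  "riemann A nabla x =
     tensor_lift (ten A) (\<lambda>\<omega> \<eta>. ten2 A (dd A \<omega>) \<eta> - wedge_id A \<omega> (nabla \<eta>)) (nabla x)"

definition is_generalized_braiding :: "'n::finite quantum_data \<Rightarrow>
    ('n, 'b::complex_algebra_1, 'w, 't::complex_vector, 'v, 'u) calculus \<Rightarrow> ('t \<Rightarrow> 't) \<Rightarrow> bool" where
  "is_generalized_braiding Q A \<sigma> \<longleftrightarrow>
    bimodule_map (OmOm A) (OmOm A) \<sigma> \<and>
    (let tens = fam_prod (ten A); a = a_num Q; w = w_num Q; m = m_num Q;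
         pgp = (\<lambda>g. fam_prod (\<lambda>b c. lact (OmOm A) b (ract (OmOm A) g c)) (pfam A) (pfam A))
     in \<forall>I. length I = 4 \<longrightarrow>
       \<sigma> (tens (delp A) (delp A) I)
         = qpow Q a *\<^sub>C S123 Q (St234 Q (tens (delp A) (delp A))) I \<and>
       \<sigma> (tens (delbp A) (delbp A) I)
         = qpow Q (- a) *\<^sub>C S123 Q (St234 Q (tens (delbp A) (delbp A))) I \<and>
       \<sigma> (tens (delp A) (delbp A) I)
         = qpow Q (2 * a - 2 * w) *\<^sub>C S123 Q (St234_inv Q (tens (delbp A) (delp A))) I
           + ((1 - qpow Q a) * qpow Q a * qpow Q (- m)) *\<^sub>C pgp (g_mp Q A) I \<and>
       \<sigma> (tens (delbp A) (delp A) I)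
         = qpow Q (2 * w - 2 * a) *\<^sub>C S123_inv Q (St234 Q (tens (delp A) (delbp A))) I
           + ((1 - qpow Q (- a)) * qpow Q (- m)) *\<^sub>C pgp (g_pm Q A) I)"

definition is_splitting_map :: "'n::finite quantum_data \<Rightarrow>
    ('n, 'b::complex_algebra_1, 'w::complex_vector, 't::complex_vector, 'v::complex_vector, 'u) calculus
     \<Rightarrow> ('t \<Rightarrow> 't) \<Rightarrow> complex \<Rightarrow> complex \<Rightarrow> ('v \<Rightarrow> 't) \<Rightarrow> bool" where
  "is_splitting_map Q A \<sigma> c_pm c_mp s \<longleftrightarrow>
    bimodule_map (Om2 A) (OmOm A) s \<and>
    (\<forall>y. quo A (s y) = y) \<and>
    (let a = a_num Q
     in \<forall>x\<in>Om_plus A. \<forall>x'\<in>Om_plus A. \<forall>y\<in>Om_minus A. \<forall>y'\<in>Om_minus A.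
       s (wedge A x x')
         = (1 / (1 + qpow Q (- a))) *\<^sub>C (ten A x x' - qpow Q (- a) *\<^sub>C \<sigma> (ten A x x')) \<and>
       s (wedge A y y')
         = (1 / (1 + qpow Q a)) *\<^sub>C (ten A y y' - qpow Q a *\<^sub>C \<sigma> (ten A y y')) \<and>
       s (wedge A x y) = c_pm *\<^sub>C ten A x y - c_mp *\<^sub>C \<sigma> (ten A x y) \<and>
       s (wedge A y x) = c_mp *\<^sub>C ten A y x - c_pm *\<^sub>C \<sigma> (ten A y x))"


section \<open>The Ricci tensor\<close>

text \<open>\<open>pair_id A ip \<omega> t \<zeta>\<close> is the image of \<open>\<omega> \<otimes> t \<otimes> \<zeta>\<close>, for \<open>t\<close> in \<open>\<Omega> \<otimes> \<Omega>\<close>, under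
  \<open>( , ) \<otimes> id \<otimes> id\<close>, and \<open>split_pair A ip s \<omega> u\<close> is the image of \<open>\<omega> \<otimes> u\<close>, for \<open>u\<close> in
  \<open>\<Omega>\<^sup>2 \<otimes> \<Omega>\<close>, under the composite of \<open>id \<otimes> s \<otimes> id\<close> and \<open>( , ) \<otimes> id \<otimes> id\<close>. In this way
  \<open>ricci_map\<close> is the composite of \<open>id \<otimes> R\<^sub>\<nabla>\<close>, \<open>id \<otimes> s \<otimes> id\<close> and \<open>( , ) \<otimes> id \<otimes> id\<close>.\<close>

definition pair_id :: "('n, 'b, 'w, 't::complex_vector, 'v, 'u) calculus \<Rightarrow> ('t \<Rightarrow> 'b) \<Rightarrow>
    'w \<Rightarrow> 't \<Rightarrow> 'w \<Rightarrow> 't" where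
  "pair_id A ip \<omega> t \<zeta> =
     tensor_lift (ten A) (\<lambda>\<eta> \<eta>'. ten A (lact (Om A) (ip (ten A \<omega> \<eta>)) \<eta>') \<zeta>) t"

definition split_pair :: "('n, 'b, 'w, 't::complex_vector, 'v, 'u::complex_vector) calculus \<Rightarrow>
    ('t \<Rightarrow> 'b) \<Rightarrow> ('v \<Rightarrow> 't) \<Rightarrow> 'w \<Rightarrow> 'u \<Rightarrow> 't" where
  "split_pair A ip s \<omega> = tensor_lift (ten2 A) (\<lambda>\<theta> \<zeta>. pair_id A ip \<omega> (s \<theta>) \<zeta>)"

definition ricci_map :: "('n, 'b, 'w, 't::complex_vector, 'v, 'u::complex_vector) calculus \<Rightarrow>
    ('t \<Rightarrow> 'b) \<Rightarrow> ('w \<Rightarrow> 't) \<Rightarrow> ('v \<Rightarrow> 't) \<Rightarrow> 't \<Rightarrow> 't" where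
  "ricci_map A ip nabla s =
     tensor_lift (ten A) (\<lambda>\<omega> \<eta>. split_pair A ip s \<omega> (riemann A nabla \<eta>))"

definition Ricci :: "'n::finite quantum_data \<Rightarrow>
    ('n, 'b, 'w, 't::complex_vector, 'v, 'u::complex_vector) calculus \<Rightarrow>
    ('t \<Rightarrow> 'b) \<Rightarrow> ('w \<Rightarrow> 't) \<Rightarrow> ('v \<Rightarrow> 't) \<Rightarrow> 't" where
  "Ricci Q A ip nabla s = ricci_map A ip nabla s (g_metric Q A)"

definition Ricci_pm :: "'n::finite quantum_data \<Rightarrow>
    ('n, 'b, 'w, 't::complex_vector, 'v, 'u::complex_vector) calculus \<Rightarrow>
    ('t \<Rightarrow> 'b) \<Rightarrow> ('w \<Rightarrow> 't) \<Rightarrow> ('v \<Rightarrow> 't) \<Rightarrow> 't" where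
  "Ricci_pm Q A ip nabla s = ricci_map A ip nabla s (g_pm Q A)"

definition Ricci_mp :: "'n::finite quantum_data \<Rightarrow>
    ('n, 'b, 'w, 't::complex_vector, 'v, 'u::complex_vector) calculus \<Rightarrow>
    ('t \<Rightarrow> 'b) \<Rightarrow> ('w \<Rightarrow> 't) \<Rightarrow> ('v \<Rightarrow> 't) \<Rightarrow> 't" where
  "Ricci_mp Q A ip nabla s = ricci_map A ip nabla s (g_mp Q A)"

end

theory Submission
  imports Defs "HOL-Library.Function_Algebras"
begin

text \<open>
  \<^bold>\<open>Why the theorem is true.\<close> Write \<open>x y\<close> for the matrix product of two families (contraction of the
  inner \<open>V\<^sup>*\<close> and \<open>V\<close> legs by \<open>E\<close>), \<open>tr\<close> for the quantum trace (\<open>E'\<close>), and \<open>\<partial>p\<close>, \<open>\<delta>p\<close> for the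
  holomorphic and antiholomorphic differentials. The relations make \<open>p\<close> behave like a projection:
  \<open>p p = p\<close>, \<open>p \<partial>p = 0\<close>, \<open>p \<delta>p = \<delta>p\<close>, \<open>\<partial>p p = \<partial>p\<close>, \<open>\<delta>p p = 0\<close> (\<open>cap_pp\<close>, \<open>cap_pdp\<close>, \<open>cap_pdb\<close>, \<open>del_p\<close>).
  So \<open>\<delta>p = p dp\<close>, and \<open>d \<delta>p = \<partial>p \<and> \<delta>p + \<delta>p \<and> \<partial>p\<close>. Let \<open>M = \<delta>p \<otimes> \<partial>p\<close> and \<open>P = \<partial>p \<otimes> \<delta>p\<close> (matrix products).
  Moving \<open>p\<close> through such a product is the braiding \<open>T\<close>, which by naturality commutes with the
  contraction (\<open>move_p\<close>). This gives \<open>M = q\<^sup>-\<^sup>m p g\<^sub>-\<^sub>+\<close> (\<open>M_eq\<close>) and the centrality of \<open>g\<^sub>+\<^sub>-\<close>, and with the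
  Hecke relation it follows that \<open>\<sigma>\<close> maps \<open>g\<^sub>-\<^sub>+\<close> to \<open>g\<^sub>+\<^sub>-\<close> (\<open>sigma_gmp\<close>).

  Pairing with \<open>\<delta>p\<close> on the left kills every tensor in \<open>\<Omega>\<^sub>- \<otimes> \<Omega>\<close>, so only the part of
  \<open>s(d \<delta>p)\<close> in \<open>\<Omega>\<^sub>+ \<otimes> \<Omega>\<^sub>-\<close> matters, and this is \<open>c\<^sub>+\<^sub>- (P - q\<^sup>-\<^sup>m p g\<^sub>+\<^sub>-)\<close>. The pairing turns it into the sum of
  \<open>C' \<delta>p\<close>, \<open>- q\<^sup>-\<^sup>m p \<delta>p\<close> and \<open>- q\<^sup>-\<^sup>m \<delta>p p\<close> (four legs each), times \<open>c\<^sub>+\<^sub>-\<close> (\<open>split_curv\<close>). Insert this into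
  \<open>\<nabla>(\<partial>p) = q\<^sup>a E T(\<delta>p \<otimes> \<partial>p) - q\<^sup>a\<^sup>-\<^sup>m p g\<^sub>-\<^sub>+\<close> and take the total contraction. The first summand of the connection
  contributes \<open>- c\<^sub>+\<^sub>- q\<^sup>a\<^sup>-\<^sup>m g\<^sub>-\<^sub>+\<close> (\<open>qtr_T_curv_pairing\<close>; here \<open>p \<nabla>(\<partial>p) = - M\<close> is the Leibniz rule applied to
  \<open>p \<partial>p = 0\<close>). In the second one \<open>d(p g\<^sub>-\<^sub>+)\<close> leaves \<open>\<partial>p \<and> g\<^sub>-\<^sub>+\<close>, because \<open>\<delta>p p = 0\<close>, and contributes
  \<open>- c\<^sub>+\<^sub>- q\<^sup>a\<^sup>-\<^sup>m (q\<^sup>m qdim(V) - 1) g\<^sub>-\<^sub>+\<close> (\<open>qtr_ip\<close>). The two add up to the claim.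

  \<^bold>\<open>What is used about the braidings.\<close> All manipulations of legs follow from a few properties of the
  braidings: the twist \<open>E R = c E'\<close>, naturality with respect to \<open>E\<close> and \<open>E'\<close> in four forms, and the Hecke
  relations. They are collected in the locale \<open>leg_data\<close>, and they are read off from explicit matrices.
  For these, the weights of \<open>V\<close> are shown to be simple, so that the given basis is, up to scalars and order,
  the chain \<open>v, F v, F F v, \<dots>\<close> generated by the highest weight vector; a braiding is then computed by
  propagating its value on (highest) \<open>\<otimes>\<close> (lowest) with the intertwining property.
\<close>

section \<open>Linear algebra over function spaces\<close>

text \<open>A family with many legs is curried, \<open>'n \<Rightarrow> 'n \<Rightarrow> \<dots> \<Rightarrow> 'v\<close>, and a map that acts on its first legs treats
  the remaining ones as part of the vector space of values. Once functions form a vector space, "leg maps on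
  disjoint legs commute" is just linearity.\<close>

instantiation "fun" :: (type, complex_vector) complex_vector
begin
definition scaleC_fun :: "complex \<Rightarrow> ('a \<Rightarrow> 'b) \<Rightarrow> 'a \<Rightarrow> 'b"
  where "scaleC_fun c f = (\<lambda>x. c *\<^sub>C f x)"
instance
  by standard (simp_all add: scaleC_fun_def fun_eq_iff scaleC_add_right scaleC_add_left
      scaleC_scaleC scaleC_one)
end

lemma scaleC_fun_apply [simp]: "(c *\<^sub>C f) x = c *\<^sub>C f x"
  by (simp add: scaleC_fun_def)

lemma sum_fun_apply: "(\<Sum>a\<in>B. f a) x = (\<Sum>a\<in>B. f a x)"
  by (induction B rule: infinite_finite_induct) auto

declare scaleC_zero_right [simp] scaleC_one [simp]

lemma scaleC_zero_left [simp]: "0 *\<^sub>C (x :: 'a::complex_vector) = 0"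
  using scaleC_add_left[of 0 0 x] by simp

lemma scaleC_minus_right [simp]: "c *\<^sub>C (- x) = - (c *\<^sub>C (x :: 'a::complex_vector))"
  using scaleC_add_right[of c x "- x"] by (simp add: eq_neg_iff_add_eq_0 add.commute)

lemma scaleC_minus_left [simp]: "(- c) *\<^sub>C x = - (c *\<^sub>C (x :: 'a::complex_vector))"
  using scaleC_add_left[of c "- c" x] by (simp add: eq_neg_iff_add_eq_0 add.commute)

lemma scaleC_diff_right: "c *\<^sub>C (x - y) = c *\<^sub>C x - c *\<^sub>C (y :: 'a::complex_vector)"
  using scaleC_add_right[of c x "- y"] by simp

lemma scaleC_diff_left: "(c - d) *\<^sub>C x = c *\<^sub>C x - d *\<^sub>C (x :: 'a::complex_vector)"
  using scaleC_add_left[of c "- d" x] by simp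

lemma scaleC_sum_right: "c *\<^sub>C (\<Sum>a\<in>B. f a) = (\<Sum>a\<in>B. c *\<^sub>C (f a :: 'a::complex_vector))"
  by (induction B rule: infinite_finite_induct) (auto simp: scaleC_add_right)

lemma scaleC_sum_left: "(\<Sum>a\<in>B. f a) *\<^sub>C x = (\<Sum>a\<in>B. f a *\<^sub>C (x :: 'a::complex_vector))"
  by (induction B rule: infinite_finite_induct) (auto simp: scaleC_add_left)

lemma scaleC_cancel: "c \<noteq> 0 \<Longrightarrow> c *\<^sub>C x = c *\<^sub>C y \<longleftrightarrow> x = (y :: 'a::complex_vector)"
  by (metis (no_types) left_inverse scaleC_one scaleC_scaleC)

lemma clinearI:
  "(\<And>x y. h (x + y) = h x + h y) \<Longrightarrow> (\<And>c x. h (c *\<^sub>C x) = c *\<^sub>C h x) \<Longrightarrow> clinear h"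
  by (simp add: clinear_def)

lemma clinear_add: "clinear h \<Longrightarrow> h (x + y) = h x + h y"
  and clinear_scaleC: "clinear h \<Longrightarrow> h (c *\<^sub>C x) = c *\<^sub>C h x"
  by (auto simp: clinear_def)

lemma clinear_0: "clinear h \<Longrightarrow> h 0 = 0"
  using clinear_scaleC[of h 0 0] by simp

lemma clinear_minus: "clinear h \<Longrightarrow> h (- x) = - h x"
  using clinear_scaleC[of h "-1" x] by simp

lemma clinear_diff: "clinear h \<Longrightarrow> h (x - y) = h x - h y"
  using clinear_add[of h x "- y"] clinear_minus[of h y] by simp

lemma clinear_sum: "clinear h \<Longrightarrow> h (\<Sum>a\<in>B. f a) = (\<Sum>a\<in>B. h (f a))"
  by (induction B rule: infinite_finite_induct) (auto simp: clinear_0 clinear_add)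

lemma clinear_apply: "clinear (\<lambda>f. f i)"
  by (simp add: clinear_def)

lemma clinear_compose: "clinear g \<Longrightarrow> clinear h \<Longrightarrow> clinear (\<lambda>x. g (h x))"
  by (simp add: clinear_def)

lemma clinear_pointwise: "clinear L \<Longrightarrow> clinear (\<lambda>x i. L (x i))"
  by (simp add: clinear_def fun_eq_iff)

text \<open>The leg maps on the first two legs: \<open>cap\<close> is \<open>E\<close>, \<open>qcap D\<close> is \<open>E'\<close> and \<open>qcup D\<close> is \<open>C'\<close> when \<open>D\<close> consists of
  the numbers \<open>q\<^sup>(\<^sup>\<lambda>\<^sup>i\<^sup>,\<^sup>2\<^sup>\<rho>\<^sup>)\<close>, and \<open>braid M\<close> is a braiding with matrix \<open>M\<close>. To act on later legs, precompose with
  a \<open>\<lambda>\<close>: \<open>\<lambda>i. braid M (x i)\<close> acts on legs two and three.\<close>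

definition cap :: "('n::finite \<Rightarrow> 'n \<Rightarrow> 'v::complex_vector) \<Rightarrow> 'v" where
  "cap x = (\<Sum>i\<in>UNIV. x i i)"

definition qcap :: "('n::finite \<Rightarrow> complex) \<Rightarrow> ('n \<Rightarrow> 'n \<Rightarrow> 'v::complex_vector) \<Rightarrow> 'v" where
  "qcap D x = (\<Sum>i\<in>UNIV. D i *\<^sub>C x i i)"

definition qcup :: "('n::finite \<Rightarrow> complex) \<Rightarrow> 'v::complex_vector \<Rightarrow> 'n \<Rightarrow> 'n \<Rightarrow> 'v" where
  "qcup D v = (\<lambda>i j. if i = j then inverse (D i) *\<^sub>C v else 0)"

definition braid :: "complex^('n \<times> 'n)^('n \<times> 'n) \<Rightarrow> ('n::finite \<Rightarrow> 'n \<Rightarrow> 'v::complex_vector) \<Rightarrow> 'n \<Rightarrow> 'n \<Rightarrow> 'v"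
  where "braid M x = (\<lambda>i j. \<Sum>k\<in>UNIV. \<Sum>l\<in>UNIV. M $ (i, j) $ (k, l) *\<^sub>C x k l)"

lemma cap_clinear: "clinear L \<Longrightarrow> L (cap x) = cap (\<lambda>i j. L (x i j))"
  by (simp add: cap_def clinear_sum)

lemma qcap_clinear: "clinear L \<Longrightarrow> L (qcap D x) = qcap D (\<lambda>i j. L (x i j))"
  by (simp add: qcap_def clinear_sum clinear_scaleC)

lemma braid_clinear: "clinear L \<Longrightarrow> L (braid M x i j) = braid M (\<lambda>i j. L (x i j)) i j"
  by (simp add: braid_def clinear_sum clinear_scaleC)

lemma qcup_clinear: "clinear L \<Longrightarrow> L (qcup D v i j) = qcup D (L v) i j"
  by (simp add: qcup_def clinear_0 clinear_scaleC)

lemmas cap_apply = cap_clinear[OF clinear_apply]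
lemmas qcap_apply = qcap_clinear[OF clinear_apply]
lemmas braid_apply = braid_clinear[OF clinear_apply]

lemma clinear_cap: "clinear cap"
  by (rule clinearI) (simp_all add: cap_def sum.distrib scaleC_sum_right)

lemma clinear_qcap: "clinear (qcap D)"
  by (rule clinearI)
    (simp_all add: qcap_def sum.distrib scaleC_sum_right scaleC_add_right scaleC_scaleC mult.commute)

lemma clinear_braid: "clinear (braid M)"
  by (rule clinearI)
    (simp_all add: braid_def fun_eq_iff sum.distrib scaleC_sum_right scaleC_add_right scaleC_scaleC mult.commute)

lemma braid_mat_1: "braid (mat 1) x = x"
proof (intro ext)
  fix i j
  have "braid (mat 1) x i j = (\<Sum>k\<in>UNIV. \<Sum>l\<in>UNIV. if k = i then (if l = j then x k l else 0) else 0)"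
    unfolding braid_def mat_def by (intro sum.cong refl) auto
  also have "\<dots> = (\<Sum>k\<in>UNIV. if k = i then x k j else 0)"
    by (intro sum.cong refl) (auto simp: sum.delta)
  also have "\<dots> = x i j" by (simp add: sum.delta)
  finally show "braid (mat 1) x i j = x i j" .
qed

lemma braid_braid: "braid M (braid M' x) = braid (M ** M') (x :: 'n::finite \<Rightarrow> 'n \<Rightarrow> 'v::complex_vector)"
proof (intro ext)
  fix i j
  have p: "(\<Sum>k\<in>UNIV. \<Sum>l\<in>UNIV. f k l) = (\<Sum>z\<in>UNIV. f (fst z) (snd z))" for f :: "'n \<Rightarrow> 'n \<Rightarrow> 'v"
    by (simp add: sum.cartesian_product split_def flip: UNIV_Times_UNIV)
  have "braid M (braid M' x) i j = (\<Sum>z\<in>UNIV. \<Sum>y\<in>UNIV. (M $ (i,j) $ z * M' $ z $ y) *\<^sub>C x (fst y) (snd y))"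
    by (simp add: braid_def p scaleC_sum_right scaleC_scaleC)
  also have "\<dots> = (\<Sum>y\<in>UNIV. \<Sum>z\<in>UNIV. (M $ (i,j) $ z * M' $ z $ y) *\<^sub>C x (fst y) (snd y))"
    by (rule sum.swap)
  also have "\<dots> = (\<Sum>y\<in>UNIV. (\<Sum>z\<in>UNIV. M $ (i,j) $ z * M' $ z $ y) *\<^sub>C x (fst y) (snd y))"
    by (simp add: scaleC_sum_left)
  also have "\<dots> = braid (M ** M') x i j"
    by (simp add: braid_def p matrix_matrix_mult_def)
  finally show "braid M (braid M' x) i j = braid (M ** M') x i j" .
qed

text \<open>What the computation needs to know about the three braidings and their inverses. The assumption \<open>twist\<close> is
  \<open>E R\<^sub>V\<^sub>,\<^sub>V\<^sub>* = c E'\<close>; the four \<open>bend\<close> assumptions are the matrix form of the naturality of the braidings with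
  respect to \<open>E\<close> and \<open>E'\<close>: turning one strand of a crossing around gives an inverse crossing.\<close>

locale leg_data =
  fixes VV VD DD VVi VDi DDi :: "complex^('n \<times> 'n)^('n::finite \<times> 'n)"
    and D :: "'n \<Rightarrow> complex" and c h1 h0 k1 k0 :: complex
  assumes VV_inv: "VV ** VVi = mat 1" "VVi ** VV = mat 1"
    and VD_inv: "VD ** VDi = mat 1" "VDi ** VD = mat 1"
    and DD_inv: "DD ** DDi = mat 1" "DDi ** DD = mat 1"
    and D_nonzero: "D i \<noteq> 0" and c_nonzero: "c \<noteq> 0"
    and twist: "(\<Sum>a\<in>UNIV. VD $ (a, a) $ (b, d)) = (if b = d then c * D b else 0)"
    and bend_VVi: "D k * VVi $ (i, k) $ (a, b) = D a * VD $ (a, i) $ (b, k)"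
    and bend_DDi: "D k * DDi $ (k, i) $ (b, a) = D a * VD $ (i, a) $ (k, b)"
    and bend_VDi: "VDi $ (i, e) $ (a, b) = VV $ (a, i) $ (b, e)"
    and bend_VDi': "VDi $ (k, i) $ (b, a) = DD $ (i, a) $ (k, b)"
    and hecke_VV: "VV $ x $ y = h1 * VVi $ x $ y + h0 * mat 1 $ x $ y"
    and hecke_DD: "DDi $ x $ y = k1 * DD $ x $ y + k0 * mat 1 $ x $ y"
begin

lemma braid_inv [simp]:
  "braid VV (braid VVi x) = x" "braid VVi (braid VV x) = x"
  "braid VD (braid VDi x) = x" "braid VDi (braid VD x) = x"
  "braid DD (braid DDi x) = x" "braid DDi (braid DD x) = x"
  by (simp_all add: braid_braid VV_inv VD_inv DD_inv braid_mat_1)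

definition S :: "('n \<Rightarrow> 'n \<Rightarrow> 'n \<Rightarrow> 'v::complex_vector) \<Rightarrow> 'n \<Rightarrow> 'n \<Rightarrow> 'n \<Rightarrow> 'v" where
  "S x = (\<lambda>i. braid VD (braid VV (\<lambda>i. braid VDi (x i)) i))"

definition Sinv :: "('n \<Rightarrow> 'n \<Rightarrow> 'n \<Rightarrow> 'v::complex_vector) \<Rightarrow> 'n \<Rightarrow> 'n \<Rightarrow> 'n \<Rightarrow> 'v" where
  "Sinv x = (\<lambda>i. braid VD (braid VVi (\<lambda>i. braid VDi (x i)) i))"

definition St :: "('n \<Rightarrow> 'n \<Rightarrow> 'n \<Rightarrow> 'v::complex_vector) \<Rightarrow> 'n \<Rightarrow> 'n \<Rightarrow> 'n \<Rightarrow> 'v" where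
  "St x = braid VD (\<lambda>i. braid DDi (braid VDi x i))"

definition Stinv :: "('n \<Rightarrow> 'n \<Rightarrow> 'n \<Rightarrow> 'v::complex_vector) \<Rightarrow> 'n \<Rightarrow> 'n \<Rightarrow> 'n \<Rightarrow> 'v" where
  "Stinv x = braid VD (\<lambda>i. braid DD (braid VDi x i))"

definition T :: "('n \<Rightarrow> 'n \<Rightarrow> 'n \<Rightarrow> 'n \<Rightarrow> 'v::complex_vector) \<Rightarrow> 'n \<Rightarrow> 'n \<Rightarrow> 'n \<Rightarrow> 'n \<Rightarrow> 'v" where
  "T x = S (\<lambda>i. St (x i))"

lemma S_clinear: "clinear L \<Longrightarrow> L (S x i j k) = S (\<lambda>i j k. L (x i j k)) i j k"
proof -
  assume L: "clinear L"
  have "L (S x i j k) = braid VD (\<lambda>j k. L (braid VV (\<lambda>i. braid VDi (x i)) i j k)) j k"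
    unfolding S_def by (rule braid_clinear[OF L])
  also have "(\<lambda>j k. L (braid VV (\<lambda>i. braid VDi (x i)) i j k)) = braid VV (\<lambda>i j k. L (braid VDi (x i) j k)) i"
  proof (intro ext)
    fix j k
    show "L (braid VV (\<lambda>i. braid VDi (x i)) i j k) = braid VV (\<lambda>i j k. L (braid VDi (x i) j k)) i j k"
      using braid_clinear[OF clinear_compose[OF L clinear_apply[of k]], of VV "\<lambda>i. braid VDi (x i)" i j]
        braid_apply[of VV "\<lambda>i j k. L (braid VDi (x i) j k)" i j k] by simp
  qed
  also have "(\<lambda>i j k. L (braid VDi (x i) j k)) = (\<lambda>i. braid VDi (\<lambda>j k. L (x i j k)))"
    by (intro ext braid_clinear[OF L])
  finally show ?thesis by (simp add: S_def)
qed

lemma clinear_S: "clinear S"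
  unfolding S_def
  by (intro clinear_pointwise[OF clinear_braid] clinear_compose[OF clinear_pointwise[OF clinear_braid, of VD]]
      clinear_compose[OF clinear_braid, of _ VV])

lemma braid_pointwise: "clinear L \<Longrightarrow> (\<lambda>i j. L (braid M x i j)) = braid M (\<lambda>i j. L (x i j))"
  by (intro ext braid_clinear)

lemma clinear_Sinv: "clinear Sinv"
  unfolding Sinv_def
  by (intro clinear_pointwise[OF clinear_braid] clinear_compose[OF clinear_pointwise[OF clinear_braid, of VD]]
      clinear_compose[OF clinear_braid, of _ VVi])

lemma clinear_St: "clinear St"
  unfolding St_def
  by (intro clinear_pointwise[OF clinear_braid] clinear_compose[OF clinear_braid, of _ VD]
      clinear_compose[OF clinear_pointwise[OF clinear_braid, of DDi]] clinear_braid)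

lemma clinear_Stinv: "clinear Stinv"
  unfolding Stinv_def
  by (intro clinear_pointwise[OF clinear_braid] clinear_compose[OF clinear_braid, of _ VD]
      clinear_compose[OF clinear_pointwise[OF clinear_braid, of DD]] clinear_braid)

lemma clinear_T: "clinear T"
  unfolding T_def by (rule clinear_compose[OF clinear_S clinear_pointwise[OF clinear_St]])

lemma S_pointwise: "clinear L \<Longrightarrow> (\<lambda>i j k. L (S x i j k)) = S (\<lambda>i j k. L (x i j k))"
  by (intro ext S_clinear)

lemma St_clinear: "clinear L \<Longrightarrow> L (St x i j k) = St (\<lambda>i j k. L (x i j k)) i j k"
proof -
  assume L: "clinear L"
  have "L (St x i j k) = L (braid VD (\<lambda>i. braid DDi (braid VDi x i)) i j k)" by (simp add: St_def)
  also have "\<dots> = braid VD (\<lambda>i j. L (braid DDi (braid VDi x i) j k)) i j"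
    using braid_clinear[OF clinear_compose[OF L clinear_apply[of k]], of VD _ i j] by simp
  also have "\<dots> = braid VD (\<lambda>i j. braid DDi (\<lambda>j k. L (braid VDi x i j k)) j k) i j"
    by (simp add: braid_clinear[OF L])
  also have "(\<lambda>i j k. L (braid VDi x i j k)) = braid VDi (\<lambda>i j k. L (x i j k))"
    by (intro ext) (use braid_pointwise[OF clinear_pointwise[OF L], of VDi x] in \<open>simp add: fun_eq_iff\<close>)
  then have "braid VD (\<lambda>i j. braid DDi (\<lambda>j k. L (braid VDi x i j k)) j k) i j
      = braid VD (\<lambda>i j. braid DDi (braid VDi (\<lambda>i j k. L (x i j k)) i) j k) i j"
    by (simp add: fun_eq_iff)
  also have "\<dots> = St (\<lambda>i j k. L (x i j k)) i j k"
    by (simp add: St_def braid_apply[of VD _ i j k])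
  finally show ?thesis .
qed

lemma St_pointwise: "clinear L \<Longrightarrow> (\<lambda>i j k. L (St x i j k)) = St (\<lambda>i j k. L (x i j k))"
  by (intro ext St_clinear)

lemma T_clinear: "clinear L \<Longrightarrow> L (T x i j k l) = T (\<lambda>i j k l. L (x i j k l)) i j k l"
proof -
  assume L: "clinear L"
  have "L (T x i j k l) = L (S (\<lambda>i. St (x i)) i j k l)" by (simp add: T_def)
  also have "\<dots> = S (\<lambda>i j k l. L (St (x i) j k l)) i j k l"
    using fun_cong[OF S_clinear[OF clinear_pointwise[OF L], of "\<lambda>i. St (x i)" i j k], of l] by simp
  also have "\<dots> = T (\<lambda>i j k l. L (x i j k l)) i j k l"
    by (simp add: T_def St_pointwise[OF L])
  finally show ?thesis .
qed

lemma T_pointwise: "clinear L \<Longrightarrow> (\<lambda>i j k l. L (T x i j k l)) = T (\<lambda>i j k l. L (x i j k l))"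
  by (intro ext T_clinear)

lemma S_Sinv [simp]: "S (Sinv x) = x" "Sinv (S x) = x"
  by (simp_all add: S_def Sinv_def)

lemma St_Stinv [simp]: "St (Stinv x) = x" "Stinv (St x) = x"
  by (simp_all add: St_def Stinv_def)

lemma VV_DDi_commute:
  "braid VV (\<lambda>i j. braid DDi (x i j)) = (\<lambda>i j. braid DDi (braid VV x i j))"
  using braid_pointwise[OF clinear_braid] by metis

text \<open>The order of factors in \<open>T\<close> that shows it as the braiding that carries \<open>V \<otimes> V\<^sup>*\<close> past a further \<open>V\<close> (the inner
  \<open>VV\<close>, \<open>VDi\<close>) and then past a further \<open>V\<^sup>*\<close> (the outer \<open>VD\<close>, \<open>DDi\<close>).\<close>

lemma T_eq: "T x = (\<lambda>i. braid VD (\<lambda>j. braid DDi (braid VV (\<lambda>i. braid VDi (x i)) i j)))"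
  by (simp add: T_def S_def St_def VV_DDi_commute)

lemma S_St_commute: "(\<lambda>i. St (S x i)) = S (\<lambda>i. St (x i))"
  by (simp add: S_def St_def VV_DDi_commute)

lemma T_eq': "T x = (\<lambda>i. St (S x i))"
  by (simp add: T_def S_St_commute)

lemma twist_cap: "cap (braid VD x) = c *\<^sub>C qcap D x"
proof -
  have "cap (braid VD x) = (\<Sum>a\<in>UNIV. \<Sum>k\<in>UNIV. \<Sum>l\<in>UNIV. VD $ (a, a) $ (k, l) *\<^sub>C x k l)"
    by (simp add: cap_def braid_def)
  also have "\<dots> = (\<Sum>k\<in>UNIV. \<Sum>a\<in>UNIV. \<Sum>l\<in>UNIV. VD $ (a, a) $ (k, l) *\<^sub>C x k l)"
    by (rule sum.swap)
  also have "\<dots> = (\<Sum>k\<in>UNIV. \<Sum>l\<in>UNIV. \<Sum>a\<in>UNIV. VD $ (a, a) $ (k, l) *\<^sub>C x k l)"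
    by (intro sum.cong refl sum.swap)
  also have "\<dots> = (\<Sum>k\<in>UNIV. \<Sum>l\<in>UNIV. (\<Sum>a\<in>UNIV. VD $ (a, a) $ (k, l)) *\<^sub>C x k l)"
    by (simp add: scaleC_sum_left)
  also have "\<dots> = (\<Sum>k\<in>UNIV. \<Sum>l\<in>UNIV. if k = l then (c * D k) *\<^sub>C x k k else 0)"
    by (intro sum.cong refl) (simp add: twist)
  also have "\<dots> = c *\<^sub>C qcap D x"
    by (simp add: qcap_def scaleC_sum_right scaleC_scaleC)
  finally show ?thesis .
qed

text \<open>In the next four lemmas a crossing is slid off a contraction; each one is an entrywise reformulation of a
  \<open>bend\<close> assumption.\<close>

lemma qcap_VVi: "(\<lambda>i. qcap D (braid VVi w i)) = qcap D (\<lambda>i. braid VD (w i))"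
proof
  fix i
  have "qcap D (braid VVi w i) = (\<Sum>k\<in>UNIV. \<Sum>a\<in>UNIV. \<Sum>b\<in>UNIV. (D k * VVi $ (i, k) $ (a, b)) *\<^sub>C w a b k)"
    by (simp add: qcap_def braid_def sum_fun_apply scaleC_sum_right scaleC_scaleC)
  also have "\<dots> = (\<Sum>a\<in>UNIV. \<Sum>k\<in>UNIV. \<Sum>b\<in>UNIV. (D a * VD $ (a, i) $ (b, k)) *\<^sub>C w a b k)"
    unfolding bend_VVi by (rule sum.swap)
  also have "\<dots> = (\<Sum>a\<in>UNIV. \<Sum>b\<in>UNIV. \<Sum>k\<in>UNIV. (D a * VD $ (a, i) $ (b, k)) *\<^sub>C w a b k)"
    by (intro sum.cong refl sum.swap)
  also have "\<dots> = qcap D (\<lambda>i. braid VD (w i)) i"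
    by (simp add: qcap_def braid_def sum_fun_apply scaleC_sum_right scaleC_scaleC)
  finally show "qcap D (braid VVi w i) = qcap D (\<lambda>i. braid VD (w i)) i" .
qed

lemma qcap_VD: "(\<lambda>i. qcap D (braid VD w i)) = qcap D (\<lambda>i. braid DDi (w i))"
proof
  fix i
  have "qcap D (\<lambda>i. braid DDi (w i)) i = (\<Sum>k\<in>UNIV. \<Sum>b\<in>UNIV. \<Sum>a\<in>UNIV. (D k * DDi $ (k, i) $ (b, a)) *\<^sub>C w k b a)"
    by (simp add: qcap_def braid_def sum_fun_apply scaleC_sum_right scaleC_scaleC)
  also have "\<dots> = (\<Sum>k\<in>UNIV. \<Sum>a\<in>UNIV. \<Sum>b\<in>UNIV. (D a * VD $ (i, a) $ (k, b)) *\<^sub>C w k b a)"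
    unfolding bend_DDi by (intro sum.cong refl sum.swap)
  also have "\<dots> = (\<Sum>a\<in>UNIV. \<Sum>k\<in>UNIV. \<Sum>b\<in>UNIV. (D a * VD $ (i, a) $ (k, b)) *\<^sub>C w k b a)"
    by (rule sum.swap)
  also have "\<dots> = qcap D (braid VD w i)"
    by (simp add: qcap_def braid_def sum_fun_apply scaleC_sum_right scaleC_scaleC)
  finally show "qcap D (braid VD w i) = qcap D (\<lambda>i. braid DDi (w i)) i" by simp
qed

lemma cap_VV: "cap (\<lambda>i. braid VV (w i)) = (\<lambda>i. cap (braid VDi w i))"
proof
  fix i
  have "cap (\<lambda>i. braid VV (w i)) i = (\<Sum>a\<in>UNIV. \<Sum>b\<in>UNIV. \<Sum>e\<in>UNIV. VV $ (a, i) $ (b, e) *\<^sub>C w a b e)"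
    by (simp add: cap_def braid_def sum_fun_apply)
  also have "\<dots> = (\<Sum>a\<in>UNIV. \<Sum>e\<in>UNIV. \<Sum>b\<in>UNIV. VDi $ (i, e) $ (a, b) *\<^sub>C w a b e)"
    unfolding bend_VDi by (intro sum.cong refl sum.swap)
  also have "\<dots> = (\<Sum>e\<in>UNIV. \<Sum>a\<in>UNIV. \<Sum>b\<in>UNIV. VDi $ (i, e) $ (a, b) *\<^sub>C w a b e)"
    by (rule sum.swap)
  also have "\<dots> = cap (braid VDi w i)"
    by (simp add: cap_def braid_def sum_fun_apply)
  finally show "cap (\<lambda>i. braid VV (w i)) i = cap (braid VDi w i)" .
qed

lemma cap_VDi: "cap (\<lambda>i. braid VDi (w i)) = (\<lambda>i. cap (braid DD w i))"
proof
  fix i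
  have "cap (\<lambda>i. braid VDi (w i)) i = (\<Sum>k\<in>UNIV. \<Sum>b\<in>UNIV. \<Sum>a\<in>UNIV. VDi $ (k, i) $ (b, a) *\<^sub>C w k b a)"
    by (simp add: cap_def braid_def sum_fun_apply)
  also have "\<dots> = (\<Sum>k\<in>UNIV. \<Sum>a\<in>UNIV. \<Sum>b\<in>UNIV. DD $ (i, a) $ (k, b) *\<^sub>C w k b a)"
    unfolding bend_VDi' by (intro sum.cong refl sum.swap)
  also have "\<dots> = (\<Sum>a\<in>UNIV. \<Sum>k\<in>UNIV. \<Sum>b\<in>UNIV. DD $ (i, a) $ (k, b) *\<^sub>C w k b a)"
    by (rule sum.swap)
  also have "\<dots> = cap (braid DD w i)"
    by (simp add: cap_def braid_def sum_fun_apply)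
  finally show "cap (\<lambda>i. braid VDi (w i)) i = cap (braid DD w i)" .
qed

text \<open>The crossing \<open>VD\<close> that ends \<open>St\<close> is absorbed by \<open>E\<close> at the cost of the twist; what remains of \<open>St\<close> then slides
  off \<open>E'\<close>. For \<open>S\<close> the same works with the inverse crossing, whence \<open>cap_Sinv\<close> below; \<open>S\<close> itself, and \<open>E'\<close> after
  \<open>St\<close>, are reached through the Hecke relation.\<close>

lemma cap_St: "cap (St y) = c *\<^sub>C (\<lambda>i. qcap D (y i))"
proof -
  have "cap (St y) = c *\<^sub>C qcap D (\<lambda>i. braid DDi (braid VDi y i))"
    unfolding St_def by (rule twist_cap)
  also have "\<dots> = c *\<^sub>C (\<lambda>i. qcap D (braid VD (braid VDi y) i))"
    by (simp only: qcap_VD)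
  finally show ?thesis by simp
qed

lemma cap_Sinv: "(\<lambda>i. cap (Sinv x i)) = c *\<^sub>C qcap D x"
proof -
  have "(\<lambda>i. cap (Sinv x i)) = (\<lambda>i. c *\<^sub>C qcap D (braid VVi (\<lambda>i. braid VDi (x i)) i))"
    by (simp add: Sinv_def twist_cap)
  also have "\<dots> = c *\<^sub>C (\<lambda>i. qcap D (braid VVi (\<lambda>i. braid VDi (x i)) i))"
    by (simp add: fun_eq_iff)
  also have "\<dots> = c *\<^sub>C qcap D x"
    by (simp only: qcap_VVi) simp
  finally show ?thesis .
qed

lemma braid_hecke: "(\<And>x y. M $ x $ y = a * M' $ x $ y + b * mat 1 $ x $ y) \<Longrightarrow>
    braid M z = a *\<^sub>C braid M' z + b *\<^sub>C z"
proof -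
  assume *: "\<And>x y. M $ x $ y = a * M' $ x $ y + b * mat 1 $ x $ y"
  have "braid M z = a *\<^sub>C braid M' z + b *\<^sub>C braid (mat 1) z"
    by (simp add: braid_def * fun_eq_iff scaleC_add_left sum.distrib scaleC_sum_right scaleC_scaleC)
  then show ?thesis by (simp add: braid_mat_1)
qed

lemma S_hecke: "S x = h1 *\<^sub>C Sinv x + h0 *\<^sub>C x"
proof -
  have "S x = (\<lambda>i. braid VD ((h1 *\<^sub>C braid VVi (\<lambda>i. braid VDi (x i)) + h0 *\<^sub>C (\<lambda>i. braid VDi (x i))) i))"
    unfolding S_def by (simp only: braid_hecke[OF hecke_VV])
  also have "\<dots> = h1 *\<^sub>C Sinv x + h0 *\<^sub>C x"
    by (intro ext) (simp add: clinear_add[OF clinear_braid] clinear_scaleC[OF clinear_braid] Sinv_def)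
  finally show ?thesis .
qed

lemma St_hecke: "St x = k1 *\<^sub>C Stinv x + k0 *\<^sub>C x"
proof -
  have "St x = braid VD (k1 *\<^sub>C (\<lambda>i. braid DD (braid VDi x i)) + k0 *\<^sub>C braid VDi x)"
    unfolding St_def by (simp only: braid_hecke[OF hecke_DD]) (simp add: plus_fun_def scaleC_fun_def)
  also have "\<dots> = k1 *\<^sub>C Stinv x + k0 *\<^sub>C x"
    by (simp add: clinear_add[OF clinear_braid] clinear_scaleC[OF clinear_braid] Stinv_def)
  finally show ?thesis .
qed

lemma cap_S: "(\<lambda>i. cap (S x i)) = (h1 * c) *\<^sub>C qcap D x + h0 *\<^sub>C (\<lambda>i. cap (x i))"
proof -
  have "(\<lambda>i. cap (S x i)) = h1 *\<^sub>C (\<lambda>i. cap (Sinv x i)) + h0 *\<^sub>C (\<lambda>i. cap (x i))"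
    by (intro ext) (simp add: S_hecke[of x] clinear_add[OF clinear_cap] clinear_scaleC[OF clinear_cap])
  then show ?thesis by (simp add: cap_Sinv scaleC_scaleC)
qed

lemma qcap_St: "(\<lambda>i. qcap D (St y i)) = (k1 / c) *\<^sub>C cap y + k0 *\<^sub>C (\<lambda>i. qcap D (y i))"
proof -
  have *: "(\<lambda>i. qcap D (Stinv y i)) = inverse c *\<^sub>C cap y"
    using cap_St[of "Stinv y"] c_nonzero by (simp add: scaleC_scaleC)
  have "(\<lambda>i. qcap D (St y i)) = k1 *\<^sub>C (\<lambda>i. qcap D (Stinv y i)) + k0 *\<^sub>C (\<lambda>i. qcap D (y i))"
    by (intro ext) (simp add: St_hecke[of y] clinear_add[OF clinear_qcap] clinear_scaleC[OF clinear_qcap])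
  then show ?thesis by (simp add: * scaleC_scaleC divide_inverse)
qed

lemma qcap_S: "qcap D (S x) = inverse c *\<^sub>C (\<lambda>i. cap (x i))"
  using cap_Sinv[of "S x"] c_nonzero by (simp add: scaleC_scaleC)

lemma qcap_T: "qcap D (T x) = (\<lambda>i j. qcap D (x i j))"
proof -
  have "qcap D (T x) = inverse c *\<^sub>C (\<lambda>i. cap (St (x i)))"
    by (simp add: T_def qcap_S)
  also have "\<dots> = (\<lambda>i. inverse c *\<^sub>C c *\<^sub>C (\<lambda>j. qcap D (x i j)))"
    by (simp add: cap_St fun_eq_iff)
  finally show ?thesis using c_nonzero by (simp add: scaleC_scaleC)
qed

text \<open>Naturality for a contraction \<open>V\<^sup>* \<otimes> V \<rightarrow> 1\<close>: after \<open>V \<otimes> V\<^sup>*\<close> has been carried past both legs, they can be contracted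
  just as well before.\<close>

lemma cap_past:
  "cap (\<lambda>i. braid VV (\<lambda>j. braid VDi (braid VD (\<lambda>i. braid DDi (y i)) i j))) = (\<lambda>i j. cap (y i j))"
proof -
  have "braid VDi (\<lambda>i j. braid VDi (braid VD (\<lambda>i. braid DDi (y i)) i j)) = (\<lambda>i j. braid VDi (braid DDi (y i) j))"
    by (simp add: braid_pointwise[OF clinear_braid, symmetric])
  then show ?thesis by (simp add: cap_VV cap_VDi)
qed

text \<open>This is \<open>cap_past\<close> inside two consecutive crossings \<open>T\<close>: carrying \<open>V \<otimes> V\<^sup>*\<close> through a product of two families and
  then contracting the product is the same as carrying it through the contracted product.\<close>

lemma T_T_cap: "(\<lambda>i. cap (\<lambda>j. T (T x i j))) = T (\<lambda>i j k. cap (x i j k))"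
proof
  fix i
  define u where "u = braid VV (\<lambda>i. braid VDi (x i))"
  define y where "y = braid VD (\<lambda>j. braid DDi (u i j))"
  have L: "clinear (\<lambda>z. braid VD (\<lambda>j. braid DDi (z j)))"
    by (rule clinear_compose[OF clinear_braid clinear_pointwise[OF clinear_braid]])
  have "T x i j = y j" for j
    by (simp add: T_eq u_def y_def)
  then have "cap (\<lambda>j. T (T x i j))
      = cap (\<lambda>j a. braid VD (\<lambda>k. braid DDi (braid VV (\<lambda>k. braid VDi (y j k)) a k)))"
    by (simp only: T_eq[of "y _"])
  also have "\<dots> = braid VD (\<lambda>k. braid DDi (cap (\<lambda>j. braid VV (\<lambda>k. braid VDi (y j k))) k))"
    using cap_clinear[OF L, of "\<lambda>j. braid VV (\<lambda>k. braid VDi (y j k))"] by simp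
  also have "\<dots> = braid VD (\<lambda>k. braid DDi (\<lambda>l. cap (u i k l)))"
    unfolding y_def cap_past by simp
  also have "(\<lambda>k l. cap (u i k l)) = braid VV (\<lambda>i. braid VDi (\<lambda>j k. cap (x i j k))) i"
  proof -
    have "(\<lambda>i j k. cap (u i j k)) = braid VV (\<lambda>i j k. cap (braid VDi (x i) j k))"
      unfolding u_def by (rule braid_pointwise[OF clinear_pointwise[OF clinear_cap]])
    then show ?thesis
      by (simp add: braid_pointwise[OF clinear_cap] fun_eq_iff)
  qed
  finally show "cap (\<lambda>j. T (T x i j)) = T (\<lambda>i j k. cap (x i j k)) i"
    by (simp add: T_eq fun_eq_iff)
qed

end

section \<open>Presentations and tensor products\<close>

lemma lookup_scaleC: "Poly_Mapping.lookup (c *\<^sub>C f) k = c *\<^sub>C Poly_Mapping.lookup f k"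
  unfolding scaleC_poly_mapping_def by transfer (simp add: when_def)

lemma clinear_scaleC_left: "clinear (\<lambda>c. c *\<^sub>C (x :: 'a::complex_vector))"
  by (rule clinearI) (simp_all add: scaleC_add_left scaleC_scaleC scaleC_complex_def)

text \<open>The common shape of the evaluations of formal linear combinations in a tensor product, an algebra and a left
  module.\<close>

definition keys_sum :: "('c \<Rightarrow> 'x \<Rightarrow> 'v::complex_vector) \<Rightarrow> ('x \<Rightarrow>\<^sub>0 'c::complex_vector) \<Rightarrow> 'v" where
  "keys_sum F f = (\<Sum>x\<in>Poly_Mapping.keys f. F (Poly_Mapping.lookup f x) x)"

context
  fixes F :: "'c::complex_vector \<Rightarrow> 'x \<Rightarrow> 'v::complex_vector"
  assumes F: "\<And>x. clinear (\<lambda>c. F c x)"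
begin

lemma keys_sum_superset:
  assumes "finite B" "Poly_Mapping.keys f \<subseteq> B"
  shows "keys_sum F f = (\<Sum>x\<in>B. F (Poly_Mapping.lookup f x) x)"
  unfolding keys_sum_def
  by (rule sum.mono_neutral_left) (use assms clinear_0[OF F] in \<open>auto simp: in_keys_iff\<close>)

lemma clinear_keys_sum: "clinear (keys_sum F)"
proof (rule clinearI)
  fix f g :: "'x \<Rightarrow>\<^sub>0 'c" and c
  let ?B = "Poly_Mapping.keys f \<union> Poly_Mapping.keys g"
  have B: "finite ?B" by simp
  show "keys_sum F (f + g) = keys_sum F f + keys_sum F g"
    using keys_sum_superset[OF B, of f] keys_sum_superset[OF B, of g]
      keys_sum_superset[OF B keys_add]
    by (simp add: lookup_add clinear_add[OF F] sum.distrib)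
  have "Poly_Mapping.keys (c *\<^sub>C f) \<subseteq> Poly_Mapping.keys f"
    by (auto simp: in_keys_iff lookup_scaleC)
  then show "keys_sum F (c *\<^sub>C f) = c *\<^sub>C keys_sum F f"
    using keys_sum_superset[of "Poly_Mapping.keys f" "c *\<^sub>C f"]
    by (simp add: keys_sum_def lookup_scaleC clinear_scaleC[OF F] scaleC_sum_right)
qed

lemma keys_sum_single: "keys_sum F (Poly_Mapping.single x c) = F c x"
  using keys_sum_superset[of "{x}" "Poly_Mapping.single x c"] by simp

end

lemma tensor_eval_keys_sum: "tensor_eval t = keys_sum (\<lambda>c z. c *\<^sub>C t (fst z) (snd z))"
  by (simp add: fun_eq_iff tensor_eval_def keys_sum_def)

lemma clinear_tensor_eval: "clinear (tensor_eval t)"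
  and tensor_eval_single: "tensor_eval t (Poly_Mapping.single (x, y) c) = c *\<^sub>C t x y"
  unfolding tensor_eval_keys_sum
  by (rule clinear_keys_sum[OF clinear_scaleC_left]) (simp add: keys_sum_single[OF clinear_scaleC_left])

text \<open>The condition under which \<open>tensor_lift\<close> denotes a map.\<close>

definition balanced :: "('b, 'm::complex_vector) bimod \<Rightarrow> ('b, 'k::complex_vector) bimod \<Rightarrow>
    ('m \<Rightarrow> 'k \<Rightarrow> 'z::complex_vector) \<Rightarrow> bool" where
  "balanced M N f \<longleftrightarrow> (\<forall>y. clinear (\<lambda>x. f x y)) \<and> (\<forall>x. clinear (f x)) \<and>
     (\<forall>b x y. f (ract M x b) y = f x (lact N b y))"

text \<open>The kernel of the evaluation of a balanced map is a subspace, and contains the defining relations.\<close>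

lemma tensor_eval_relations:
  assumes f: "balanced M N f" and z: "z \<in> csubspace hull tensor_relations M N"
  shows "tensor_eval f z = 0"
proof -
  note L = clinear_tensor_eval[of f]
  have "csubspace {z. tensor_eval f z = 0}"
    using clinear_add[OF L] clinear_scaleC[OF L] clinear_0[OF L] by (simp add: csubspace_def)
  moreover have "tensor_relations M N \<subseteq> {z. tensor_eval f z = 0}"
  proof -
    have "f (x + x') y = f x y + f x' y" "f x (y + y') = f x y + f x y'"
      "f (c *\<^sub>C x) y = c *\<^sub>C f x y" "f x (c *\<^sub>C y) = c *\<^sub>C f x y"
      "f (ract M x b) y = f x (lact N b y)" for x x' y y' b c
      using f by (simp_all add: balanced_def clinear_def)
    then show ?thesis
      unfolding tensor_relations_def by (auto simp: clinear_diff[OF L] tensor_eval_single)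
  qed
  ultimately have "csubspace hull tensor_relations M N \<subseteq> {z. tensor_eval f z = 0}"
    by (simp add: hull_minimal)
  with z show ?thesis by auto
qed

context
  fixes M :: "('b::complex_algebra_1, 'm::complex_vector) bimod" and N :: "('b, 'k::complex_vector) bimod"
    and T :: "('b, 't::complex_vector) bimod" and t :: "'m \<Rightarrow> 'k \<Rightarrow> 't"
  assumes T: "is_tensor_product M N T t"
begin

lemma tensor_balanced: "balanced M N t"
proof -
  have *: "tensor_eval t z = 0" if "z \<in> tensor_relations M N" for z
    using T hull_inc[OF that, of csubspace] unfolding is_tensor_product_def
    by (metis (mono_tags, lifting) mem_Collect_eq)
  note L = clinear_diff[OF clinear_tensor_eval[of t]] tensor_eval_single
  have "t (x + x') y = t x y + t x' y" for x x' y
  proof -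
    have "Poly_Mapping.single (x + x', y) 1 - Poly_Mapping.single (x, y) 1
        - Poly_Mapping.single (x', y) 1 \<in> tensor_relations M N"
      unfolding tensor_relations_def by blast
    from *[OF this] have "t (x + x') y - t x y - t x' y = 0" by (simp add: L)
    then show ?thesis by (simp add: diff_diff_eq)
  qed
  moreover have "t x (y + y') = t x y + t x y'" for x y y'
  proof -
    have "Poly_Mapping.single (x, y + y') 1 - Poly_Mapping.single (x, y) 1
        - Poly_Mapping.single (x, y') 1 \<in> tensor_relations M N"
      unfolding tensor_relations_def by blast
    from *[OF this] have "t x (y + y') - t x y - t x y' = 0" by (simp add: L)
    then show ?thesis by (simp add: diff_diff_eq)
  qed
  moreover have "t (c *\<^sub>C x) y = c *\<^sub>C t x y" for c x y
  proof -
    have "Poly_Mapping.single (c *\<^sub>C x, y) 1 - Poly_Mapping.single (x, y) c \<in> tensor_relations M N"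
      unfolding tensor_relations_def by blast
    from *[OF this] show ?thesis by (simp add: L)
  qed
  moreover have "t x (c *\<^sub>C y) = c *\<^sub>C t x y" for c x y
  proof -
    have "Poly_Mapping.single (x, c *\<^sub>C y) 1 - Poly_Mapping.single (x, y) c \<in> tensor_relations M N"
      unfolding tensor_relations_def by blast
    from *[OF this] show ?thesis by (simp add: L)
  qed
  moreover have "t (ract M x b) y = t x (lact N b y)" for b x y
  proof -
    have "Poly_Mapping.single (ract M x b, y) 1 - Poly_Mapping.single (x, lact N b y) 1
        \<in> tensor_relations M N"
      unfolding tensor_relations_def by blast
    from *[OF this] show ?thesis by (simp add: L)
  qed
  ultimately show ?thesis by (simp add: balanced_def clinear_def)
qed

lemma tensor_induct [case_names tensor add]:
  assumes t: "\<And>x y. P (t x y)" and a: "\<And>u v. P u \<Longrightarrow> P v \<Longrightarrow> P (u + v)"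
  shows "P z"
proof -
  have "z \<in> range (tensor_eval t)" using T by (simp add: is_tensor_product_def)
  then obtain f where f: "z = (\<Sum>u\<in>Poly_Mapping.keys f. Poly_Mapping.lookup f u *\<^sub>C t (fst u) (snd u))"
    by (auto simp: tensor_eval_def)
  have sc: "c *\<^sub>C t x y = t (c *\<^sub>C x) y" for c x y
    using tensor_balanced clinear_scaleC[of "\<lambda>x. t x y" c x] by (simp add: balanced_def)
  have "P 0" using t[of 0 0] tensor_balanced clinear_0[of "t 0"] by (simp add: balanced_def)
  then have "P (\<Sum>u\<in>B. Poly_Mapping.lookup f u *\<^sub>C t (fst u) (snd u))" for B
    by (induction B rule: infinite_finite_induct) (auto simp: sc intro: t a)
  then show ?thesis by (simp add: f)
qed

lemma tensor_ext:
  assumes "clinear g" "clinear h" "\<And>x y. g (t x y) = h (t x y)"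
  shows "g z = h z"
  by (induction z rule: tensor_induct) (simp_all add: assms(3) clinear_add[OF assms(1)] clinear_add[OF assms(2)])

lemma
  assumes f: "balanced M N f"
  shows clinear_tensor_lift: "clinear (tensor_lift t f)"
    and tensor_lift: "tensor_lift t f (t x y) = f x y"
proof -
  note Lt = clinear_tensor_eval[of t] and Lf = clinear_tensor_eval[of f]
  define pre where "pre z = (SOME u. tensor_eval t u = z)" for z
  have pre: "tensor_eval t (pre z) = z" for z
  proof -
    have "z \<in> range (tensor_eval t)" using T by (simp add: is_tensor_product_def)
    then have "\<exists>u. tensor_eval t u = z" by auto
    then show ?thesis unfolding pre_def by (rule someI_ex)
  qed
  have wd: "tensor_eval f u = tensor_eval f v" if "tensor_eval t u = tensor_eval t v" for u v
  proof -
    have "tensor_eval t (u - v) = 0" by (simp add: clinear_diff[OF Lt] that)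
    then have "u - v \<in> csubspace hull tensor_relations M N"
      using T by (auto simp: is_tensor_product_def)
    from tensor_eval_relations[OF f this] show ?thesis by (simp add: clinear_diff[OF Lf])
  qed
  define h where "h z = tensor_eval f (pre z)" for z
  have h: "h (tensor_eval t u) = tensor_eval f u" for u
    unfolding h_def by (rule wd) (rule pre)
  have "clinear h"
  proof (rule clinearI)
    fix x y c
    have "h (tensor_eval t (pre x + pre y)) = h x + h y"
      unfolding h by (simp add: clinear_add[OF Lf] h_def)
    then show "h (x + y) = h x + h y" by (simp add: clinear_add[OF Lt] pre)
    have "h (tensor_eval t (c *\<^sub>C pre x)) = c *\<^sub>C h x"
      unfolding h by (simp add: clinear_scaleC[OF Lf] h_def)
    then show "h (c *\<^sub>C x) = c *\<^sub>C h x" by (simp add: clinear_scaleC[OF Lt] pre)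
  qed
  moreover have "h (t x y) = f x y" for x y
    using h[of "Poly_Mapping.single (x, y) 1"] by (simp add: tensor_eval_single)
  ultimately have h': "clinear h \<and> (\<forall>x y. h (t x y) = f x y)" by blast
  have "\<exists>!h. clinear h \<and> (\<forall>x y. h (t x y) = f x y)"
  proof (rule ex1I)
    show "clinear h \<and> (\<forall>x y. h (t x y) = f x y)" by (rule h')
  next
    fix g assume "clinear g \<and> (\<forall>x y. g (t x y) = f x y)"
    then have "g z = h z" for z
      using h' tensor_ext[of g h z] by simp
    then show "g = h" ..
  qed
  from theI'[OF this] show "clinear (tensor_lift t f)" "tensor_lift t f (t x y) = f x y"
    unfolding tensor_lift_def[symmetric] by simp_all
qed

end

lemma alg_eval_keys_sum: "alg_eval p = keys_sum (\<lambda>c u. c *\<^sub>C prod_list (map p u))"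
  by (simp add: fun_eq_iff alg_eval_def keys_sum_def)

lemma clinear_alg_eval: "clinear (alg_eval p)"
  and alg_eval_single: "alg_eval p (Poly_Mapping.single u c) = c *\<^sub>C prod_list (map p u)"
  unfolding alg_eval_keys_sum
  by (rule clinear_keys_sum[OF clinear_scaleC_left]) (simp add: keys_sum_single[OF clinear_scaleC_left])

lemma left_eval_keys_sum: "left_eval M e = keys_sum (\<lambda>c x. lact M c (e x))"
  by (simp add: fun_eq_iff left_eval_def keys_sum_def)

lemma
  assumes "is_bimodule M"
  shows clinear_left_eval: "clinear (left_eval M e)"
    and left_eval_single: "left_eval M e (Poly_Mapping.single x b) = lact M b (e x)"
proof -
  have *: "clinear (\<lambda>c. lact M c (e x))" for x
    using assms by (simp add: is_bimodule_def)
  show "clinear (left_eval M e)" "left_eval M e (Poly_Mapping.single x b) = lact M b (e x)"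
    unfolding left_eval_keys_sum
    by (rule clinear_keys_sum[OF *]) (simp add: keys_sum_single[where F = "\<lambda>c x. lact M c (e x)", OF *])
qed

lemma free_lact_single: "free_lact b (Poly_Mapping.single x 1) = Poly_Mapping.single x b"
  unfolding free_lact_def
  by (rule poly_mapping_eqI) (simp add: map.rep_eq lookup_single when_def)

lemma presented_algebra_relation:
  "presented_algebra p rels \<Longrightarrow> f \<in> rels \<Longrightarrow> alg_eval p f = 0"
  using hull_inc[of f rels two_sided_ideal] unfolding presented_algebra_def
  by (metis (mono_tags, lifting) mem_Collect_eq)

lemma presented_left_module_relation:
  "presented_left_module M B e rels \<Longrightarrow> f \<in> rels \<Longrightarrow> left_eval M e f = 0"
  using hull_inc[of f rels free_submodule] unfolding presented_left_module_def
  by (metis (mono_tags, lifting) mem_Collect_eq)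

section \<open>Projection identities in the first-order calculus\<close>

lemma cap_scaleC: "cap (\<lambda>i j. a *\<^sub>C x i j) = a *\<^sub>C cap x"
  by (simp add: cap_def scaleC_sum_right)

lemma qcap_scaleC: "qcap D (\<lambda>i j. a *\<^sub>C x i j) = a *\<^sub>C qcap D x"
  by (simp add: qcap_def scaleC_sum_right scaleC_scaleC mult.commute)

locale calculus_legs = leg_data VV VD DD VVi VDi DDi D c h1 h0 k1 k0
  for VV VD DD VVi VDi DDi :: "complex^('n \<times> 'n)^('n::finite \<times> 'n)"
    and D :: "'n \<Rightarrow> complex" and c h1 h0 k1 k0 :: complex +
  fixes A :: "('n, 'b::complex_algebra_1, 'w::complex_vector, 't::complex_vector,
                'v::complex_vector, 'u::complex_vector) calculus"
    and qa qw qm :: complex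
begin

abbreviation p where "p \<equiv> gen A"
abbreviation dp where "dp \<equiv> \<lambda>i j. del A (gen A i j)"
abbreviation db where "db \<equiv> \<lambda>i j. delb A (gen A i j)"
abbreviation lmul (infixr "\<rhd>" 80) where "b \<rhd> x \<equiv> lact (Om A) b x"
abbreviation rmul (infixl "\<lhd>" 80) where "x \<lhd> b \<equiv> ract (Om A) x b"
abbreviation tens (infixl "\<otimes>" 78) where "x \<otimes> y \<equiv> ten A x y"
abbreviation lmul2 (infixr "\<rhd>\<rhd>" 80) where "b \<rhd>\<rhd> x \<equiv> lact (OmOm A) b x"
abbreviation rmul2 (infixl "\<lhd>\<lhd>" 80) where "x \<lhd>\<lhd> b \<equiv> ract (OmOm A) x b"

definition pp where "pp = (\<lambda>i j k l. p i j * p k l)"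
definition pdp where "pdp = (\<lambda>i j k l. p i j \<rhd> dp k l)"
definition pdb where "pdb = (\<lambda>i j k l. p i j \<rhd> db k l)"
definition dpp where "dpp = (\<lambda>i j k l. dp i j \<lhd> p k l)"
definition dbp where "dbp = (\<lambda>i j k l. db i j \<lhd> p k l)"

text \<open>The matrix products \<open>M\<close> of \<open>\<delta>p\<close> with \<open>\<partial>p\<close> and \<open>P\<close> of \<open>\<partial>p\<close> with \<open>\<delta>p\<close> in \<open>\<Omega> \<otimes> \<Omega>\<close>; their quantum
  traces are the two parts of the metric.\<close>

definition M where "M = (\<lambda>i. cap (\<lambda>j k l. db i j \<otimes> dp k l))"
definition P where "P = (\<lambda>i. cap (\<lambda>j k l. dp i j \<otimes> db k l))"
definition gmp where "gmp = qcap D M"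
definition gpm where "gpm = qcap D P"

end

text \<open>The relations of the first-order calculus in curried form, with \<open>qa\<close>, \<open>qw\<close>, \<open>qm\<close> for \<open>q\<^sup>a\<close>, \<open>q\<^sup>w\<close>, \<open>q\<^sup>m\<close>. In these
  terms the twist is \<open>c = q\<^sup>-\<^sup>w\<^sup>-\<^sup>m\<close>, and the coefficient \<open>k1\<close> of the Hecke relation of \<open>V\<^sup>*\<close> is
  \<open>q\<^sup>2\<^sup>-\<^sup>2\<^sup>w = q\<^sup>a\<^sup>-\<^sup>2\<^sup>w\<close>.\<close>

locale first_order_calculus = calculus_legs +
  assumes scalars_nonzero: "qa \<noteq> 0" "qw \<noteq> 0" "qm \<noteq> 0"
    and c_eq: "c * (qw * qm) = 1"
    and k1_eq: "k1 * (qw * qw) = qa"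
    and Om_bimodule: "is_bimodule (Om A)"
    and del_derivation: "is_derivation (Om A) (del A)"
    and delb_derivation: "is_derivation (Om A) (delb A)"
    and St_pp: "(\<lambda>i. St (pp i)) = inverse qw *\<^sub>C pp"
    and qcap_p: "qcap D p = qm *\<^sub>C 1"
    and St_pdp: "(\<lambda>i. St (pdp i)) = inverse qw *\<^sub>C pdp"
    and S_pdb: "S pdb = qw *\<^sub>C pdb"
    and qcap_dp: "qcap D dp = 0"
    and qcap_db: "qcap D db = 0"
    and dpp_T: "dpp = qa *\<^sub>C T pdp"
    and dbp_T: "dbp = inverse qa *\<^sub>C T pdb"
    and OmOm: "is_tensor_product (Om A) (Om A) (OmOm A) (ten A)"
begin

lemma bim_clinear:
  "clinear (lact (Om A) b)" "clinear (\<lambda>b. b \<rhd> x)" "clinear (\<lambda>x. x \<lhd> b)" "clinear (ract (Om A) x)"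
  using Om_bimodule by (simp_all add: is_bimodule_def)

lemma bim_clinear2:
  "clinear (lact (OmOm A) b)" "clinear (\<lambda>b. b \<rhd>\<rhd> y)" "clinear (\<lambda>y. y \<lhd>\<lhd> b)" "clinear (ract (OmOm A) y)"
  using OmOm by (simp_all add: is_tensor_product_def is_bimodule_def)

lemma bim_assoc:
  "1 \<rhd> x = x" "x \<lhd> 1 = x" "(a * b) \<rhd> x = a \<rhd> b \<rhd> x" "x \<lhd> (a * b) = x \<lhd> a \<lhd> b"
  "a \<rhd> (x \<lhd> b) = (a \<rhd> x) \<lhd> b"
  using Om_bimodule by (simp_all add: is_bimodule_def)

lemma bim_assoc2:
  "1 \<rhd>\<rhd> y = y" "y \<lhd>\<lhd> 1 = y" "(a * b) \<rhd>\<rhd> y = a \<rhd>\<rhd> b \<rhd>\<rhd> y" "y \<lhd>\<lhd> (a * b) = y \<lhd>\<lhd> a \<lhd>\<lhd> b"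
  "a \<rhd>\<rhd> (y \<lhd>\<lhd> b) = (a \<rhd>\<rhd> y) \<lhd>\<lhd> b"
  using OmOm by (simp_all add: is_tensor_product_def is_bimodule_def)

lemma tens_clinear: "clinear (\<lambda>x. x \<otimes> y)" "clinear (ten A x)"
  using tensor_balanced[OF OmOm] by (simp_all add: balanced_def)

lemma tens_act:
  "(x \<lhd> b) \<otimes> y = x \<otimes> (b \<rhd> y)" "b \<rhd>\<rhd> (x \<otimes> y) = (b \<rhd> x) \<otimes> y" "(x \<otimes> y) \<lhd>\<lhd> b = x \<otimes> (y \<lhd> b)"
  using tensor_balanced[OF OmOm] OmOm by (simp_all add: balanced_def is_tensor_product_def)

lemma mult_clinear: "clinear (\<lambda>b. b * (y :: 'b))" "clinear (\<lambda>b. (y :: 'b) * b)"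
  by (simp_all add: clinear_def algebra_simps mult_scaleC_left mult_scaleC_right)

lemma c_eq': "c * qm = inverse qw" "c * qw = inverse qm"
  using c_eq scalars_nonzero by (auto simp: field_simps)

text \<open>The projection identity \<open>p p = p\<close>: apply \<open>E\<close> to the relation for \<open>St\<close>. Since \<open>E\<close> after \<open>St\<close> is \<open>c E'\<close>
  on the last two legs, the relation becomes \<open>c q\<^sup>m p = q\<^sup>-\<^sup>w p p\<close>. The same argument for \<open>p \<partial>p\<close> has \<open>tr(\<partial>p) = 0\<close> in place of
  \<open>tr(p) = q\<^sup>m\<close>; for \<open>p \<delta>p\<close> one uses \<open>S\<close> and the trace of the left factor.\<close>

lemma cap_pp: "(\<lambda>i. cap (pp i)) = p"
proof
  fix i
  have "inverse qw *\<^sub>C cap (pp i) = cap (inverse qw *\<^sub>C pp i)"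
    by (simp add: clinear_scaleC[OF clinear_cap])
  also have "\<dots> = cap (St (pp i))"
    using fun_cong[OF St_pp, of i] by simp
  also have "\<dots> = c *\<^sub>C (\<lambda>j. qcap D (pp i j))" by (rule cap_St)
  also have "(\<lambda>j. qcap D (pp i j)) = qm *\<^sub>C p i"
    using qcap_clinear[OF mult_clinear(2), of "p i _" D p]
    by (simp add: fun_eq_iff pp_def qcap_p mult_scaleC_right)
  finally show "cap (pp i) = p i"
    using scalars_nonzero by (simp add: scaleC_scaleC c_eq' scaleC_cancel fun_eq_iff)
qed

lemma cap_pdp: "(\<lambda>i. cap (pdp i)) = 0"
proof
  fix i
  have "inverse qw *\<^sub>C cap (pdp i) = cap (inverse qw *\<^sub>C pdp i)"
    by (simp add: clinear_scaleC[OF clinear_cap])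
  also have "\<dots> = cap (St (pdp i))"
    using fun_cong[OF St_pdp, of i] by simp
  also have "\<dots> = c *\<^sub>C (\<lambda>j. qcap D (pdp i j))" by (rule cap_St)
  also have "(\<lambda>j. qcap D (pdp i j)) = 0"
    using qcap_clinear[OF bim_clinear(1), of "p i _" D dp]
    by (simp add: fun_eq_iff pdp_def qcap_dp clinear_0[OF bim_clinear(1)])
  finally show "cap (pdp i) = 0 i"
    using scalars_nonzero scaleC_cancel[of "inverse qw" "cap (pdp i) _" 0] by (simp add: fun_eq_iff)
qed

lemma cap_pdb: "(\<lambda>i. cap (pdb i)) = db"
proof -
  have "Sinv pdb = inverse qw *\<^sub>C pdb"
  proof -
    have "pdb = Sinv (qw *\<^sub>C pdb)" using S_pdb S_Sinv(2)[of pdb] by simp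
    then have "pdb = qw *\<^sub>C Sinv pdb" by (simp add: clinear_scaleC[OF clinear_Sinv])
    then show ?thesis using scalars_nonzero
      by (metis (no_types) left_inverse scaleC_one scaleC_scaleC)
  qed
  then have "inverse qw *\<^sub>C (\<lambda>i. cap (pdb i)) = (\<lambda>i. cap (Sinv pdb i))"
    by (simp add: clinear_scaleC[OF clinear_cap]) (simp add: scaleC_fun_def)
  also have "\<dots> = c *\<^sub>C qcap D pdb" by (rule cap_Sinv)
  also have "qcap D pdb = qm *\<^sub>C db"
  proof -
    have "qcap D (\<lambda>i j. p i j \<rhd> y) = qm *\<^sub>C y" for y
      using qcap_clinear[OF bim_clinear(2)[of y], of D p]
      by (simp add: qcap_p clinear_scaleC[OF bim_clinear(2)] bim_assoc)
    then show ?thesis by (simp add: fun_eq_iff pdb_def qcap_apply)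
  qed
  finally show ?thesis
    using scalars_nonzero by (simp add: scaleC_scaleC c_eq' scaleC_cancel fun_eq_iff)
qed

text \<open>Differentiate \<open>p = p p\<close> and insert \<open>p \<partial>p = 0\<close>, respectively \<open>p \<delta>p = \<delta>p\<close>.\<close>

lemma del_p: "(\<lambda>i. cap (dpp i)) = dp" "(\<lambda>i. cap (dbp i)) = 0"
proof -
  have D: "D' (p i l) = cap (\<lambda>j k. D' (p i j) \<lhd> p k l) + cap (\<lambda>j k. p i j \<rhd> D' (p k l))"
    if "is_derivation (Om A) D'" for D' i l
  proof -
    have "D' (p i l) = D' (cap (\<lambda>j k. p i j * p k l))"
      using fun_cong[OF fun_cong[OF cap_pp, of i], of l] by (simp add: cap_apply pp_def)
    also have "\<dots> = cap (\<lambda>j k. D' (p i j * p k l))"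
      using that by (simp add: cap_clinear is_derivation_def)
    also have "\<dots> = cap (\<lambda>j k. D' (p i j) \<lhd> p k l) + cap (\<lambda>j k. p i j \<rhd> D' (p k l))"
      using that by (simp add: is_derivation_def cap_def sum.distrib)
    finally show ?thesis .
  qed
  show "(\<lambda>i. cap (dpp i)) = dp"
  proof (intro ext)
    fix i l
    have "cap (\<lambda>j k. p i j \<rhd> dp k l) = 0"
      using fun_cong[OF fun_cong[OF cap_pdp, of i], of l] by (simp add: cap_apply pdp_def)
    then show "cap (dpp i) l = dp i l"
      using D[OF del_derivation, of i l] by (simp add: cap_apply dpp_def)
  qed
  show "(\<lambda>i. cap (dbp i)) = 0"
  proof (intro ext)
    fix i l
    have "cap (\<lambda>j k. p i j \<rhd> db k l) = db i l"
      using fun_cong[OF fun_cong[OF cap_pdb, of i], of l] by (simp add: cap_apply pdb_def)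
    then show "cap (dbp i) l = 0 i l"
      using D[OF delb_derivation, of i l] by (simp add: cap_apply dbp_def)
  qed
qed

lemma St_dpp: "(\<lambda>i. St (dpp i)) = inverse qw *\<^sub>C dpp"
proof -
  have "(\<lambda>i. St (dpp i)) = qa *\<^sub>C (\<lambda>i. St (S (\<lambda>i. St (pdp i)) i))"
    by (simp add: dpp_T T_def fun_eq_iff clinear_scaleC[OF clinear_St])
  also have "(\<lambda>i. St (S (\<lambda>i. St (pdp i)) i)) = S (\<lambda>i. St (inverse qw *\<^sub>C pdp i))"
    using fun_cong[OF St_pdp] by (simp only: S_St_commute scaleC_fun_apply)
  also have "\<dots> = inverse qw *\<^sub>C S (\<lambda>i. St (pdp i))"
    unfolding clinear_scaleC[OF clinear_St]
    by (simp add: scaleC_fun_def[of _ "\<lambda>i. St (pdp i)", symmetric] clinear_scaleC[OF clinear_S])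
  finally show ?thesis
    by (simp only: dpp_T T_def scaleC_scaleC mult.commute)
qed

text \<open>Both products vanish by inserting a \<open>p\<close> in the middle: \<open>\<partial>p \<partial>p = (\<partial>p p) \<partial>p = \<partial>p (p \<partial>p)\<close>, and
  \<open>\<delta>p \<delta>p = \<delta>p (p \<delta>p) = (\<delta>p p) \<delta>p\<close> for the next lemma.\<close>

lemma cap_dp_dp: "cap (\<lambda>j k. dp i j \<otimes> dp k l) = 0"
proof -
  have dp: "dp i j = cap (\<lambda>a b. dp i a \<lhd> p b j)" for j
    using fun_cong[OF fun_cong[OF del_p(1), of i], of j] by (simp add: cap_apply dpp_def)
  have "cap (\<lambda>j k. dp i j \<otimes> dp k l) = cap (\<lambda>j k. cap (\<lambda>a b. dp i a \<lhd> p b j) \<otimes> dp k l)"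
    by (simp only: dp[symmetric])
  also have "\<dots> = cap (\<lambda>j k. cap (\<lambda>a b. dp i a \<otimes> (p b j \<rhd> dp k l)))"
    by (simp add: cap_clinear[OF tens_clinear(1)] tens_act)
  also have "\<dots> = cap (\<lambda>a b. cap (\<lambda>j k. dp i a \<otimes> (p b j \<rhd> dp k l)))"
    unfolding cap_def by (rule sum.swap)
  also have "\<dots> = cap (\<lambda>a b. dp i a \<otimes> cap (\<lambda>j k. p b j \<rhd> dp k l))"
    by (simp add: cap_clinear[OF tens_clinear(2)])
  also have "\<dots> = cap (\<lambda>a b. dp i a \<otimes> 0)"
  proof -
    have "cap (\<lambda>j k. p b j \<rhd> dp k l) = 0" for b
      using fun_cong[OF fun_cong[OF cap_pdp, of b], of l] by (simp add: cap_apply pdp_def)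
    then show ?thesis by simp
  qed
  finally show ?thesis by (simp add: clinear_0[OF tens_clinear(2)] cap_def)
qed

lemma cap_db_db: "cap (\<lambda>j k. db i j \<otimes> db k l) = 0"
proof -
  have db: "db k l = cap (\<lambda>a b. p k a \<rhd> db b l)" for k
    using fun_cong[OF fun_cong[OF cap_pdb, of k], of l] by (simp add: cap_apply pdb_def)
  have "cap (\<lambda>j k. db i j \<otimes> db k l) = cap (\<lambda>j k. db i j \<otimes> cap (\<lambda>a b. p k a \<rhd> db b l))"
    by (simp only: db[symmetric])
  also have "\<dots> = cap (\<lambda>j k. cap (\<lambda>a b. (db i j \<lhd> p k a) \<otimes> db b l))"
    by (simp add: cap_clinear[OF tens_clinear(2)] tens_act)
  also have "\<dots> = cap (\<lambda>a b. cap (\<lambda>j k. (db i j \<lhd> p k a) \<otimes> db b l))"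
    unfolding cap_def by (rule sum.swap)
  also have "\<dots> = cap (\<lambda>a b. cap (\<lambda>j k. db i j \<lhd> p k a) \<otimes> db b l)"
    by (simp add: cap_clinear[OF tens_clinear(1)])
  also have "\<dots> = cap (\<lambda>a b. 0 \<otimes> db b l)"
  proof -
    have "cap (\<lambda>j k. db i j \<lhd> p k a) = 0" for a
      using fun_cong[OF fun_cong[OF del_p(2), of i], of a] by (simp add: cap_apply dbp_def)
    then show ?thesis by simp
  qed
  finally show ?thesis by (simp add: clinear_0[OF tens_clinear(1)] cap_def)
qed

text \<open>Two differentials of opposite type commute with \<open>p\<close> up to \<open>T\<close> and mutually inverse scalars, so a product of the two
  commutes with \<open>p\<close> up to two factors \<open>T\<close>; \<open>T_T_cap\<close> reduces these to one after contraction.\<close>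

lemma move_p:
  assumes x: "(\<lambda>i j k l. x i j \<lhd> p k l) = a *\<^sub>C T (\<lambda>i j k l. p i j \<rhd> x k l)"
    and y: "(\<lambda>i j k l. y i j \<lhd> p k l) = inverse a *\<^sub>C T (\<lambda>i j k l. p i j \<rhd> y k l)"
    and a: "a \<noteq> 0"
  shows "(\<lambda>i l m n. cap (\<lambda>j k. x i j \<otimes> y k l) \<lhd>\<lhd> p m n)
    = T (\<lambda>i j k n. p i j \<rhd>\<rhd> cap (\<lambda>l m. x k l \<otimes> y m n))"
proof -
  let ?Y = "\<lambda>i j k l m n. p i j \<rhd>\<rhd> (x k l \<otimes> y m n)"
  let ?X = "\<lambda>i j k l m n. x i j \<otimes> (p k l \<rhd> y m n)"
  let ?W = "\<lambda>i j k l m n. (x i j \<otimes> y k l) \<lhd>\<lhd> p m n"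
  have X: "?X = a *\<^sub>C T ?Y"
  proof -
    have L: "clinear (\<lambda>z m n. z \<otimes> y m n)"
      using tens_clinear(1) by (simp add: clinear_def fun_eq_iff)
    have "?X = (\<lambda>i j k l m n. (x i j \<lhd> p k l) \<otimes> y m n)" by (simp add: tens_act)
    also have "\<dots> = (\<lambda>i j k l m n. (a *\<^sub>C T (\<lambda>i j k l. p i j \<rhd> x k l)) i j k l \<otimes> y m n)"
      using x by (simp add: fun_eq_iff)
    also have "\<dots> = a *\<^sub>C (\<lambda>i j k l m n. T (\<lambda>i j k l. p i j \<rhd> x k l) i j k l \<otimes> y m n)"
      by (simp add: fun_eq_iff clinear_scaleC[OF tens_clinear(1)])
    also have "\<dots> = a *\<^sub>C T ?Y"
      by (subst T_pointwise[OF L]) (simp add: tens_act)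
    finally show ?thesis .
  qed
  have W: "?W i j = inverse a *\<^sub>C T (?X i j)" for i j
  proof -
    have "?W i j = (\<lambda>k l m n. x i j \<otimes> (y k l \<lhd> p m n))" by (simp add: tens_act)
    also have "\<dots> = (\<lambda>k l m n. x i j \<otimes> (inverse a *\<^sub>C T (\<lambda>i j k l. p i j \<rhd> y k l)) k l m n)"
      using y by (simp add: fun_eq_iff)
    also have "\<dots> = inverse a *\<^sub>C (\<lambda>k l m n. x i j \<otimes> T (\<lambda>i j k l. p i j \<rhd> y k l) k l m n)"
      by (simp add: fun_eq_iff clinear_scaleC[OF tens_clinear(2)])
    also have "\<dots> = inverse a *\<^sub>C T (?X i j)"
      by (subst T_pointwise[OF tens_clinear(2)]) simp
    finally show ?thesis .
  qed
  have WT: "?W i j = T (T ?Y i j)" for i j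
  proof -
    have "T (a *\<^sub>C T ?Y i j) = a *\<^sub>C T (T ?Y i j)" by (rule clinear_scaleC[OF clinear_T])
    moreover have "?X i j = a *\<^sub>C T ?Y i j" using fun_cong[OF fun_cong[OF X, of i], of j] by simp
    ultimately show ?thesis unfolding W using a by (simp add: scaleC_scaleC)
  qed
  have "(\<lambda>i l m n. cap (\<lambda>j k. x i j \<otimes> y k l) \<lhd>\<lhd> p m n) = (\<lambda>i. cap (\<lambda>j. ?W i j))"
    by (simp add: fun_eq_iff cap_apply cap_clinear[OF bim_clinear2(3)])
  also have "\<dots> = (\<lambda>i. cap (\<lambda>j. T (T ?Y i j)))" by (simp only: WT)
  also have "\<dots> = T (\<lambda>i j k. cap (?Y i j k))" by (rule T_T_cap)
  also have "(\<lambda>i j k. cap (?Y i j k)) = (\<lambda>i j k n. p i j \<rhd>\<rhd> cap (\<lambda>l m. x k l \<otimes> y m n))"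
    by (simp add: fun_eq_iff cap_apply cap_clinear[OF bim_clinear2(1)])
  finally show ?thesis .
qed

lemma M_apply: "M i l = cap (\<lambda>j k. db i j \<otimes> dp k l)"
  and P_apply: "P i l = cap (\<lambda>j k. dp i j \<otimes> db k l)"
  by (simp_all add: M_def P_def cap_apply)

text \<open>Take the trace in \<open>move_p\<close>: \<open>E'\<close> absorbs \<open>T\<close>.\<close>

lemma gpm_central: "gpm \<lhd>\<lhd> p m n = p m n \<rhd>\<rhd> gpm"
proof -
  have "(\<lambda>m n. gpm \<lhd>\<lhd> p m n) = qcap D (\<lambda>i l m n. P i l \<lhd>\<lhd> p m n)"
    by (simp add: fun_eq_iff gpm_def qcap_apply qcap_clinear[OF bim_clinear2(3)])
  also have "\<dots> = qcap D (T (\<lambda>i j k n. p i j \<rhd>\<rhd> P k n))"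
    unfolding P_apply
    using move_p[of dp qa db] dpp_T dbp_T scalars_nonzero by (simp add: dpp_def dbp_def pdp_def pdb_def)
  also have "\<dots> = (\<lambda>i j. p i j \<rhd>\<rhd> gpm)"
    by (simp add: qcap_T gpm_def qcap_clinear[OF bim_clinear2(1)])
  finally show ?thesis by (simp add: fun_eq_iff)
qed

text \<open>Both \<open>p \<otimes> M\<close> and \<open>M \<otimes> p\<close> inherit relations from their factors: \<open>p \<delta>p\<close> is an eigenvector of \<open>S\<close>, so \<open>p \<otimes> M\<close> is
  one, and \<open>\<partial>p p\<close> is an eigenvector of \<open>St\<close>, so \<open>M \<otimes> p\<close> is one. As \<open>T\<close> carries \<open>p \<otimes> M\<close> to \<open>M \<otimes> p\<close>, also
  \<open>p \<otimes> M\<close> is an eigenvector of \<open>St\<close>, and as in \<open>cap_pp\<close> this compares \<open>p M = M\<close> with \<open>p tr(M)\<close>.\<close>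

lemma M_eq: "M i l = inverse qm *\<^sub>C (p i l \<rhd>\<rhd> gmp)"
proof -
  define U where "U = (\<lambda>i j k n. p i j \<rhd>\<rhd> M k n)"
  define U' where "U' = (\<lambda>i l m n. M i l \<lhd>\<lhd> p m n)"
  have U': "U' = T U"
    unfolding U_def U'_def M_apply
    using move_p[of db "inverse qa" dp] dpp_T dbp_T scalars_nonzero by (simp add: dpp_def dbp_def pdp_def pdb_def)
  have SU: "S U = qw *\<^sub>C U"
  proof -
    let ?Y = "\<lambda>i j k l m n. pdb i j k l \<otimes> dp m n"
    have L: "clinear (\<lambda>z m n. z \<otimes> dp m n)"
      using tens_clinear(1) by (simp add: clinear_def fun_eq_iff)
    have U: "U = (\<lambda>i j k. cap (?Y i j k))"
      by (simp add: U_def M_apply fun_eq_iff cap_apply cap_clinear[OF bim_clinear2(1)] pdb_def tens_act)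
    have "S ?Y = qw *\<^sub>C ?Y"
    proof -
      have "S ?Y = (\<lambda>i j k l m n. S pdb i j k l \<otimes> dp m n)"
        using S_pointwise[OF clinear_pointwise[OF L], of pdb] by simp
      then show ?thesis by (simp add: S_pdb fun_eq_iff clinear_scaleC[OF tens_clinear(1)])
    qed
    moreover have "S U = (\<lambda>i j k. cap (S ?Y i j k))"
      unfolding U by (rule S_pointwise[OF clinear_cap, symmetric])
    ultimately show ?thesis
      unfolding U by (simp add: clinear_scaleC[OF clinear_cap]) (simp add: scaleC_fun_def)
  qed
  have StU': "(\<lambda>i. St (U' i)) = inverse qw *\<^sub>C U'"
  proof
    fix i
    let ?W = "\<lambda>j k l m n. db i j \<otimes> dpp k l m n"
    have U'_cap: "U' i = cap ?W"
      by (simp add: U'_def M_apply fun_eq_iff cap_apply cap_clinear[OF bim_clinear2(3)] dpp_def tens_act)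
    have "St (?W j k) = inverse qw *\<^sub>C ?W j k" for j k
    proof -
      have "St (?W j k) = (\<lambda>l m n. db i j \<otimes> St (dpp k) l m n)"
        by (rule St_pointwise[OF tens_clinear(2), symmetric])
      then show ?thesis
        using fun_cong[OF St_dpp, of k] by (simp add: fun_eq_iff clinear_scaleC[OF tens_clinear(2)])
    qed
    then have "St (U' i) = cap (\<lambda>j k. inverse qw *\<^sub>C ?W j k)"
      by (simp only: U'_cap cap_clinear[OF clinear_St])
    also have "\<dots> = inverse qw *\<^sub>C U' i"
      unfolding U'_cap by (rule cap_scaleC)
    finally show "St (U' i) = (inverse qw *\<^sub>C U') i" by simp
  qed
  have "St (St (U i)) = inverse qw *\<^sub>C St (U i)" for i
  proof -
    have U'i: "U' i = qw *\<^sub>C St (U i)" for i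
      by (simp add: U' T_eq' SU clinear_scaleC[OF clinear_St])
    have "qw *\<^sub>C St (St (U i)) = qw *\<^sub>C inverse qw *\<^sub>C St (U i)"
      using fun_cong[OF StU', of i] by (simp add: U'i clinear_scaleC[OF clinear_St] scaleC_scaleC mult.commute)
    then show ?thesis using scalars_nonzero by (simp add: scaleC_cancel)
  qed
  then have StU: "St (U i) = inverse qw *\<^sub>C U i" for i
    by (metis St_Stinv(2) clinear_scaleC[OF clinear_Stinv])
  have "inverse qw *\<^sub>C cap (U i) = c *\<^sub>C (\<lambda>j. qcap D (U i j))"
    using cap_St[of "U i"] by (simp add: StU clinear_scaleC[OF clinear_cap])
  moreover have "cap (U i) l = M i l"
  proof -
    have "cap (U i) l = cap (\<lambda>j k. cap (\<lambda>a b. pdb i j k a \<otimes> dp b l))"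
      by (simp add: U_def M_apply cap_apply cap_clinear[OF bim_clinear2(1)] pdb_def tens_act)
    also have "\<dots> = cap (\<lambda>a b. cap (\<lambda>j k. pdb i j k a \<otimes> dp b l))"
      unfolding cap_def by (rule sum.swap)
    also have "\<dots> = cap (\<lambda>a b. cap (\<lambda>j k. pdb i j k a) \<otimes> dp b l)"
      by (simp add: cap_clinear[OF tens_clinear(1)])
    also have "\<dots> = cap (\<lambda>a b. db i a \<otimes> dp b l)"
    proof -
      have "cap (\<lambda>j k. pdb i j k a) = db i a" for a
        using fun_cong[OF fun_cong[OF cap_pdb, of i], of a] by (simp add: cap_apply)
      then show ?thesis by simp
    qed
    finally show ?thesis by (simp add: M_apply)
  qed
  moreover have "qcap D (U i l) = p i l \<rhd>\<rhd> gmp"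
    by (simp add: U_def gmp_def qcap_clinear[OF bim_clinear2(1)])
  ultimately have "inverse qw *\<^sub>C M i l = c *\<^sub>C (p i l \<rhd>\<rhd> gmp)"
    by (metis scaleC_fun_apply)
  then have "qw *\<^sub>C inverse qw *\<^sub>C M i l = qw *\<^sub>C c *\<^sub>C (p i l \<rhd>\<rhd> gmp)" by simp
  then show ?thesis using scalars_nonzero by (simp add: scaleC_scaleC c_eq' mult.commute)
qed

end

section \<open>Curvature\<close>

lemma tensor_product_act:
  assumes "is_tensor_product M N T t"
  shows "lact T b (t x y) = t (lact M b x) y" "ract T (t x y) b = t x (ract N y b)"
    "t (ract M x b) y = t x (lact N b y)"
  using assms tensor_balanced[OF assms] by (simp_all add: is_tensor_product_def balanced_def)

lemma tensor_product_clinear: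
  assumes "is_tensor_product M N T t"
  shows "clinear (\<lambda>x. t x y)" "clinear (t x)"
    "clinear (lact T b)" "clinear (\<lambda>b. lact T b z)" "clinear (\<lambda>z. ract T z b)" "clinear (ract T z)"
  using assms tensor_balanced[OF assms] by (simp_all add: is_tensor_product_def is_bimodule_def balanced_def)

lemma clinear_plus: "clinear f \<Longrightarrow> clinear g \<Longrightarrow> clinear (\<lambda>x. f x + g x)"
  and clinear_difference: "clinear f \<Longrightarrow> clinear g \<Longrightarrow> clinear (\<lambda>x. f x - g x)"
  by (simp_all add: clinear_def scaleC_add_right scaleC_diff_right)

lemma qcap_add: "qcap D (\<lambda>i j. x i j + y i j) = qcap D x + qcap D y"
  by (simp add: qcap_def sum.distrib scaleC_add_right)

lemma cap_add: "cap (\<lambda>i j. x i j + y i j) = cap x + cap y"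
  by (simp add: cap_def sum.distrib)

text \<open>The metric, connection, generalized braiding and splitting map on the generators. The numbers \<open>k2\<close>, \<open>e1\<close>, \<open>e2\<close> stand for
  \<open>1 / (1 + q\<^sup>a)\<close>, \<open>q\<^sup>2\<^sup>a\<^sup>-\<^sup>2\<^sup>w\<close> and \<open>(1 - q\<^sup>a) q\<^sup>a\<^sup>-\<^sup>m\<close>. The letters \<open>dp\<close> and \<open>db\<close> denote \<open>\<partial>p\<close> and \<open>\<delta>p\<close>.\<close>

locale geometry = first_order_calculus VV VD DD VVi VDi DDi D c h1 h0 k1 k0 A qa qw qm
  for VV VD DD VVi VDi DDi :: "complex^('n \<times> 'n)^('n::finite \<times> 'n)"
    and D :: "'n \<Rightarrow> complex" and c h1 h0 k1 k0 :: complex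
    and A :: "('n, 'b::complex_algebra_1, 'w::complex_vector, 't::complex_vector,
                'v::complex_vector, 'u::complex_vector) calculus"
    and qa qw qm +
  fixes ip :: "'t \<Rightarrow> 'b" and nabla :: "'w \<Rightarrow> 't" and sigma :: "'t \<Rightarrow> 't" and s :: "'v \<Rightarrow> 't"
    and cpm cmp k2 e1 e2 :: complex
  assumes universal: "is_universal_calculus A"
    and spanning: "range (left_eval (Om A) (\<lambda>(i, j). del A (gen A i j))) = Om_plus A"
      "range (left_eval (Om A) (\<lambda>(i, j). delb A (gen A i j))) = Om_minus A"
      "\<exists>y\<in>Om_plus A. \<exists>z\<in>Om_minus A. x = y + z"
    and ip_map: "bimodule_map (OmOm A) base_bimod ip"
    and ip_db_db: "ip (db i j \<otimes> db k l) = 0"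
    and ip_db_dp: "ip (db i j \<otimes> dp k l) = qcup D (p i l) j k - inverse qm *\<^sub>C (p i j * p k l)"
    and nabla_linear: "clinear nabla"
    and nabla_leibniz: "nabla (b \<rhd> x) = dB A b \<otimes> x + b \<rhd>\<rhd> nabla x"
    and nabla_dp: "nabla (dp i l) = qa *\<^sub>C cap (T (\<lambda>i j k l. db i j \<otimes> dp k l) i) l
        - (qa * inverse qm) *\<^sub>C (p i l \<rhd>\<rhd> gmp)"
    and sigma_map: "bimodule_map (OmOm A) (OmOm A) sigma"
    and sigma_db_db: "sigma (db i j \<otimes> db k l) = inverse qa *\<^sub>C T (\<lambda>i j k l. db i j \<otimes> db k l) i j k l"
    and sigma_dp_db: "sigma (dp i j \<otimes> db k l) =
        e1 *\<^sub>C S (\<lambda>i. Stinv (\<lambda>j k l. db i j \<otimes> dp k l)) i j k l + e2 *\<^sub>C (p i j \<rhd>\<rhd> (gmp \<lhd>\<lhd> p k l))"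
    and sigma_db_dp: "sigma (db i j \<otimes> dp k l) =
        (qw * qw / (qa * qa)) *\<^sub>C Sinv (\<lambda>i. St (\<lambda>j k l. dp i j \<otimes> db k l)) i j k l
        + ((1 - inverse qa) * inverse qm) *\<^sub>C (p i j \<rhd>\<rhd> (gpm \<lhd>\<lhd> p k l))"
    and s_map: "bimodule_map (Om2 A) (OmOm A) s"
    and s_db_db: "s (quo A (db i j \<otimes> db k l)) = k2 *\<^sub>C (db i j \<otimes> db k l - qa *\<^sub>C sigma (db i j \<otimes> db k l))"
    and s_dp_db: "s (quo A (dp i j \<otimes> db k l)) = cpm *\<^sub>C (dp i j \<otimes> db k l) - cmp *\<^sub>C sigma (dp i j \<otimes> db k l)"
    and s_db_dp: "s (quo A (db i j \<otimes> dp k l)) = cmp *\<^sub>C (db i j \<otimes> dp k l) - cpm *\<^sub>C sigma (db i j \<otimes> dp k l)"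
begin

text \<open>In the first summand of \<open>\<sigma>\<close> the contraction \<open>E\<close> removes \<open>Sinv\<close> (\<open>cap_Sinv\<close>), after which \<open>E'\<close> meets \<open>St\<close>; by the Hecke
  relation this gives \<open>E\<close> up to a multiple of \<open>tr(\<delta>p) = 0\<close>. The result is \<open>q\<^sup>-\<^sup>a g\<^sub>+\<^sub>-\<close>. The second summand
  is \<open>(1 - q\<^sup>-\<^sup>a) g\<^sub>+\<^sub>-\<close>, since \<open>g\<^sub>+\<^sub>-\<close> is central and \<open>p p = p\<close> has trace \<open>q\<^sup>m\<close>.\<close>

lemma sigma_gmp: "sigma gmp = gpm"
proof -
  define Z where "Z = (\<lambda>i. St (\<lambda>j k l. dp i j \<otimes> db k l))"
  let ?x = "qw * qw / (qa * qa)" and ?y = "(1 - inverse qa) * inverse qm"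
  have L: "clinear sigma" using sigma_map by (simp add: bimodule_map_def)
  have pgp: "cap (\<lambda>j k. p i j \<rhd>\<rhd> (gpm \<lhd>\<lhd> p k l)) = p i l \<rhd>\<rhd> gpm" for i l
  proof -
    have "cap (\<lambda>j k. p i j \<rhd>\<rhd> (gpm \<lhd>\<lhd> p k l)) = cap (\<lambda>j k. p i j * p k l) \<rhd>\<rhd> gpm"
      by (simp add: gpm_central bim_assoc2[symmetric] cap_clinear[OF bim_clinear2(2)])
    also have "cap (\<lambda>j k. p i j * p k l) = p i l"
      using fun_cong[OF fun_cong[OF cap_pp, of i], of l] by (simp add: cap_apply pp_def)
    finally show ?thesis .
  qed
  have M: "sigma (M i l) = (?x * c) *\<^sub>C qcap D Z i l + ?y *\<^sub>C (p i l \<rhd>\<rhd> gpm)" for i l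
  proof -
    have "sigma (M i l) = cap (\<lambda>j k. ?x *\<^sub>C Sinv Z i j k l + ?y *\<^sub>C (p i j \<rhd>\<rhd> (gpm \<lhd>\<lhd> p k l)))"
      by (simp add: M_apply cap_clinear[OF L] sigma_db_dp Z_def)
    also have "\<dots> = ?x *\<^sub>C cap (\<lambda>j k. Sinv Z i j k l) + ?y *\<^sub>C cap (\<lambda>j k. p i j \<rhd>\<rhd> (gpm \<lhd>\<lhd> p k l))"
      by (simp add: cap_def sum.distrib scaleC_sum_right)
    also have "cap (\<lambda>j k. Sinv Z i j k l) = c *\<^sub>C qcap D Z i l"
      using fun_cong[OF fun_cong[OF cap_Sinv, of Z i], of l] by (simp add: cap_apply)
    finally show ?thesis by (simp add: pgp scaleC_scaleC)
  qed
  have Z: "qcap D (qcap D Z) = (k1 / c) *\<^sub>C gpm"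
  proof -
    have "(\<lambda>j. qcap D (Z i j)) = (k1 / c) *\<^sub>C P i" for i
    proof -
      have "qcap D (\<lambda>k l. dp i j \<otimes> db k l) = 0" for j
        using qcap_clinear[OF tens_clinear(2), of "dp i j" D db]
        by (simp add: qcap_db clinear_0[OF tens_clinear(2)])
      moreover have "cap (\<lambda>j k l. dp i j \<otimes> db k l) = P i"
        by (simp add: P_def)
      ultimately show ?thesis
        unfolding Z_def qcap_St by (simp add: fun_eq_iff)
    qed
    then have "(\<lambda>i j. qcap D (Z i j)) = (\<lambda>i j. (k1 / c) *\<^sub>C P i j)"
      by (simp add: fun_eq_iff)
    then show ?thesis
      by (simp add: qcap_clinear[OF clinear_qcap] qcap_scaleC gpm_def)
  qed
  have "sigma gmp = qcap D (\<lambda>i l. sigma (M i l))"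
    by (simp add: gmp_def qcap_clinear[OF L])
  also have "\<dots> = (?x * c) *\<^sub>C qcap D (qcap D Z) + ?y *\<^sub>C (qcap D p \<rhd>\<rhd> gpm)"
    unfolding M qcap_clinear[OF bim_clinear2(2)] qcap_add qcap_scaleC by simp
  also have "\<dots> = (?x * c * (k1 / c) + ?y * qm) *\<^sub>C gpm"
    by (simp add: Z qcap_p clinear_scaleC[OF bim_clinear2(2)] bim_assoc2 scaleC_add_left scaleC_scaleC)
  also have "?x * c * (k1 / c) + ?y * qm = 1"
  proof -
    have "?x * c * (k1 / c) = (k1 * (qw * qw)) / (qa * qa)"
      using c_nonzero by (simp add: field_simps)
    also have "\<dots> = inverse qa" using scalars_nonzero by (simp add: k1_eq field_simps)
    finally have "?x * c * (k1 / c) = inverse qa" .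
    then show ?thesis using scalars_nonzero by (simp add: field_simps)
  qed
  finally show ?thesis by simp
qed

text \<open>Apply the connection to \<open>p \<partial>p = 0\<close>.\<close>

lemma p_nabla_dp: "cap (\<lambda>j k. p i j \<rhd>\<rhd> nabla (dp k l)) = - M i l"
proof -
  have "0 = nabla (cap (\<lambda>j k. p i j \<rhd> dp k l))"
    using fun_cong[OF fun_cong[OF cap_pdp, of i], of l]
    by (simp add: cap_apply pdp_def clinear_0[OF nabla_linear])
  also have "\<dots> = cap (\<lambda>j k. dB A (p i j) \<otimes> dp k l + p i j \<rhd>\<rhd> nabla (dp k l))"
    by (simp add: cap_clinear[OF nabla_linear] nabla_leibniz)
  also have "\<dots> = cap (\<lambda>j k. dp i j \<otimes> dp k l) + M i l + cap (\<lambda>j k. p i j \<rhd>\<rhd> nabla (dp k l))"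
    by (simp add: dB_def M_apply cap_def sum.distrib clinear_add[OF tens_clinear(1)])
  finally show ?thesis by (simp add: cap_dp_dp eq_neg_iff_add_eq_0 add.commute)
qed

lemma OmOm_clinear: "clinear (quo A)" "clinear (dd A)" "clinear ip" "clinear s" "clinear sigma"
  using universal ip_map s_map sigma_map by (simp_all add: is_universal_calculus_def bimodule_map_def)

lemma quo_act: "quo A (b \<rhd>\<rhd> z) = lact (Om2 A) b (quo A z)" "quo A (z \<lhd>\<lhd> b) = ract (Om2 A) (quo A z) b"
  using universal by (simp_all add: is_universal_calculus_def bimodule_map_def)

lemma dd_eq: "dd A (a \<rhd> dB A b) = quo A (dB A a \<otimes> dB A b)"
  using universal by (simp add: is_universal_calculus_def wedge_def)

lemma Om2Om: "is_tensor_product (Om2 A) (Om A) (Om2Om A) (ten2 A)"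
  and Om2: "is_bimodule (Om2 A)"
  using universal by (simp_all add: is_universal_calculus_def)

lemma Om2_clinear:
  "clinear (lact (Om2 A) b)" "clinear (\<lambda>b. lact (Om2 A) b x)" "clinear (\<lambda>x. ract (Om2 A) x b)"
  using Om2 by (simp_all add: is_bimodule_def)

lemmas ten2_act = tensor_product_act[OF Om2Om]
lemmas ten2_clinear = tensor_product_clinear[OF Om2Om]

lemma dB_mult: "dB A (a * b) = dB A a \<lhd> b + a \<rhd> dB A b"
  using del_derivation delb_derivation
  by (simp add: dB_def is_derivation_def clinear_add[OF bim_clinear(1)] clinear_add[OF bim_clinear(3)])

lemma dB_1: "dB A 1 = 0"
  using dB_mult[of 1 1] by (simp add: bim_assoc)

lemma db_eq: "db i l = cap (\<lambda>j k. p i j \<rhd> dB A (p k l))"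
proof -
  have "cap (\<lambda>j k. p i j \<rhd> dB A (p k l)) = cap (pdp i) l + cap (pdb i) l"
    by (simp add: dB_def cap_apply pdp_def pdb_def cap_def sum_fun_apply sum.distrib clinear_add[OF bim_clinear(1)])
  then show ?thesis
    using fun_cong[OF fun_cong[OF cap_pdp, of i], of l] fun_cong[OF fun_cong[OF cap_pdb, of i], of l] by simp
qed

text \<open>One-forms are sums of \<open>a db\<close>, because \<open>\<delta>p = p dp\<close> and \<open>\<partial>p = dp - \<delta>p\<close>.\<close>

lemma Om_induct [case_names mult add]:
  assumes t: "\<And>a b. Q (a \<rhd> dB A b)" and a: "\<And>x y. Q x \<Longrightarrow> Q y \<Longrightarrow> Q (x + y)"
  shows "Q x"
proof -
  have Q0: "Q 0" using t[of 0 0] by (simp add: clinear_0[OF bim_clinear(2)])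
  have sum: "(\<And>i. i \<in> B \<Longrightarrow> Q (f i)) \<Longrightarrow> Q (\<Sum>i\<in>B. f i)" for B :: "'i set" and f
    by (induction B rule: infinite_finite_induct) (auto simp: Q0 intro: a)
  have Qb: "Q (b \<rhd> db i l)" for b i l
  proof -
    have "b \<rhd> db i l = (\<Sum>j\<in>UNIV. (b * p i j) \<rhd> dB A (p j l))"
      by (simp add: db_eq cap_def clinear_sum[OF bim_clinear(1)] bim_assoc)
    then show ?thesis by (simp add: sum t)
  qed
  have Qd: "Q (b \<rhd> dp i l)" for b i l
  proof -
    have "b \<rhd> dp i l = b \<rhd> dB A (p i l) + (- b) \<rhd> db i l"
      by (simp add: dB_def clinear_add[OF bim_clinear(1)] clinear_minus[OF bim_clinear(2)])
    then show ?thesis using a[OF t Qb] by simp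
  qed
  obtain y z where x: "x = y + z" and y: "y \<in> Om_plus A" and z: "z \<in> Om_minus A"
    using spanning(3)[of x] by blast
  have "Q y"
    using y unfolding spanning(1)[symmetric] by (auto simp: left_eval_def split_def intro!: sum Qd)
  moreover have "Q z"
    using z unfolding spanning(2)[symmetric] by (auto simp: left_eval_def split_def intro!: sum Qb)
  ultimately show ?thesis by (simp add: x a)
qed

lemma dd_lmul: "dd A (x \<rhd> w) = quo A (dB A x \<otimes> w) + lact (Om2 A) x (dd A w)"
proof (induction w rule: Om_induct)
  case (mult a b)
  have "dd A (x \<rhd> a \<rhd> dB A b) = quo A (dB A (x * a) \<otimes> dB A b)"
    by (simp add: bim_assoc(3)[symmetric] dd_eq)
  then show ?case
    by (simp add: dB_mult clinear_add[OF tens_clinear(1)] clinear_add[OF OmOm_clinear(1)] tens_act dd_eq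
        quo_act[symmetric])
next
  case (add v w)
  then show ?case
    by (simp add: clinear_add[OF bim_clinear(1)] clinear_add[OF OmOm_clinear(2)] clinear_add[OF tens_clinear(2)]
        clinear_add[OF OmOm_clinear(1)] clinear_add[OF Om2_clinear(1)])
qed

lemma dd_rmul: "dd A (w \<lhd> b) = ract (Om2 A) (dd A w) b - quo A (w \<otimes> dB A b)"
proof (induction w rule: Om_induct)
  case (mult a e)
  have "dd A ((a \<rhd> dB A e) \<lhd> b) = dd A (a \<rhd> dB A (e * b) - (a * e) \<rhd> dB A b)"
    by (simp add: dB_mult bim_assoc clinear_add[OF bim_clinear(1)])
  also have "\<dots> = quo A (dB A a \<otimes> dB A (e * b)) - quo A (dB A (a * e) \<otimes> dB A b)"
    by (simp add: clinear_diff[OF OmOm_clinear(2)] dd_eq)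
  also have "\<dots> = quo A ((dB A a \<otimes> dB A e) \<lhd>\<lhd> b) - quo A ((a \<rhd> dB A e) \<otimes> dB A b)"
    by (simp add: dB_mult clinear_add[OF tens_clinear(1)] clinear_add[OF tens_clinear(2)]
        clinear_add[OF OmOm_clinear(1)] tens_act)
  finally show ?case by (simp add: quo_act dd_eq)
next
  case (add v w)
  then show ?case
    by (simp add: clinear_add[OF bim_clinear(3)] clinear_add[OF OmOm_clinear(2)] clinear_add[OF tens_clinear(1)]
        clinear_add[OF OmOm_clinear(1)] clinear_add[OF Om2_clinear(3)])
qed

lemma dd_dB: "dd A (dB A b) = 0"
  using dd_eq[of 1 b] by (simp add: bim_assoc dB_1 clinear_0[OF tens_clinear(1)] clinear_0[OF OmOm_clinear(1)])

text \<open>Of the four terms of \<open>d(p dp) = dp \<and> dp\<close>, those with equal types vanish already in \<open>\<Omega> \<otimes> \<Omega>\<close>.\<close>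

lemma dd_db: "dd A (db i l) = quo A (P i l) + quo A (M i l)"
proof -
  have "dd A (db i l) = quo A (cap (\<lambda>j k. dB A (p i j) \<otimes> dB A (p k l)))"
    by (simp add: db_eq cap_clinear[OF OmOm_clinear(2)] dd_eq cap_clinear[OF OmOm_clinear(1)])
  also have "cap (\<lambda>j k. dB A (p i j) \<otimes> dB A (p k l))
      = cap (\<lambda>j k. dp i j \<otimes> dp k l) + P i l + (M i l + cap (\<lambda>j k. db i j \<otimes> db k l))"
    by (simp add: dB_def P_apply M_apply cap_def sum.distrib clinear_add[OF tens_clinear(1)]
        clinear_add[OF tens_clinear(2)])
  finally show ?thesis by (simp add: cap_dp_dp cap_db_db clinear_add[OF OmOm_clinear(1)])
qed

lemma wedge_id_balanced: "balanced (Om A) (Om A) (\<lambda>x y. ten2 A (wedge A w x) y)"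
  unfolding balanced_def wedge_def
proof (intro conjI allI)
  fix x y b
  show "clinear (\<lambda>x. ten2 A (quo A (w \<otimes> x)) y)"
    by (rule clinear_compose[OF ten2_clinear(1) clinear_compose[OF OmOm_clinear(1) tens_clinear(2)]])
  show "clinear (ten2 A (quo A (w \<otimes> x)))" by (rule ten2_clinear(2))
  show "ten2 A (quo A (w \<otimes> (x \<lhd> b))) y = ten2 A (quo A (w \<otimes> x)) (b \<rhd> y)"
    by (simp add: tens_act(3)[symmetric] quo_act ten2_act)
qed

lemma clinear_wedge_id: "clinear (wedge_id A w)"
  and wedge_id_tens: "wedge_id A w (x \<otimes> y) = ten2 A (quo A (w \<otimes> x)) y"
  unfolding wedge_id_def wedge_def
  using clinear_tensor_lift[OF OmOm wedge_id_balanced[of w]] tensor_lift[OF OmOm wedge_id_balanced[of w]]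
  by (simp_all add: wedge_def)

lemma wedge_id_lmul: "wedge_id A w (b \<rhd>\<rhd> z) = wedge_id A (w \<lhd> b) z"
  by (rule tensor_ext[OF OmOm clinear_compose[OF clinear_wedge_id bim_clinear2(1)] clinear_wedge_id])
    (simp add: tens_act wedge_id_tens)

lemma wedge_id_lmul_left: "wedge_id A (b \<rhd> w) z = lact (Om2Om A) b (wedge_id A w z)"
  by (rule tensor_ext[OF OmOm clinear_wedge_id clinear_compose[OF ten2_clinear(3) clinear_wedge_id]])
    (simp add: tens_act(2)[symmetric] wedge_id_tens quo_act ten2_act)

lemma clinear_wedge_id_left: "clinear (\<lambda>w. wedge_id A w z)"
proof (rule clinearI)
  fix v w :: 'w and a
  show "wedge_id A (v + w) z = wedge_id A v z + wedge_id A w z"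
    by (rule tensor_ext[OF OmOm clinear_wedge_id clinear_plus[OF clinear_wedge_id clinear_wedge_id]])
      (simp add: wedge_id_tens clinear_add[OF tens_clinear(1)] clinear_add[OF OmOm_clinear(1)]
        clinear_add[OF ten2_clinear(1)])
  have L: "clinear (\<lambda>z. a *\<^sub>C wedge_id A w z)"
    by (rule clinearI) (simp_all add: clinear_add[OF clinear_wedge_id] clinear_scaleC[OF clinear_wedge_id]
        scaleC_add_right scaleC_scaleC mult.commute)
  show "wedge_id A (a *\<^sub>C w) z = a *\<^sub>C wedge_id A w z"
    by (rule tensor_ext[OF OmOm clinear_wedge_id L])
      (simp add: wedge_id_tens clinear_scaleC[OF tens_clinear(1)] clinear_scaleC[OF OmOm_clinear(1)]
        clinear_scaleC[OF ten2_clinear(1)])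
qed

text \<open>The map \<open>d \<otimes> id - (\<and> \<otimes> id)(id \<otimes> \<nabla>)\<close>, so that the Riemann tensor is \<open>curv\<close> after \<open>\<nabla>\<close>. It is balanced because the
  Leibniz defect \<open>- \<omega> \<and> db\<close> of \<open>d\<close> on \<open>\<omega> b\<close> cancels that of \<open>\<nabla>\<close> on \<open>b \<eta>\<close>.\<close>

definition curv :: "'t \<Rightarrow> 'u" where
  "curv = tensor_lift (ten A) (\<lambda>w x. ten2 A (dd A w) x - wedge_id A w (nabla x))"

lemma curv_balanced: "balanced (Om A) (Om A) (\<lambda>w x. ten2 A (dd A w) x - wedge_id A w (nabla x))"
  unfolding balanced_def
proof (intro conjI allI)
  fix w x b
  show "clinear (\<lambda>w. ten2 A (dd A w) x - wedge_id A w (nabla x))"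
    by (rule clinear_difference[OF clinear_compose[OF ten2_clinear(1) OmOm_clinear(2)] clinear_wedge_id_left])
  show "clinear (\<lambda>x. ten2 A (dd A w) x - wedge_id A w (nabla x))"
    by (rule clinear_difference[OF ten2_clinear(2) clinear_compose[OF clinear_wedge_id nabla_linear]])
  show "ten2 A (dd A (w \<lhd> b)) x - wedge_id A (w \<lhd> b) (nabla x)
      = ten2 A (dd A w) (b \<rhd> x) - wedge_id A w (nabla (b \<rhd> x))"
    by (simp add: dd_rmul clinear_diff[OF ten2_clinear(1)] ten2_act nabla_leibniz
        clinear_add[OF clinear_wedge_id] wedge_id_lmul wedge_id_tens)
qed

lemma clinear_curv: "clinear curv"
  and curv_tens: "curv (w \<otimes> x) = ten2 A (dd A w) x - wedge_id A w (nabla x)"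
  unfolding curv_def
  by (rule clinear_tensor_lift[OF OmOm curv_balanced] tensor_lift[OF OmOm curv_balanced])+

lemma riemann_eq: "riemann A nabla x = curv (nabla x)"
  by (simp add: riemann_def curv_def)

lemma curv_lmul: "curv (b \<rhd>\<rhd> z) = wedge_id A (dB A b) z + lact (Om2Om A) b (curv z)"
  by (rule tensor_ext[OF OmOm clinear_compose[OF clinear_curv bim_clinear2(1)]
        clinear_plus[OF clinear_wedge_id clinear_compose[OF ten2_clinear(3) clinear_curv]]])
    (simp add: tens_act curv_tens dd_lmul clinear_add[OF ten2_clinear(1)] wedge_id_tens
      clinear_diff[OF ten2_clinear(3)] ten2_act wedge_id_lmul_left)

text \<open>The two Leibniz terms with \<open>db \<and> \<nabla>(x)\<close> cancel, and \<open>d(db) = 0\<close>.\<close>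

lemma riemann_lmul: "riemann A nabla (b \<rhd> x) = lact (Om2Om A) b (riemann A nabla x)"
  by (simp add: riemann_eq nabla_leibniz clinear_add[OF clinear_curv] curv_tens curv_lmul dd_dB
      clinear_0[OF ten2_clinear(1)])

lemma clinear_riemann: "clinear (riemann A nabla)"
  unfolding riemann_eq by (rule clinear_compose[OF clinear_curv nabla_linear])

end

section \<open>The Ricci map\<close>

context geometry
begin

lemma ip_act: "ip (b \<rhd>\<rhd> z) = b * ip z" "ip (z \<lhd>\<lhd> b) = ip z * b"
  using ip_map by (simp_all add: bimodule_map_def base_bimod_def)

lemma s_act: "s (lact (Om2 A) b x) = b \<rhd>\<rhd> s x" "s (ract (Om2 A) x b) = s x \<lhd>\<lhd> b"
  using s_map by (simp_all add: bimodule_map_def)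

lemma pair_balanced: "balanced (Om A) (Om A) (\<lambda>x x'. (ip (w \<otimes> x) \<rhd> x') \<otimes> y)"
  unfolding balanced_def
proof (intro conjI allI)
  fix x x' b
  show "clinear (\<lambda>x. (ip (w \<otimes> x) \<rhd> x') \<otimes> y)"
    by (rule clinear_compose[OF tens_clinear(1) clinear_compose[OF bim_clinear(2)
            clinear_compose[OF OmOm_clinear(3) tens_clinear(2)]]])
  show "clinear (\<lambda>x'. (ip (w \<otimes> x) \<rhd> x') \<otimes> y)"
    by (rule clinear_compose[OF tens_clinear(1) bim_clinear(1)])
  show "(ip (w \<otimes> (x \<lhd> b)) \<rhd> x') \<otimes> y = (ip (w \<otimes> x) \<rhd> b \<rhd> x') \<otimes> y"
    by (simp add: tens_act(3)[symmetric] ip_act bim_assoc)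
qed

lemma clinear_pair: "clinear (\<lambda>z. pair_id A ip w z y)"
  and pair_tens: "pair_id A ip w (x \<otimes> x') y = (ip (w \<otimes> x) \<rhd> x') \<otimes> y"
  unfolding pair_id_def
  by (rule clinear_tensor_lift[OF OmOm pair_balanced] tensor_lift[OF OmOm pair_balanced])+

lemma pair_rmul: "pair_id A ip w (z \<lhd>\<lhd> b) y = pair_id A ip w z (b \<rhd> y)"
  by (rule tensor_ext[OF OmOm clinear_compose[OF clinear_pair bim_clinear2(3)] clinear_pair])
    (simp add: tens_act(3) pair_tens bim_assoc tens_act(1))

lemma pair_lmul: "pair_id A ip w (b \<rhd>\<rhd> z) y = pair_id A ip (w \<lhd> b) z y"
  by (rule tensor_ext[OF OmOm clinear_compose[OF clinear_pair bim_clinear2(1)] clinear_pair])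
    (simp add: tens_act(1,2) pair_tens)

lemma pair_lmul_left: "pair_id A ip (b \<rhd> w) z y = b \<rhd>\<rhd> pair_id A ip w z y"
  by (rule tensor_ext[OF OmOm clinear_pair clinear_compose[OF bim_clinear2(1) clinear_pair]])
    (simp add: tens_act(2)[symmetric] pair_tens ip_act bim_assoc)

lemma clinear_scaled: "clinear f \<Longrightarrow> clinear (\<lambda>x. a *\<^sub>C f x)"
  by (simp add: clinear_def scaleC_add_right scaleC_scaleC mult.commute)

lemma clinear_pair_left: "clinear (\<lambda>w. pair_id A ip w z y)"
proof (rule clinearI)
  fix v w :: 'w and a
  show "pair_id A ip (v + w) z y = pair_id A ip v z y + pair_id A ip w z y"
    by (rule tensor_ext[OF OmOm clinear_pair clinear_plus[OF clinear_pair clinear_pair]])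
      (simp add: pair_tens clinear_add[OF tens_clinear(1)] clinear_add[OF OmOm_clinear(3)]
        clinear_add[OF bim_clinear(2)])
  show "pair_id A ip (a *\<^sub>C w) z y = a *\<^sub>C pair_id A ip w z y"
    by (rule tensor_ext[OF OmOm clinear_pair clinear_scaled[OF clinear_pair]])
      (simp add: pair_tens clinear_scaleC[OF tens_clinear(1)] clinear_scaleC[OF OmOm_clinear(3)]
        clinear_scaleC[OF bim_clinear(2)])
qed

lemma clinear_pair_right: "clinear (pair_id A ip w z)"
proof (rule clinearI)
  fix x y :: 'w and a
  show "pair_id A ip w z (x + y) = pair_id A ip w z x + pair_id A ip w z y"
    by (rule tensor_ext[OF OmOm clinear_pair clinear_plus[OF clinear_pair clinear_pair]])
      (simp add: pair_tens clinear_add[OF tens_clinear(2)])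
  show "pair_id A ip w z (a *\<^sub>C x) = a *\<^sub>C pair_id A ip w z x"
    by (rule tensor_ext[OF OmOm clinear_pair clinear_scaled[OF clinear_pair]])
      (simp add: pair_tens clinear_scaleC[OF tens_clinear(2)])
qed

abbreviation G where "G \<equiv> split_pair A ip s"

lemma split_balanced: "balanced (Om2 A) (Om A) (\<lambda>x y. pair_id A ip w (s x) y)"
  unfolding balanced_def
  by (simp add: clinear_compose[OF clinear_pair OmOm_clinear(4)] clinear_pair_right s_act pair_rmul)

lemma clinear_split: "clinear (G w)"
  and split_tens: "G w (ten2 A x y) = pair_id A ip w (s x) y"
  unfolding split_pair_def
  by (rule clinear_tensor_lift[OF Om2Om split_balanced] tensor_lift[OF Om2Om split_balanced])+

lemma split_lmul: "G w (lact (Om2Om A) b u) = G (w \<lhd> b) u"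
  by (rule tensor_ext[OF Om2Om clinear_compose[OF clinear_split ten2_clinear(3)] clinear_split])
    (simp add: ten2_act split_tens s_act pair_lmul)

lemma clinear_split_left: "clinear (\<lambda>w. G w u)"
proof (rule clinearI)
  fix v w :: 'w and a
  show "G (v + w) u = G v u + G w u"
    by (rule tensor_ext[OF Om2Om clinear_split clinear_plus[OF clinear_split clinear_split]])
      (simp add: split_tens clinear_add[OF clinear_pair_left])
  show "G (a *\<^sub>C w) u = a *\<^sub>C G w u"
    by (rule tensor_ext[OF Om2Om clinear_split clinear_scaled[OF clinear_split]])
      (simp add: split_tens clinear_scaleC[OF clinear_pair_left])
qed

lemma ricci_balanced: "balanced (Om A) (Om A) (\<lambda>w x. G w (riemann A nabla x))"
  unfolding balanced_def
  by (simp add: clinear_split_left clinear_compose[OF clinear_split clinear_riemann] riemann_lmul split_lmul)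

lemma clinear_ricci: "clinear (ricci_map A ip nabla s)"
  and ricci_tens: "ricci_map A ip nabla s (w \<otimes> x) = G w (riemann A nabla x)"
  unfolding ricci_map_def
  by (rule clinear_tensor_lift[OF OmOm ricci_balanced] tensor_lift[OF OmOm ricci_balanced])+

text \<open>To evaluate a linear map on \<open>\<delta>p p\<close>, commute \<open>p\<close> to the left. In particular a map that vanishes on \<open>p \<delta>p\<close>
  vanishes on \<open>\<delta>p p\<close>.\<close>

lemma db_rmul: "clinear F \<Longrightarrow>
    F (db i j \<lhd> p a b) = inverse qa *\<^sub>C T (\<lambda>i j k l. F (p i j \<rhd> db k l)) i j a b"
proof -
  assume F: "clinear F"
  have "db i j \<lhd> p a b = (inverse qa *\<^sub>C T pdb) i j a b"
    unfolding dbp_T[symmetric] by (simp add: dbp_def)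
  then show ?thesis
    by (simp add: clinear_scaleC[OF F] T_clinear[OF F] pdb_def)
qed

lemma T_zero: "T (\<lambda>i j k l. 0) i j k l = (0 :: 'z::complex_vector)"
proof -
  have "T (0 :: 'n \<Rightarrow> 'n \<Rightarrow> 'n \<Rightarrow> 'n \<Rightarrow> 'z::complex_vector) = 0" by (rule clinear_0[OF clinear_T])
  then show ?thesis by (simp add: zero_fun_def)
qed

lemma gmp_zero:
  assumes F: "clinear F" and 0: "\<And>i j k l. F (db i j \<otimes> dp k l) = 0"
  shows "F gmp = 0"
  by (simp add: gmp_def M_apply[abs_def] qcap_clinear[OF F] cap_clinear[OF F] 0) (simp add: qcap_def cap_def)

text \<open>This and the following lemmas say what pairing with \<open>\<delta>p\<close> kills: tensors whose first factor is antiholomorphic, with or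
  without a coefficient \<open>p\<close>.\<close>

lemma pair_db: "pair_id A ip (db i j) (db a b \<otimes> x) y = 0"
  by (simp add: pair_tens ip_db_db clinear_0[OF bim_clinear(2)] clinear_0[OF tens_clinear(1)])

lemma pair_p_db: "pair_id A ip (db i j) (p a b \<rhd>\<rhd> (db k l \<otimes> x)) y = 0"
proof -
  have "pair_id A ip (p i j \<rhd> db a b) (db k l \<otimes> x) y = 0" for i j a b
    by (simp add: pair_lmul_left pair_db clinear_0[OF bim_clinear2(1)])
  then show ?thesis
    by (simp add: pair_lmul db_rmul[OF clinear_pair_left] T_zero)
qed

text \<open>On antiholomorphic two-forms the splitting map stays in the span of \<open>\<delta>p \<otimes> \<delta>p\<close>.\<close>

lemma pair_s_db_db: "pair_id A ip (db i j) (b \<rhd>\<rhd> s (quo A (db k l \<otimes> db m n))) y = 0"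
  if b: "\<And>k l x. pair_id A ip (db i j) (b \<rhd>\<rhd> (db k l \<otimes> x)) y = 0"
proof -
  define F where "F z = pair_id A ip (db i j) (b \<rhd>\<rhd> z) y" for z
  have F: "clinear F"
    unfolding F_def by (rule clinear_compose[OF clinear_pair bim_clinear2(1)])
  have 0: "F (db k l \<otimes> x) = 0" for k l x
    unfolding F_def by (rule b)
  have "F (sigma (db k l \<otimes> db m n)) = 0"
    by (simp add: sigma_db_db clinear_scaleC[OF F] T_clinear[OF F] 0 T_zero)
  then have "F (s (quo A (db k l \<otimes> db m n))) = 0"
    by (simp add: s_db_db clinear_scaleC[OF F] clinear_diff[OF F] 0)
  then show ?thesis by (simp add: F_def)
qed

lemma split_db_db: "G (db i j) (ten2 A (quo A (db k l \<otimes> db m n)) y) = 0"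
  using pair_s_db_db[of i j 1 y k l m n] by (simp add: split_tens bim_assoc2 pair_db)

lemma split_p_db_db: "G (db i j) (ten2 A (quo A ((p a b \<rhd> db k l) \<otimes> db m n)) y) = 0"
  using pair_s_db_db[of i j "p a b" y k l m n]
  by (simp add: split_tens pair_p_db s_act quo_act tens_act(2)[symmetric])

text \<open>On \<open>\<Omega>\<^sub>+ \<otimes> \<Omega>\<^sub>-\<close> the generalized braiding takes values in \<open>\<Omega>\<^sub>- \<otimes> \<Omega>\<^sub>+\<close>, which the pairing kills; so only \<open>c\<^sub>+\<^sub>- id\<close> remains
  of the splitting map.\<close>

lemma pair_s_dp_db: "pair_id A ip (db i j) (s (quo A (dp a b \<otimes> db k l))) y
    = cpm *\<^sub>C pair_id A ip (db i j) (dp a b \<otimes> db k l) y"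
proof -
  define F where "F z = pair_id A ip (db i j) z y" for z
  have F: "clinear F" unfolding F_def by (rule clinear_pair)
  have 0: "F (db k l \<otimes> x) = 0" for k l x unfolding F_def by (rule pair_db)
  have Z: "F (Stinv (\<lambda>j k l. db i j \<otimes> dp k l) j k l) = 0" for i j k l
  proof -
    define z where "z = (\<lambda>j k l. F (Stinv (\<lambda>j k l. db i j \<otimes> dp k l) j k l))"
    \<comment> \<open>\<open>Stinv\<close> commutes with linear maps because its inverse does.\<close>
    have "St z = (\<lambda>j k l. F (db i j \<otimes> dp k l))"
      unfolding z_def by (subst St_pointwise[OF F, symmetric]) simp
    then have "St z = 0" by (simp add: 0 zero_fun_def)
    then have "z = 0" by (metis St_Stinv(2) clinear_0[OF clinear_Stinv])
    then show ?thesis by (simp add: z_def fun_eq_iff)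
  qed
  have "F (S (\<lambda>i. Stinv (\<lambda>j k l. db i j \<otimes> dp k l)) a b k l) = 0"
  proof -
    have "F (S X a b k l) = S (\<lambda>i j k l. F (X i j k l)) a b k l" for X
      using fun_cong[OF S_clinear[OF clinear_pointwise[OF F], of X a b k], of l] by simp
    moreover have "S (0 :: 'n \<Rightarrow> 'n \<Rightarrow> 'n \<Rightarrow> 'n \<Rightarrow> 't) = 0" by (rule clinear_0[OF clinear_S])
    ultimately show ?thesis by (simp add: Z zero_fun_def)
  qed
  moreover have "F (p a b \<rhd>\<rhd> (gmp \<lhd>\<lhd> p k l)) = 0"
  proof (rule gmp_zero)
    show "clinear (\<lambda>z. F (p a b \<rhd>\<rhd> (z \<lhd>\<lhd> p k l)))"
      by (rule clinear_compose[OF F clinear_compose[OF bim_clinear2(1) bim_clinear2(3)]])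
    show "F (p a b \<rhd>\<rhd> ((db i j \<otimes> dp i' j') \<lhd>\<lhd> p k l)) = 0" for i j i' j'
      unfolding F_def tens_act(3) by (rule pair_p_db)
  qed
  ultimately have "F (sigma (dp a b \<otimes> db k l)) = 0"
    by (simp add: sigma_dp_db clinear_add[OF F] clinear_scaleC[OF F])
  then have "F (s (quo A (dp a b \<otimes> db k l))) = cpm *\<^sub>C F (dp a b \<otimes> db k l)"
    by (simp add: s_dp_db clinear_diff[OF F] clinear_scaleC[OF F])
  then show ?thesis by (simp add: F_def)
qed

text \<open>The result of pairing \<open>\<delta>p\<close> with the first factor of \<open>P\<close>, before the remaining one-form is tensored on.\<close>

definition db_P where
  "db_P i j a b = qcup D (db i b) j a - inverse qm *\<^sub>C (p i j \<rhd> db a b)"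

lemma pair_P: "pair_id A ip (db i j) (P a b) y = db_P i j a b \<otimes> y"
proof -
  have e: "cap (\<lambda>m n. p a m \<rhd> db n b) = db a b" for a
    using fun_cong[OF fun_cong[OF cap_pdb, of a], of b] by (simp add: cap_apply pdb_def)
  have "pair_id A ip (db i j) (P a b) y = cap (\<lambda>m n. (ip (db i j \<otimes> dp a m) \<rhd> db n b) \<otimes> y)"
    by (simp add: P_apply cap_clinear[OF clinear_pair] pair_tens)
  also have "\<dots> = cap (\<lambda>m n. ip (db i j \<otimes> dp a m) \<rhd> db n b) \<otimes> y"
    by (simp add: cap_clinear[OF tens_clinear(1)])
  also have "cap (\<lambda>m n. ip (db i j \<otimes> dp a m) \<rhd> db n b) = cap (\<lambda>m n. qcup D (p i m) j a \<rhd> db n b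
      + (- inverse qm) *\<^sub>C (p i j \<rhd> p a m \<rhd> db n b))"
    by (simp add: ip_db_dp clinear_diff[OF bim_clinear(2)] clinear_scaleC[OF bim_clinear(2)] bim_assoc)
  also have "\<dots> = qcup D (db i b) j a - inverse qm *\<^sub>C (p i j \<rhd> db a b)"
  proof -
    have "cap (\<lambda>m n. qcup D (p i m) j a \<rhd> db n b) = qcup D (db i b) j a"
      by (simp add: qcup_clinear[OF bim_clinear(2)] qcup_clinear[OF clinear_cap, symmetric])
        (simp add: qcup_def cap_scaleC e, simp add: cap_def)
    moreover have "cap (\<lambda>m n. p i j \<rhd> p a m \<rhd> db n b) = p i j \<rhd> db a b"
      by (simp add: cap_clinear[OF bim_clinear(1), symmetric] e)
    ultimately show ?thesis
      by (simp only: cap_add cap_scaleC) simp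
  qed
  finally show ?thesis by (simp add: db_P_def)
qed

lemma qcap_qcup: "qcap D (\<lambda>a b. qcup D (x b) j a) = x j"
proof -
  have "qcap D (\<lambda>a b. qcup D (x b) j a) = (\<Sum>a\<in>UNIV. if a = j then x a else 0)"
    unfolding qcap_def qcup_def by (intro sum.cong refl) (auto simp: scaleC_scaleC D_nonzero)
  then show ?thesis by simp
qed

text \<open>The pairing inverts the metric.\<close>

lemma pair_gpm: "pair_id A ip (db i j) gpm y = db i j \<otimes> y"
proof -
  have "qcap D (db_P i j) = db i j"
  proof -
    have "db_P i j = (\<lambda>a b. qcup D (db i b) j a + (- inverse qm) *\<^sub>C (p i j \<rhd> db a b))"
      by (simp add: db_P_def fun_eq_iff)
    then have "qcap D (db_P i j) = db i j + (- inverse qm) *\<^sub>C (p i j \<rhd> qcap D db)"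
      by (simp only: qcap_add qcap_scaleC qcap_qcup qcap_clinear[OF bim_clinear(1)])
    then show ?thesis by (simp add: qcap_db clinear_0[OF bim_clinear(1)])
  qed
  moreover have "pair_id A ip (db i j) gpm y = qcap D (db_P i j) \<otimes> y"
    by (simp add: gpm_def qcap_clinear[OF clinear_pair] pair_P qcap_clinear[OF tens_clinear(1)])
  ultimately show ?thesis by simp
qed

lemma pair_p_gpm: "pair_id A ip (db i j) (p a b \<rhd>\<rhd> gpm) y = (db i j \<lhd> p a b) \<otimes> y"
  unfolding pair_lmul
  by (simp only: db_rmul[OF clinear_pair_left] db_rmul[OF tens_clinear(1)] pair_lmul_left pair_gpm tens_act(2))

text \<open>This is where the exact value of \<open>\<sigma>\<close> on the metric enters.\<close>

lemma s_quo_gmp: "s (quo A gmp) = cmp *\<^sub>C gmp - cpm *\<^sub>C gpm"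
proof -
  define F where "F z = s (quo A z) - (cmp *\<^sub>C z - cpm *\<^sub>C sigma z)" for z
  have "clinear F"
    unfolding F_def using OmOm_clinear
    by (intro clinear_difference clinear_compose[of s "quo A"] clinear_scaled) (simp_all add: clinear_def)
  then have "F gmp = 0" by (rule gmp_zero) (simp add: F_def s_db_dp)
  then show ?thesis by (simp add: F_def sigma_gmp)
qed

text \<open>Of \<open>curv(\<delta>p \<otimes> \<partial>p)\<close> the connection term is of the form \<open>\<delta>p \<and> \<delta>p\<close> or \<open>\<delta>p \<and> p \<delta>p\<close> in its first two factors and is
  killed. In \<open>d \<delta>p\<close> the product \<open>P\<close> gives \<open>db_P\<close>, and \<open>M = q\<^sup>-\<^sup>m p g\<^sub>-\<^sub>+\<close> gives the remaining term after the splitting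
  map has turned \<open>g\<^sub>-\<^sub>+\<close> into \<open>- c\<^sub>+\<^sub>- g\<^sub>+\<^sub>-\<close>.\<close>

lemma split_curv: "G (db i j) (curv (db a b \<otimes> dp e f))
    = cpm *\<^sub>C ((db_P i j a b - inverse qm *\<^sub>C (db i j \<lhd> p a b)) \<otimes> dp e f)"
proof -
  define F where "F z = pair_id A ip (db i j) z (dp e f)" for z
  have F: "clinear F" unfolding F_def by (rule clinear_pair)
  have "F (s (quo A (P a b))) = cpm *\<^sub>C F (P a b)"
    by (simp add: P_apply cap_clinear[OF OmOm_clinear(1)] cap_clinear[OF OmOm_clinear(4)] cap_clinear[OF F])
      (simp add: F_def pair_s_dp_db cap_scaleC)
  moreover have "F (s (quo A (M a b))) = - (cpm *\<^sub>C inverse qm *\<^sub>C ((db i j \<lhd> p a b) \<otimes> dp e f))"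
  proof -
    have "clinear (\<lambda>z. F (p a b \<rhd>\<rhd> z))" by (rule clinear_compose[OF F bim_clinear2(1)])
    then have "F (p a b \<rhd>\<rhd> gmp) = 0"
      by (rule gmp_zero) (simp add: F_def pair_p_db)
    moreover have "F (p a b \<rhd>\<rhd> gpm) = (db i j \<lhd> p a b) \<otimes> dp e f"
      unfolding F_def by (rule pair_p_gpm)
    moreover have "s (quo A (M a b)) = inverse qm *\<^sub>C (p a b \<rhd>\<rhd> (cmp *\<^sub>C gmp - cpm *\<^sub>C gpm))"
      by (simp add: M_eq clinear_scaleC[OF OmOm_clinear(1)] clinear_scaleC[OF OmOm_clinear(4)] quo_act s_act
          s_quo_gmp)
    ultimately show ?thesis
      by (simp add: clinear_scaleC[OF F] clinear_diff[OF bim_clinear2(1)] clinear_scaleC[OF bim_clinear2(1)]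
          clinear_diff[OF F] scaleC_scaleC mult.commute)
  qed
  moreover have "G (db i j) (wedge_id A (db a b) (nabla (dp e f))) = 0"
  proof -
    define W where "W z = G (db i j) (wedge_id A (db a b) z)" for z
    have W: "clinear W" unfolding W_def by (rule clinear_compose[OF clinear_split clinear_wedge_id])
    have W0: "W (db k l \<otimes> x) = 0" for k l x
      by (simp add: W_def wedge_id_tens split_db_db)
    have "W (cap (T (\<lambda>i j k l. db i j \<otimes> dp k l) e) f) = 0"
      by (simp add: cap_apply cap_clinear[OF W] T_clinear[OF W] W0 T_zero) (simp add: cap_def)
    moreover have "W (p e f \<rhd>\<rhd> gmp) = 0"
    proof -
      have L: "clinear (\<lambda>w. G (db i j) (wedge_id A w gmp))"
        by (rule clinear_compose[OF clinear_split clinear_wedge_id_left])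
      have "G (db i j) (wedge_id A (p k l \<rhd> db m n) gmp) = 0" for k l m n
        by (rule gmp_zero[OF clinear_compose[OF clinear_split clinear_wedge_id]])
          (simp add: wedge_id_tens split_p_db_db)
      then show ?thesis
        by (simp add: W_def wedge_id_lmul db_rmul[OF L] T_zero)
    qed
    ultimately have "W (nabla (dp e f)) = 0"
      by (simp add: nabla_dp clinear_diff[OF W] clinear_scaleC[OF W])
    then show ?thesis by (simp add: W_def)
  qed
  ultimately show ?thesis
    by (simp add: curv_tens dd_db clinear_diff[OF clinear_split] clinear_add[OF ten2_clinear(1)]
        clinear_add[OF clinear_split] split_tens)
      (simp add: F_def pair_P clinear_diff[OF tens_clinear(1)] clinear_scaleC[OF tens_clinear(1)]
        scaleC_diff_right)
qed

text \<open>The trace of the matrix product of two families, i.e. \<open>E'\<close> after \<open>E\<close>.\<close>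

abbreviation qtr where "qtr x \<equiv> qcap D (\<lambda>i l. cap (\<lambda>j k. x i j k l))"

lemma qtr_pp: "qtr (\<lambda>i j k l. (p i j * p k l) \<rhd>\<rhd> gmp) = qm *\<^sub>C gmp"
proof -
  have "cap (\<lambda>j k. p i j * p k l) = p i l" for i l
    using fun_cong[OF fun_cong[OF cap_pp, of i], of l] by (simp add: cap_apply pp_def)
  then show ?thesis
    by (simp add: cap_clinear[OF bim_clinear2(2), symmetric] qcap_clinear[OF bim_clinear2(2), symmetric]
        qcap_p clinear_scaleC[OF bim_clinear2(2)] bim_assoc2(1))
qed

lemma qtr_dbdp: "qtr (\<lambda>i j k l. db i j \<otimes> dp k l) = gmp"
  by (simp add: gmp_def M_apply[abs_def])

text \<open>The pairing of the metric with itself. The term \<open>C' p\<close> contracts to \<open>tr(p)\<close> times the sum of the \<open>D i\<^sup>-\<^sup>1\<close>, and \<open>p p = p\<close>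
  gives the correction.\<close>

lemma qtr_ip: "qtr (\<lambda>i j k l. ip (db i j \<otimes> dp k l) \<rhd>\<rhd> z)
    = (qm * (\<Sum>i\<in>UNIV. inverse (D i)) - 1) *\<^sub>C z"
proof -
  have pp: "cap (\<lambda>j k. p i j * p k l) = p i l" for i l
    using fun_cong[OF fun_cong[OF cap_pp, of i], of l] by (simp add: cap_apply pp_def)
  have "cap (\<lambda>j k. ip (db i j \<otimes> dp k l)) = (\<Sum>i\<in>UNIV. inverse (D i)) *\<^sub>C p i l + (- inverse qm) *\<^sub>C p i l" for i l
  proof -
    have "cap (\<lambda>j k. ip (db i j \<otimes> dp k l)) = cap (\<lambda>j k. qcup D (p i l) j k + (- inverse qm) *\<^sub>C (p i j * p k l))"
      by (simp add: ip_db_dp)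
    also have "\<dots> = cap (qcup D (p i l)) + (- inverse qm) *\<^sub>C p i l"
      by (simp only: cap_add cap_scaleC pp)
    also have "cap (qcup D (p i l)) = (\<Sum>i\<in>UNIV. inverse (D i)) *\<^sub>C p i l"
      by (simp add: cap_def qcup_def scaleC_sum_left)
    finally show ?thesis .
  qed
  then have "qtr (\<lambda>i j k l. ip (db i j \<otimes> dp k l))
      = ((\<Sum>i\<in>UNIV. inverse (D i)) * qm - inverse qm * qm) *\<^sub>C 1"
    by (simp only: qcap_add qcap_scaleC qcap_p) (simp add: scaleC_scaleC scaleC_diff_left)
  also have "inverse qm * qm = 1" using scalars_nonzero by simp
  finally have "qtr (\<lambda>i j k l. ip (db i j \<otimes> dp k l)) = (qm * (\<Sum>i\<in>UNIV. inverse (D i)) - 1) *\<^sub>C 1"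
    by (simp add: mult.commute)
  then show ?thesis
    by (simp add: cap_clinear[OF bim_clinear2(2), symmetric] qcap_clinear[OF bim_clinear2(2), symmetric]
        clinear_scaleC[OF bim_clinear2(2)] bim_assoc2)
qed

text \<open>The right-hand side of \<open>split_curv\<close> as a four-leg family in \<open>\<Omega> \<otimes> \<Omega>\<close>, with the summands ordered as
  \<open>C' \<delta>p\<close>, \<open>p \<delta>p\<close>, \<open>\<delta>p p\<close>.\<close>

definition curv_pairing where
  "curv_pairing i j = (\<lambda>a b e f. qcup D (db i b \<otimes> dp e f) j a
     + (- inverse qm) *\<^sub>C (p i j \<rhd>\<rhd> (db a b \<otimes> dp e f))
     + (- inverse qm) *\<^sub>C (db i j \<otimes> pdp a b e f))"

lemma split_curv_eq: "G (db i j) (curv (db a b \<otimes> dp e f)) = cpm *\<^sub>C curv_pairing i j a b e f"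
  by (simp add: split_curv db_P_def curv_pairing_def clinear_diff[OF tens_clinear(1)] clinear_scaleC[OF tens_clinear(1)]
      qcup_clinear[OF tens_clinear(1)] tens_act pdp_def)

lemma qtr_add: "qtr (\<lambda>i j k l. x i j k l + y i j k l) = qtr x + qtr y"
  and qtr_scaleC: "qtr (\<lambda>i j k l. a *\<^sub>C x i j k l) = a *\<^sub>C qtr x"
  by (simp_all only: cap_add qcap_add cap_scaleC qcap_scaleC)

text \<open>Bending the cup around turns the \<open>S\<close> in \<open>T\<close> into \<open>E'\<close> and \<open>E\<close> (\<open>cap_S\<close>). In one case the cup is straightened and \<open>St\<close>
  acts on \<open>\<delta>p \<otimes> \<partial>p\<close>; in both cases \<open>E\<close> meets \<open>St\<close> and produces \<open>tr(\<partial>p) = 0\<close>.\<close>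

lemma qtr_T_qcup: "cap (\<lambda>j k. cap (T (\<lambda>a b e f. qcup D (db i b \<otimes> dp e f) j a) k) l) = 0"
proof -
  define X where "X = (\<lambda>b e f. db i b \<otimes> dp e f)"
  have qX: "qcap D (X b) = 0" for b
    using qcap_clinear[OF tens_clinear(2), of "db i b" D dp]
    by (simp add: X_def qcap_dp clinear_0[OF tens_clinear(2)])
  have cSt: "cap (St X) = 0"
    by (simp add: cap_St qX fun_eq_iff)
  have St_cup: "St (\<lambda>b e f. qcup D (X b e f) j a) = qcup D (St X) j a" for j a
  proof -
    have "(\<lambda>b e f. qcup D (X b e f) j a) = (if j = a then inverse (D j) *\<^sub>C X else 0)"
      by (auto simp: qcup_def fun_eq_iff)
    then show ?thesis
      by (simp add: qcup_def clinear_scaleC[OF clinear_St] clinear_0[OF clinear_St])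
  qed
  have "(\<lambda>k. cap (T (\<lambda>a b e f. qcup D (X b e f) j a) k)) = (h1 * c) *\<^sub>C St X j" for j
  proof -
    have "qcap D (\<lambda>a. qcup D (St X) j a) = (\<Sum>a\<in>UNIV. if a = j then St X a else 0)"
      unfolding qcap_def qcup_def by (intro sum.cong refl) (auto simp: scaleC_scaleC D_nonzero)
    then have "qcap D (\<lambda>a. qcup D (St X) j a) = St X j" by simp
    moreover have "(\<lambda>a. cap (qcup D (St X) j a)) = 0"
      by (simp add: fun_eq_iff qcup_def clinear_scaleC[OF clinear_cap] cSt clinear_0[OF clinear_cap])
    moreover have "(\<lambda>k. cap (T (\<lambda>a b e f. qcup D (X b e f) j a) k))
        = (h1 * c) *\<^sub>C qcap D (\<lambda>a. qcup D (St X) j a) + h0 *\<^sub>C (\<lambda>a. cap (qcup D (St X) j a))"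
      unfolding T_def St_cup by (rule cap_S)
    ultimately show ?thesis by (simp only: scaleC_zero_right add_0_right)
  qed
  then have "cap (\<lambda>j k. cap (T (\<lambda>a b e f. qcup D (X b e f) j a) k) l) = cap (\<lambda>j k. ((h1 * c) *\<^sub>C St X j k) l)"
    by (simp add: fun_eq_iff)
  also have "\<dots> = ((h1 * c) *\<^sub>C cap (St X)) l"
    by (simp add: cap_apply cap_scaleC)
  also have "\<dots> = 0" by (simp add: cSt)
  finally show ?thesis by (simp add: X_def)
qed

text \<open>The three summands give \<open>0\<close>, \<open>- q\<^sup>-\<^sup>m (1 - q\<^sup>-\<^sup>a) g\<^sub>-\<^sub>+\<close> and \<open>- q\<^sup>-\<^sup>m\<^sup>-\<^sup>a g\<^sub>-\<^sub>+\<close>. For the second one \<open>E T(\<delta>p \<otimes> \<partial>p)\<close> is expressed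
  by the connection, for which \<open>p_nabla_dp\<close> is available; for the third one \<open>T(p \<partial>p) = q\<^sup>-\<^sup>a \<partial>p p\<close>.\<close>

lemma qtr_T_curv_pairing: "qtr (\<lambda>i j k l. cap (T (curv_pairing i j) k) l) = (- inverse qm) *\<^sub>C gmp"
proof -
  define N where "N = (\<lambda>k l. cap (T (\<lambda>a b e f. db a b \<otimes> dp e f) k) l)"
  have N: "N k l = inverse qa *\<^sub>C nabla (dp k l) + inverse qm *\<^sub>C (p k l \<rhd>\<rhd> gmp)" for k l
    using scalars_nonzero
    by (simp add: N_def nabla_dp scaleC_diff_right scaleC_scaleC mult.assoc[symmetric])
  have curv_pairing: "cap (T (curv_pairing i j) k) l = cap (T (\<lambda>a b e f. qcup D (db i b \<otimes> dp e f) j a) k) l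
      + (- inverse qm) *\<^sub>C (p i j \<rhd>\<rhd> N k l)
      + (- inverse qm * inverse qa) *\<^sub>C (db i j \<otimes> dp k l)" for i j k l
  proof -
    let ?A = "\<lambda>a b e f. qcup D (db i b \<otimes> dp e f) j a"
      and ?B = "\<lambda>a b e f. p i j \<rhd>\<rhd> (db a b \<otimes> dp e f)" and ?C = "\<lambda>a b e f. db i j \<otimes> pdp a b e f"
    have "curv_pairing i j = ?A + (- inverse qm) *\<^sub>C ?B + (- inverse qm) *\<^sub>C ?C"
      by (simp add: curv_pairing_def fun_eq_iff)
    then have "T (curv_pairing i j) = T ?A + (- inverse qm) *\<^sub>C T ?B + (- inverse qm) *\<^sub>C T ?C"
      by (simp only: clinear_add[OF clinear_T] clinear_scaleC[OF clinear_T])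
    then have *: "cap (T (curv_pairing i j) k) = cap (T ?A k) + (- inverse qm) *\<^sub>C cap (T ?B k) + (- inverse qm) *\<^sub>C cap (T ?C k)"
      by (simp only: plus_fun_apply scaleC_fun_apply clinear_add[OF clinear_cap] clinear_scaleC[OF clinear_cap])
    have B: "cap (T ?B k) l = p i j \<rhd>\<rhd> N k l"
      by (simp add: N_def cap_apply cap_clinear[OF bim_clinear2(1)] T_clinear[OF bim_clinear2(1)])
    have C: "cap (T ?C k) l = inverse qa *\<^sub>C (db i j \<otimes> dp k l)"
    proof -
      have "T pdp = inverse qa *\<^sub>C dpp"
        using scalars_nonzero by (simp add: dpp_T scaleC_scaleC)
      then have "cap (T pdp k) l = inverse qa *\<^sub>C dp k l"
        using fun_cong[OF fun_cong[OF del_p(1), of k], of l] by (simp add: clinear_scaleC[OF clinear_cap])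
      then show ?thesis
        by (simp add: cap_apply T_clinear[OF tens_clinear(2), symmetric] cap_clinear[OF tens_clinear(2), symmetric]
            clinear_scaleC[OF tens_clinear(2)])
    qed
    show ?thesis unfolding * by (simp add: B C scaleC_scaleC)
  qed
  have pN: "qtr (\<lambda>i j k l. p i j \<rhd>\<rhd> N k l) = (1 - inverse qa) *\<^sub>C gmp"
  proof -
    have "qtr (\<lambda>i j k l. p i j \<rhd>\<rhd> N k l) = qtr (\<lambda>i j k l. inverse qa *\<^sub>C (p i j \<rhd>\<rhd> nabla (dp k l))
        + inverse qm *\<^sub>C ((p i j * p k l) \<rhd>\<rhd> gmp))"
      by (simp add: N clinear_add[OF bim_clinear2(1)] clinear_scaleC[OF bim_clinear2(1)] bim_assoc2)
    also have "\<dots> = inverse qa *\<^sub>C qcap D (\<lambda>i l. - M i l) + inverse qm *\<^sub>C qm *\<^sub>C gmp"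
      by (simp only: qtr_add qtr_scaleC p_nabla_dp qtr_pp)
    also have "qcap D (\<lambda>i l. - M i l) = - gmp"
      by (simp add: gmp_def qcap_def sum_negf)
    finally show ?thesis
      using scalars_nonzero by (simp add: scaleC_scaleC scaleC_diff_left)
  qed
  have "qtr (\<lambda>i j k l. cap (T (curv_pairing i j) k) l)
      = (- inverse qm) *\<^sub>C (1 - inverse qa) *\<^sub>C gmp + (- inverse qm * inverse qa) *\<^sub>C gmp"
    unfolding curv_pairing qtr_add qtr_scaleC pN qtr_dbdp qtr_T_qcup by (simp add: qcap_def)
  also have "\<dots> = (- inverse qm) *\<^sub>C gmp"
    by (simp add: scaleC_scaleC scaleC_add_left[symmetric] algebra_simps)
  finally show ?thesis .
qed

text \<open>The left multiple \<open>p curv(g\<^sub>-\<^sub>+)\<close> drops out because \<open>\<delta>p p = 0\<close>, and of \<open>dp \<and> g\<^sub>-\<^sub>+\<close> the pairing sees only \<open>\<partial>p \<and> g\<^sub>-\<^sub>+\<close>.\<close>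

lemma split_curv_p_gmp: "cap (\<lambda>j k. G (db i j) (curv (p k l \<rhd>\<rhd> gmp)))
    = cpm *\<^sub>C cap (\<lambda>j k. ip (db i j \<otimes> dp k l) \<rhd>\<rhd> gmp)"
proof -
  have dp: "G (db i j) (wedge_id A (dp k l) gmp) = cpm *\<^sub>C (ip (db i j \<otimes> dp k l) \<rhd>\<rhd> gmp)" for j k
  proof -
    define F where "F z = G (db i j) (wedge_id A (dp k l) z) - cpm *\<^sub>C (ip (db i j \<otimes> dp k l) \<rhd>\<rhd> z)" for z
    have "clinear F"
      unfolding F_def
      by (rule clinear_difference[OF clinear_compose[OF clinear_split clinear_wedge_id] clinear_scaled[OF bim_clinear2(1)]])
    then have "F gmp = 0"
      by (rule gmp_zero) (simp add: F_def wedge_id_tens split_tens pair_s_dp_db pair_tens tens_act)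
    then show ?thesis by (simp add: F_def)
  qed
  have db: "G (db i j) (wedge_id A (db k l) gmp) = 0" for j k
    by (rule gmp_zero[OF clinear_compose[OF clinear_split clinear_wedge_id]])
      (simp add: wedge_id_tens split_db_db)
  have "cap (\<lambda>j k. db i j \<lhd> p k l) = 0"
    using fun_cong[OF fun_cong[OF del_p(2), of i], of l] by (simp add: cap_apply dbp_def)
  then have 0: "cap (\<lambda>j k. G (db i j \<lhd> p k l) u) = 0" for u
    by (simp add: cap_clinear[OF clinear_split_left, symmetric] clinear_0[OF clinear_split_left])
  have "cap (\<lambda>j k. G (db i j) (curv (p k l \<rhd>\<rhd> gmp)))
      = cap (\<lambda>j k. cpm *\<^sub>C (ip (db i j \<otimes> dp k l) \<rhd>\<rhd> gmp) + G (db i j \<lhd> p k l) (curv gmp))"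
    by (simp add: curv_lmul clinear_add[OF clinear_split] split_lmul dB_def clinear_add[OF clinear_wedge_id_left]
        dp db)
  also have "\<dots> = cpm *\<^sub>C cap (\<lambda>j k. ip (db i j \<otimes> dp k l) \<rhd>\<rhd> gmp)"
    by (simp only: cap_add cap_scaleC 0) simp
  finally show ?thesis .
qed

theorem ricci_gmp:
  "ricci_map A ip nabla s gmp = (- cpm * qa * (\<Sum>i\<in>UNIV. inverse (D i))) *\<^sub>C gmp"
proof -
  let ?d = "\<Sum>i\<in>UNIV. inverse (D i)"
  have "ricci_map A ip nabla s gmp = qtr (\<lambda>i j k l. G (db i j) (curv (nabla (dp k l))))"
    by (simp add: gmp_def M_apply[abs_def] qcap_clinear[OF clinear_ricci] cap_clinear[OF clinear_ricci]
        ricci_tens riemann_eq)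
  also have "\<dots> = qtr (\<lambda>i j k l. (qa * cpm) *\<^sub>C cap (T (curv_pairing i j) k) l
      + (- (qa * inverse qm)) *\<^sub>C G (db i j) (curv (p k l \<rhd>\<rhd> gmp)))"
  proof -
    have "G (db i j) (curv (cap (T (\<lambda>i j k l. db i j \<otimes> dp k l) k) l)) = cpm *\<^sub>C cap (T (curv_pairing i j) k) l" for i j k l
    proof -
      have L: "clinear (\<lambda>z. G (db i j) (curv z))" by (rule clinear_compose[OF clinear_split clinear_curv])
      have "G (db i j) (curv (cap (T (\<lambda>i j k l. db i j \<otimes> dp k l) k) l))
          = cap (T (\<lambda>a b e f. cpm *\<^sub>C curv_pairing i j a b e f) k) l"
        by (simp add: cap_apply cap_clinear[OF L] T_clinear[OF L] split_curv_eq)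
      moreover have "T (\<lambda>a b e f. cpm *\<^sub>C curv_pairing i j a b e f) = cpm *\<^sub>C T (curv_pairing i j)"
        using clinear_scaleC[OF clinear_T, of cpm "curv_pairing i j"] by (simp add: scaleC_fun_def)
      ultimately show ?thesis
        by (simp only: scaleC_fun_apply clinear_scaleC[OF clinear_cap])
    qed
    then show ?thesis
      by (simp add: nabla_dp clinear_diff[OF clinear_curv] clinear_scaleC[OF clinear_curv]
          clinear_diff[OF clinear_split] clinear_scaleC[OF clinear_split] scaleC_scaleC)
  qed
  also have "\<dots> = (qa * cpm) *\<^sub>C (- inverse qm) *\<^sub>C gmp
      + (- (qa * inverse qm)) *\<^sub>C cpm *\<^sub>C (qm * ?d - 1) *\<^sub>C gmp"
    unfolding qtr_add qtr_scaleC qtr_T_curv_pairing split_curv_p_gmp qcap_scaleC qtr_ip by simp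
  also have "\<dots> = (- cpm * qa * ?d) *\<^sub>C gmp"
    using scalars_nonzero
    by (simp add: scaleC_scaleC scaleC_add_left[symmetric] del: scaleC_minus_left)
      (simp add: field_simps)
  finally show ?thesis .
qed

end

section \<open>Braidings of the vector representation\<close>

lemma vtensor_axis: "vtensor (axis a 1) (axis c 1) = (axis (a, c) 1 :: complex^('i::finite \<times> 'j::finite))"
  by (auto simp: vtensor_def axis_def vec_eq_iff)

lemma vtensor_linear:
  "vtensor (x + x') y = vtensor x y + vtensor x' y" "vtensor x (y + y') = vtensor x y + vtensor x y'"
  "vtensor (a *s x) y = a *s vtensor x y" "vtensor x (a *s y) = a *s vtensor x y"
  "vtensor 0 y = 0" "vtensor x 0 = 0" "vtensor (- x) y = - vtensor x y" "vtensor x (- y) = - vtensor x y"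
  by (simp_all add: vtensor_def vec_eq_iff algebra_simps)

lemma kron_vtensor: "kron M M' *v vtensor (x :: complex^'i::finite) y = vtensor (M *v x) (M' *v (y :: complex^'j::finite))"
proof -
  have "(\<Sum>z\<in>UNIV. M $ i $ fst z * M' $ j $ snd z * (x $ fst z * y $ snd z))
      = (\<Sum>k\<in>UNIV. M $ i $ k * x $ k) * (\<Sum>l\<in>UNIV. M' $ j $ l * y $ l)" for i j
    by (simp add: sum_product sum.cartesian_product split_def mult_ac flip: UNIV_Times_UNIV)
  then show ?thesis
    by (simp add: kron_def vtensor_def matrix_vector_mult_def vec_eq_iff)
qed

lemma smult_simps:
  fixes x y :: "complex^'n"
  shows "a *s (b *s x) = (a * b) *s x" "a *s (x + y) = a *s x + a *s y" "a *s (x - y) = a *s x - a *s y"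
    "1 *s x = x" "0 *s x = 0" "a *s (0 :: complex^'n) = 0" "(- a) *s x = - (a *s x)"
    "a *s (- x) = - (a *s x)"
  by (simp_all add: vec_eq_iff algebra_simps)

lemma mv_linear:
  fixes M :: "complex^'n::finite^'m"
  shows "M *v (x + y) = M *v x + M *v y" "M *v (x - y) = M *v x - M *v y" "M *v (a *s x) = a *s (M *v x)"
    "M *v 0 = 0" "M *v (- x) = - (M *v x)"
  using matrix_vector_mult_diff_distrib[of M 0 x]
  by (simp_all add: matrix_vector_right_distrib matrix_vector_mult_diff_distrib vector_scalar_commute)

lemma mv_axis: "(M *v axis j 1) $ i = (M $ i $ j :: complex)"
  by (simp add: matrix_vector_mult_def axis_def if_distrib cong: if_cong)

lemma affine_mv:
  fixes M :: "complex^'n::finite^'n"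
  shows "(\<chi> x y. a * M $ x $ y + a' * mat 1 $ x $ y) *v v = a *s (M *v v) + a' *s v"
proof -
  have "(\<Sum>j\<in>UNIV. mat 1 $ i $ j * v $ j) = v $ i" for i
    using arg_cong[OF matrix_vector_mul_lid[of v], of "\<lambda>v. v $ i"] by (simp add: matrix_vector_mult_def)
  then show ?thesis
    by (simp only: vec_eq_iff matrix_vector_mult_def vec_lambda_beta vector_add_component
        vector_smult_component distrib_right sum.distrib mult.assoc sum_distrib_left[symmetric] simp_thms)
qed

lemma matrix_eq_axis: "M = N" if "\<And>j. M *v axis j 1 = N *v (axis j 1 :: complex^'n::finite)"
  by (simp add: vec_eq_iff) (metis that mv_axis)

lemma invertible_inv:
  fixes M :: "complex^'n::finite^'n"
  assumes "N ** M = mat 1"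
  shows "matrix_inv M = N" "M ** N = mat 1"
proof -
  show "M ** N = mat 1" using assms matrix_left_right_inverse by blast
  then have "invertible M" using assms by (auto simp: invertible_def)
  then have "M ** matrix_inv M = mat 1" 
    unfolding invertible_def matrix_inv_def by (metis (mono_tags, lifting) someI_ex)
  then have "N ** M ** matrix_inv M = N" by (simp add: matrix_mul_assoc[symmetric])
  then show "matrix_inv M = N" by (simp add: assms)
qed

text \<open>The eigenvalue of the \<open>i\<close>-th \<open>K\<close> on the \<open>j\<close>-th vector of a chain.\<close>

definition K_eigval :: "complex \<Rightarrow> nat \<Rightarrow> nat \<Rightarrow> complex" where
  "K_eigval q i j = (if j = i then q else if j = i + 1 then inverse q else 1)"

text \<open>A module with basis \<open>b 1, \<dots>, b (r + 1)\<close> on which the \<open>i\<close>-th lowering operator maps the \<open>i\<close>-th vector to a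
  multiple of the next one and does nothing else. The generators are numbered through the permutation \<open>\<tau>\<close>, which allows for both
  the vector representation and its dual; the scalars \<open>\<phi>\<close> are free because the given weight basis is.\<close>

locale chain =
  fixes q :: complex and r :: nat and X :: "'n::finite uq_module"
    and b :: "nat \<Rightarrow> 'n" and \<tau> :: "nat \<Rightarrow> nat" and \<phi> :: "nat \<Rightarrow> complex"
  assumes q0: "q \<noteq> 0" and r1: "1 \<le> r"
    and bij: "bij_betw b {1..r + 1} UNIV"
    and \<tau>: "\<And>i. i \<in> {1..r} \<Longrightarrow> \<tau> i \<in> {1..r}" and \<tau>_onto: "\<tau> ` {1..r} = {1..r}"
    and \<phi>: "\<And>i. i \<in> {1..r} \<Longrightarrow> \<phi> i \<noteq> 0"
    and K: "\<And>i j. i \<in> {1..r} \<Longrightarrow> j \<in> {1..r + 1} \<Longrightarrow>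
      Kmat X (\<tau> i) *v axis (b j) 1 = K_eigval q i j *s axis (b j) 1"
    and E: "\<And>i j. i \<in> {1..r} \<Longrightarrow> j \<in> {1..r + 1} \<Longrightarrow>
      Emat X (\<tau> i) *v axis (b j) 1 = (if j = i + 1 then inverse (\<phi> i) *s axis (b i) 1 else 0)"
    and F: "\<And>i j. i \<in> {1..r} \<Longrightarrow> j \<in> {1..r + 1} \<Longrightarrow>
      Fmat X (\<tau> i) *v axis (b j) 1 = (if j = i then \<phi> i *s axis (b (i + 1)) 1 else 0)"
begin

lemma K_eigval_nonzero: "K_eigval q i j \<noteq> 0" using q0 by (simp add: K_eigval_def)

lemma b_eq: "i \<in> {1..r + 1} \<Longrightarrow> j \<in> {1..r + 1} \<Longrightarrow> b i = b j \<longleftrightarrow> i = j"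
  using bij by (auto simp: bij_betw_def inj_on_def)

lemma b_onto: obtains j where "j \<in> {1..r + 1}" "x = b j"
  using bij by (metis UNIV_I bij_betw_def imageE)

lemma K_entry: "i \<in> {1..r} \<Longrightarrow> j \<in> {1..r + 1} \<Longrightarrow> Kmat X (\<tau> i) $ x $ b j = (if x = b j then K_eigval q i j else 0)"
  using arg_cong[OF K, of i j "\<lambda>v. v $ x"] unfolding mv_axis by (simp add: axis_def)

lemma Kinv:
  assumes i: "i \<in> {1..r}"
  shows "Kmat X (\<tau> i) ** matrix_inv (Kmat X (\<tau> i)) = mat 1" "matrix_inv (Kmat X (\<tau> i)) ** Kmat X (\<tau> i) = mat 1"
    "j \<in> {1..r + 1} \<Longrightarrow> matrix_inv (Kmat X (\<tau> i)) *v axis (b j) 1 = inverse (K_eigval q i j) *s axis (b j) 1"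
proof -
  define N :: "complex^'n^'n" where
    "N = (\<chi> x y. if x = y then inverse (K_eigval q i (the_inv_into {1..r+1} b y)) else 0)"
  have N: "N *v axis (b j) 1 = inverse (K_eigval q i j) *s axis (b j) 1" if j: "j \<in> {1..r + 1}" for j
  proof -
    have "the_inv_into {1..r+1} b (b j) = j"
      using bij that by (simp add: bij_betw_def the_inv_into_f_f)
    then show ?thesis
      by (simp add: vec_eq_iff mv_axis N_def) (simp add: axis_def)
  qed
  have "N ** Kmat X (\<tau> i) = mat 1"
  proof (rule matrix_eq_axis)
    fix x
    obtain j where j: "j \<in> {1..r + 1}" "x = b j" by (rule b_onto)
    then show "N ** Kmat X (\<tau> i) *v axis x 1 = mat 1 *v axis x 1"
      using i K_eigval_nonzero
      by (simp add: matrix_vector_mul_assoc[symmetric] K mv_linear N smult_simps)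
  qed
  from invertible_inv[OF this] N show
    "Kmat X (\<tau> i) ** matrix_inv (Kmat X (\<tau> i)) = mat 1" "matrix_inv (Kmat X (\<tau> i)) ** Kmat X (\<tau> i) = mat 1"
    "j \<in> {1..r + 1} \<Longrightarrow> matrix_inv (Kmat X (\<tau> i)) *v axis (b j) 1 = inverse (K_eigval q i j) *s axis (b j) 1"
    using \<open>N ** Kmat X (\<tau> i) = mat 1\<close> by simp_all
qed

abbreviation vt :: "nat \<Rightarrow> nat \<Rightarrow> complex^('n \<times> 'n)" where
  "vt i j \<equiv> vtensor (axis (b i) 1) (axis (b j) 1)"

lemma tensor_E:
  "Emat (tensor_module Y Z) t *v vtensor x y = vtensor (Emat Y t *v x) (Kmat Z t *v y) + vtensor x (Emat Z t *v y)"
  and tensor_F: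
  "Fmat (tensor_module Y Z) t *v vtensor x y = vtensor (Fmat Y t *v x) y + vtensor (matrix_inv (Kmat Y t) *v x) (Fmat Z t *v y)"
  for Y Z :: "'m::finite uq_module"
  by (simp_all add: tensor_module_def matrix_vector_mult_add_rdistrib kron_vtensor)

lemma b_onto2: obtains i j where "i \<in> {1..r + 1}" "j \<in> {1..r + 1}" "z = (b i, b j)"
proof -
  obtain i where i: "i \<in> {1..r + 1}" "fst z = b i" by (rule b_onto)
  obtain j where j: "j \<in> {1..r + 1}" "snd z = b j" by (rule b_onto)
  have "z = (b i, b j)" using i j by (simp add: prod_eq_iff)
  with i(1) j(1) show thesis by (rule that)
qed

lemma vt_entry:
  assumes "i \<in> {1..r + 1}" "j \<in> {1..r + 1}" "k \<in> {1..r + 1}" "l \<in> {1..r + 1}"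
  shows "vt i j $ (b k, b l) = (if k = i \<and> l = j then 1 else 0)"
  unfolding vtensor_axis using assms by (auto simp: axis_def b_eq)

lemma entry_mv: "R $ z $ (b i, b j) = (R *v vt i j) $ z"
  by (simp add: vtensor_axis mv_axis)

context
  fixes R :: "complex^('n \<times> 'n)^('n \<times> 'n)" and t :: complex
  assumes RE: "\<forall>i\<in>{1..r}. R ** Emat (tensor_module X X) i = Emat (tensor_module X X) i ** R"
    and RF: "\<forall>i\<in>{1..r}. R ** Fmat (tensor_module X X) i = Fmat (tensor_module X X) i ** R"
    and R0: "R *v vt 1 (r + 1) = t *s vt (r + 1) 1"
begin

lemma RE': "i \<in> {1..r} \<Longrightarrow> R *v (Emat (tensor_module X X) (\<tau> i) *v x) = Emat (tensor_module X X) (\<tau> i) *v (R *v x)"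
  using bspec[OF RE \<tau>] by (simp add: matrix_vector_mul_assoc)

lemma RF': "i \<in> {1..r} \<Longrightarrow> R *v (Fmat (tensor_module X X) (\<tau> i) *v x) = Fmat (tensor_module X X) (\<tau> i) *v (R *v x)"
  using bspec[OF RF \<tau>] by (simp add: matrix_vector_mul_assoc)

text \<open>Starting from (highest) \<open>\<otimes>\<close> (lowest), lowering operators reach \<open>b i \<otimes> b (r + 1)\<close>, because they annihilate the second factor.
  The raising operators then decrease the second index, which is the induction in \<open>self_braiding\<close>.\<close>

lemma self_braiding_last:
  "1 \<le> i \<Longrightarrow> i \<le> r + 1 \<Longrightarrow> R *v vt i (r + 1) = (if i = r + 1 then t * q else t) *s vt (r + 1) i"
proof (induction i rule: nat_induct_at_least)
  case base
  show ?case using r1 R0 by simp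
next
  case (Suc i)
  then have i: "i \<in> {1..r}" "i \<in> {1..r + 1}" "Suc i \<in> {1..r + 1}" "r + 1 \<in> {1..r + 1}" by auto
  have IH: "R *v vt i (r + 1) = t *s vt (r + 1) i" using Suc by simp
  have "vt (Suc i) (r + 1) = inverse (\<phi> i) *s (Fmat (tensor_module X X) (\<tau> i) *v vt i (r + 1))"
    using i \<phi>[of i] by (simp add: tensor_F F vtensor_linear smult_simps)
  then have "R *v vt (Suc i) (r + 1) = inverse (\<phi> i) *s (Fmat (tensor_module X X) (\<tau> i) *v (t *s vt (r + 1) i))"
    by (simp only: mv_linear RF'[OF i(1)] IH)
  also have "\<dots> = (if Suc i = r + 1 then t * q else t) *s vt (r + 1) (Suc i)"
    using i \<phi>[of i] by (auto simp: mv_linear tensor_F F Kinv vtensor_linear smult_simps K_eigval_def)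
  finally show ?case .
qed

lemma self_braiding:
  assumes "i \<in> {1..r + 1}" "j \<in> {1..r + 1}"
  shows "R *v vt i j = t *s (if i = j then q *s vt i i
    else vt j i + (if j < i then (q - inverse q) *s vt i j else 0))"
proof -
  have "j \<le> r + 1 \<Longrightarrow> 1 \<le> j \<Longrightarrow> \<forall>i\<in>{1..r+1}. R *v vt i j = t *s (if i = j then q *s vt i i
    else vt j i + (if j < i then (q - inverse q) *s vt i j else 0))" for j
  proof (induction j rule: inc_induct)
    case base
    show ?case using self_braiding_last by (auto simp: smult_simps)
  next
    case (step j)
    show ?case
    proof
      fix i assume i: "i \<in> {1..r+1}"
      have j: "j \<in> {1..r}" "j \<in> {1..r + 1}" "Suc j \<in> {1..r + 1}" using step by auto
      let ?E = "Emat (tensor_module X X) (\<tau> j)"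
      have IH: "i \<in> {1..r+1} \<Longrightarrow> R *v vt i (Suc j) = t *s (if i = Suc j then q *s vt i i
          else vt (Suc j) i + (if Suc j < i then (q - inverse q) *s vt i (Suc j) else 0))" for i
        using step.IH by auto
      have "vt i j = \<phi> j *s (?E *v vt i (Suc j)) - (if i = Suc j then inverse q *s vt j (Suc j) else 0)"
        using i j \<phi>[of j] by (auto simp: tensor_E E K vtensor_linear smult_simps K_eigval_def)
      then have "R *v vt i j = \<phi> j *s (?E *v (R *v vt i (Suc j)))
          - (if i = Suc j then inverse q *s (R *v vt j (Suc j)) else 0)"
        using j by (simp add: mv_linear RE')
      also have "\<dots> = t *s (if i = j then q *s vt i i
          else vt j i + (if j < i then (q - inverse q) *s vt i j else 0))"
      proof -
        consider "i = Suc j" | "i = j" | "i < j" | "Suc j < i" by linarith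
        then show ?thesis
        proof cases
          case 1
          then show ?thesis
            using i j \<phi>[of j] q0
            by (simp add: IH mv_linear tensor_E E K vtensor_linear smult_simps K_eigval_def)
              (simp add: vec_eq_iff field_simps)
        next
          case 2
          then show ?thesis
            using i j \<phi>[of j]
            by (simp add: IH mv_linear tensor_E E K vtensor_linear smult_simps K_eigval_def)
        next
          case 3
          then show ?thesis
            using i j \<phi>[of j]
            by (simp add: IH mv_linear tensor_E E K vtensor_linear smult_simps K_eigval_def)
        next
          case 4
          then show ?thesis
            using i j \<phi>[of j]
            by (simp add: IH mv_linear tensor_E E K vtensor_linear smult_simps K_eigval_def)
              (simp add: vec_eq_iff field_simps)?
        qed
      qed
      finally show "R *v vt i j = t *s (if i = j then q *s vt i i
          else vt j i + (if j < i then (q - inverse q) *s vt i j else 0))" .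
    qed
  qed
  then show ?thesis using assms by auto
qed

text \<open>The formula for \<open>R\<close> on basis vectors gives \<open>R R = t\<^sup>2 + t (q - q\<^sup>-\<^sup>1) R\<close>.\<close>

lemma self_braiding_inv:
  assumes t: "t \<noteq> 0"
  shows "R ** matrix_inv R = mat 1" "matrix_inv R ** R = mat 1"
    "matrix_inv R $ x $ y = inverse (t * t) * R $ x $ y + (- inverse t * (q - inverse q)) * mat 1 $ x $ y"
proof -
  define N where "N = (\<chi> x y. inverse (t * t) * R $ x $ y + (- inverse t * (q - inverse q)) * mat 1 $ x $ y)"
  have N: "N *v x = inverse (t * t) *s (R *v x) + (- inverse t * (q - inverse q)) *s x" for x
    unfolding N_def by (rule affine_mv)
  have "N ** R = mat 1"
  proof (rule matrix_eq_axis)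
    fix z :: "'n \<times> 'n"
    obtain i j where z: "i \<in> {1..r + 1}" "j \<in> {1..r + 1}" "z = (b i, b j)"
      by (rule b_onto2)
    have "N *v (R *v vt i j) = vt i j"
    proof -
      obtain d where d: "q - inverse q = d" by blast
      \<comment> \<open>The vectors \<open>b i \<otimes> b i\<close> are eigenvectors with eigenvalue \<open>t q\<close>, a root of the quadratic relation.\<close>
      have "q * q = 1 + (q - inverse q) * q" using q0 by (simp add: algebra_simps)
      then have q: "q * q = 1 + d * q" by (simp only: d)
      have RR: "R *v (R *v vt i j) = (t * t) *s vt i j + (t * d) *s (R *v vt i j)"
      proof (cases "i = j")
        case True
        have "t * q * (t * q) = t * t * (q * q)" by (simp only: mult_ac)
        also have "\<dots> = t * t + t * d * (t * q)" unfolding q by (simp add: distrib_left mult_ac)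
        finally have "(t * q * (t * q)) *s vt i i = (t * t + t * d * (t * q)) *s vt i i" by (rule arg_cong)
        then show ?thesis using z True
          by (simp add: self_braiding mv_linear smult_simps vector_sadd_rdistrib mult.assoc)
      next
        case False
        then consider "i < j" | "j < i" by linarith
        then show ?thesis
          using z by cases (simp_all add: self_braiding d mv_linear smult_simps mult_ac)
      qed
      have "N *v (R *v vt i j) = (inverse (t * t) * (t * t)) *s vt i j
          + (inverse (t * t) * (t * d) - inverse t * d) *s (R *v vt i j)"
        by (simp add: N d RR smult_simps vector_sadd_rdistrib vector_sub_rdistrib)
      moreover have "inverse (t * t) * (t * d) - inverse t * d = 0"
        using t by (simp add: field_simps)
      moreover have "inverse (t * t) * (t * t) = 1" using t by (intro left_inverse) simp
      ultimately show ?thesis by (simp only: smult_simps(4,5) add_0_right)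
    qed
    then show "N ** R *v axis z 1 = mat 1 *v axis z 1"
      by (simp add: matrix_vector_mul_assoc[symmetric] z vtensor_axis)
  qed
  from invertible_inv[OF this] this
  show "R ** matrix_inv R = mat 1" "matrix_inv R ** R = mat 1"
    "matrix_inv R $ x $ y = inverse (t * t) * R $ x $ y + (- inverse t * (q - inverse q)) * mat 1 $ x $ y"
    by (simp_all add: N_def)
qed

lemma self_braiding_entry:
  assumes "i \<in> {1..r + 1}" "j \<in> {1..r + 1}" "k \<in> {1..r + 1}" "l \<in> {1..r + 1}"
  shows "R $ (b k, b l) $ (b i, b j) = t * (if i = j then (if k = i \<and> l = i then q else 0)
    else (if k = j \<and> l = i then 1 else 0) + (if j < i \<and> k = i \<and> l = j then q - inverse q else 0))"
proof -
  show ?thesis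
    unfolding entry_mv self_braiding[OF assms(1,2)]
    using assms by (simp add: vt_entry)
qed

end

lemma
  assumes i: "i \<in> {1..r}" and j: "j \<in> {1..r + 1}"
  shows dual_K: "Kmat (dual_module X) (\<tau> i) *v axis (b j) 1 = inverse (K_eigval q i j) *s axis (b j) 1"
    and dual_E: "Emat (dual_module X) (\<tau> i) *v axis (b j) 1
      = (if j = i then (- q * inverse (\<phi> i)) *s axis (b (i + 1)) 1 else 0)"
    and dual_F: "Fmat (dual_module X) (\<tau> i) *v axis (b j) 1
      = (if j = i + 1 then (- inverse q * \<phi> i) *s axis (b i) 1 else 0)"
proof -
  have tr: "(transpose N *v axis (b j) 1) $ x = (N *v axis x 1) $ b j" for N :: "complex^'n^'n" and x
    by (simp add: mv_axis transpose_def)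
  have neg: "- N *v x = - (N *v x)" for N :: "complex^'n^'n" and x
    by (simp add: vec_eq_iff matrix_vector_mult_def sum_negf)
  have d: "Kmat (dual_module X) k = transpose (matrix_inv (Kmat X k))"
    "Emat (dual_module X) k = transpose (- (Emat X k ** matrix_inv (Kmat X k)))"
    "Fmat (dual_module X) k = transpose (- (Kmat X k ** Fmat X k))" for k
    by (simp_all add: dual_module_def)
  have i': "i \<in> {1..r + 1}" "i + 1 \<in> {1..r + 1}" using i by auto
  show "Kmat (dual_module X) (\<tau> i) *v axis (b j) 1 = inverse (K_eigval q i j) *s axis (b j) 1"
  proof (unfold vec_eq_iff, rule)
    fix x
    obtain l where l: "l \<in> {1..r + 1}" "x = b l" by (rule b_onto)
    show "(Kmat (dual_module X) (\<tau> i) *v axis (b j) 1) $ x = (inverse (K_eigval q i j) *s axis (b j) 1) $ x"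
      unfolding d tr l(2) Kinv(3)[OF i l(1)] using j l by (auto simp: axis_def b_eq)
  qed
  show "Emat (dual_module X) (\<tau> i) *v axis (b j) 1
      = (if j = i then (- q * inverse (\<phi> i)) *s axis (b (i + 1)) 1 else 0)"
  proof (unfold vec_eq_iff, rule)
    fix x
    obtain l where l: "l \<in> {1..r + 1}" "x = b l" by (rule b_onto)
    show "(Emat (dual_module X) (\<tau> i) *v axis (b j) 1) $ x
        = (if j = i then (- q * inverse (\<phi> i)) *s axis (b (i + 1)) 1 else 0) $ x"
      unfolding d tr neg matrix_vector_mul_assoc[symmetric] l(2) Kinv(3)[OF i l(1)] mv_linear E[OF i l(1)]
      using i i' j l q0 by (auto simp: axis_def b_eq K_eigval_def)
  qed
  show "Fmat (dual_module X) (\<tau> i) *v axis (b j) 1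
      = (if j = i + 1 then (- inverse q * \<phi> i) *s axis (b i) 1 else 0)"
  proof (unfold vec_eq_iff, rule)
    fix x
    obtain l where l: "l \<in> {1..r + 1}" "x = b l" by (rule b_onto)
    show "(Fmat (dual_module X) (\<tau> i) *v axis (b j) 1) $ x
        = (if j = i + 1 then (- inverse q * \<phi> i) *s axis (b i) 1 else 0) $ x"
      unfolding d tr neg matrix_vector_mul_assoc[symmetric] l(2) F[OF i l(1)]
      using i i' j l by (cases "l = i"; simp add: mv_linear K; auto simp: axis_def b_eq K_eigval_def)
  qed
qed

text \<open>The dual basis in reverse order is a chain, with the generators in reverse order. So the braiding of \<open>V\<^sup>*\<close> with itself needs no
  further computation.\<close>

lemma dual_chain: "chain q r (dual_module X) (\<lambda>k. b (r + 2 - k)) (\<lambda>i. \<tau> (r + 1 - i)) (\<lambda>i. - inverse q * \<phi> (r + 1 - i))"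
proof
  have rev: "bij_betw (\<lambda>k. r + 2 - k) {1..r + 1} {1..r + 1}"
    by (rule bij_betw_byWitness[where f' = "\<lambda>k. r + 2 - k"]) auto
  show "bij_betw (\<lambda>k. b (r + 2 - k)) {1..r + 1} UNIV"
    using bij_betw_trans[OF rev bij] by (simp add: o_def)
  have "(\<lambda>i. r + 1 - i) ` {1..r} = {1..r}"
  proof -
    have "bij_betw (\<lambda>k. r + 1 - k) {1..r} {1..r}"
      by (rule bij_betw_byWitness[where f' = "\<lambda>k. r + 1 - k"]) auto
    then show ?thesis by (simp add: bij_betw_def)
  qed
  then show "(\<lambda>i. \<tau> (r + 1 - i)) ` {1..r} = {1..r}"
    using \<tau>_onto by (metis image_image)
next
  fix i j assume i: "i \<in> {1..r}" and j: "j \<in> {1..r + 1}"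
  then have ij: "r + 1 - i \<in> {1..r}" "r + 2 - j \<in> {1..r + 1}" by auto
  have s: "Suc (r + 1 - i) = r + 2 - i" using i by auto
  show "Kmat (dual_module X) (\<tau> (r + 1 - i)) *v axis (b (r + 2 - j)) 1 = K_eigval q i j *s axis (b (r + 2 - j)) 1"
    using dual_K[OF ij] i j by (auto simp: K_eigval_def)
  have "r + 2 - j = r + 1 - i \<longleftrightarrow> j = i + 1" using i j by auto
  then show "Emat (dual_module X) (\<tau> (r + 1 - i)) *v axis (b (r + 2 - j)) 1
    = (if j = i + 1 then inverse (- inverse q * \<phi> (r + 1 - i)) *s axis (b (r + 2 - i)) 1 else 0)"
    using dual_E[OF ij] i j s by (simp add: mult.commute)
  have "r + 2 - j = r + 1 - i + 1 \<longleftrightarrow> j = i" "r + 2 - (i + 1) = r + 1 - i" using i j by auto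
  then show "Fmat (dual_module X) (\<tau> (r + 1 - i)) *v axis (b (r + 2 - j)) 1
    = (if j = i then (- inverse q * \<phi> (r + 1 - i)) *s axis (b (r + 2 - (i + 1))) 1 else 0)"
    using dual_F[OF ij] i j s by simp
next
  fix i assume "i \<in> {1..r}"
  then have "r + 1 - i \<in> {1..r}" by auto
  then show "\<tau> (r + 1 - i) \<in> {1..r}" "- inverse q * \<phi> (r + 1 - i) \<noteq> 0"
    using \<tau> \<phi> q0 by auto
qed (use q0 r1 in auto)

lemma dual_Kinv:
  assumes i: "i \<in> {1..r}" and j: "j \<in> {1..r + 1}"
  shows "matrix_inv (Kmat (dual_module X) (\<tau> i)) *v axis (b j) 1 = K_eigval q i j *s axis (b j) 1"
proof -
  have "r + 1 - i \<in> {1..r}" "r + 2 - j \<in> {1..r + 1}" "r + 1 - (r + 1 - i) = i" "r + 2 - (r + 2 - j) = j"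
    using i j by auto
  then have "matrix_inv (Kmat (dual_module X) (\<tau> i)) *v axis (b j) 1
      = inverse (K_eigval q (r + 1 - i) (r + 2 - j)) *s axis (b j) 1"
    using chain.Kinv(3)[OF dual_chain, of "r + 1 - i" "r + 2 - j"] by simp
  also have "inverse (K_eigval q (r + 1 - i) (r + 2 - j)) = K_eigval q i j"
    using i j by (auto simp: K_eigval_def)
  finally show ?thesis .
qed

context
  fixes R :: "complex^('n \<times> 'n)^('n \<times> 'n)" and u :: complex
  assumes RE: "\<forall>i\<in>{1..r}. R ** Emat (tensor_module X (dual_module X)) i = Emat (tensor_module (dual_module X) X) i ** R"
    and RF: "\<forall>i\<in>{1..r}. R ** Fmat (tensor_module X (dual_module X)) i = Fmat (tensor_module (dual_module X) X) i ** R"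
    and R0: "R *v vt 1 1 = (u * inverse q) *s vt 1 1"
begin

lemma RE2: "i \<in> {1..r} \<Longrightarrow> R *v (Emat (tensor_module X (dual_module X)) (\<tau> i) *v x) = Emat (tensor_module (dual_module X) X) (\<tau> i) *v (R *v x)"
  using bspec[OF RE \<tau>] by (simp add: matrix_vector_mul_assoc)

lemma RF2: "i \<in> {1..r} \<Longrightarrow> R *v (Fmat (tensor_module X (dual_module X)) (\<tau> i) *v x) = Fmat (tensor_module (dual_module X) X) (\<tau> i) *v (R *v x)"
  using bspec[OF RF \<tau>] by (simp add: matrix_vector_mul_assoc)

text \<open>As for \<open>self_braiding\<close>, but the lowest vector of the dual is the first one and raising increases the index.\<close>

lemma dual_braiding_first:
  "1 \<le> i \<Longrightarrow> i \<le> r + 1 \<Longrightarrow> R *v vt i 1 = (if i = 1 then u * inverse q else u) *s vt 1 i"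
proof (induction i rule: nat_induct_at_least)
  case base
  show ?case using R0 by simp
next
  case (Suc i)
  then have i: "i \<in> {1..r}" "i \<in> {1..r + 1}" "Suc i \<in> {1..r + 1}" "1 \<in> {1..r + 1}" by auto
  let ?F = "Fmat (tensor_module (dual_module X) X) (\<tau> i)"
  have IH: "R *v vt i 1 = (if i = 1 then u * inverse q else u) *s vt 1 i" using Suc by simp
  have "vt (Suc i) 1 = inverse (\<phi> i) *s (Fmat (tensor_module X (dual_module X)) (\<tau> i) *v vt i 1)"
    using i \<phi>[of i] by (auto simp: tensor_F F dual_F vtensor_linear smult_simps)
  then have "R *v vt (Suc i) 1 = inverse (\<phi> i) *s (?F *v ((if i = 1 then u * inverse q else u) *s vt 1 i))"
    using i by (simp only: mv_linear RF2 IH)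
  also have "\<dots> = u *s vt 1 (Suc i)"
    using i \<phi>[of i] q0
    by (auto simp: mv_linear tensor_F F dual_F dual_Kinv vtensor_linear smult_simps K_eigval_def) (simp_all add: field_simps)
  finally show ?case using i by simp
qed

lemma dual_step:
  assumes i: "i \<in> {1..r + 1}" and j: "j \<in> {1..r}"
  shows "R *v vt i (Suc j) = (- (inverse q * \<phi> j)) *s (Emat (tensor_module (dual_module X) X) (\<tau> j) *v (R *v vt i j))
    + (if i = Suc j then (inverse q * inverse q) *s (R *v vt j j) else 0)"
proof -
  have j': "j \<in> {1..r + 1}" using j by auto
  have "vt i (Suc j) = (- (inverse q * \<phi> j)) *s (Emat (tensor_module X (dual_module X)) (\<tau> j) *v vt i j)
      + (if i = Suc j then (inverse q * inverse q) *s vt j j else 0)"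
    using i j j' \<phi>[OF j] q0
    by (auto simp: tensor_E E dual_E dual_K vtensor_linear smult_simps K_eigval_def field_simps)
  then show ?thesis using j by (simp add: mv_linear RE2 if_distrib cong: if_cong)
qed

text \<open>On zero weight vectors the braiding is not a transposition. It suffices to know that its correction term \<open>L\<close> to the
  transposition of \<open>b j \<otimes> b j\<close> is annihilated by all further raising operators; the recursion for the diagonal vectors determines
  it, and all later computations with it go by this recursion.\<close>

lemma dual_braiding_aux:
  "1 \<le> j \<Longrightarrow> j \<le> r + 1 \<Longrightarrow>
    (\<forall>i\<in>{1..r+1}. i \<noteq> j \<longrightarrow> R *v vt i j = u *s vt j i) \<and>
    (\<exists>L. R *v vt j j = (u * inverse q) *s vt j j + L \<and>
       (\<forall>m\<in>{1..r}. j \<le> m \<longrightarrow> Emat (tensor_module (dual_module X) X) (\<tau> m) *v L = 0))"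
  and dual_braiding_rec:
  "j \<in> {1..r} \<Longrightarrow> R *v vt (Suc j) (Suc j) = (u * inverse q) *s (vt (Suc j) (Suc j) - vt j j)
       + (inverse q * inverse q) *s (R *v vt j j)"
proof -
  let ?P = "\<lambda>j. (\<forall>i\<in>{1..r+1}. i \<noteq> j \<longrightarrow> R *v vt i j = u *s vt j i) \<and>
    (\<exists>L. R *v vt j j = (u * inverse q) *s vt j j + L \<and>
       (\<forall>m\<in>{1..r}. j \<le> m \<longrightarrow> Emat (tensor_module (dual_module X) X) (\<tau> m) *v L = 0))"
  have rec: "R *v vt (Suc j) (Suc j) = (u * inverse q) *s (vt (Suc j) (Suc j) - vt j j)
       + (inverse q * inverse q) *s (R *v vt j j)" if j: "j \<in> {1..r}" and P: "?P j" for j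
  proof -
    have j': "j \<in> {1..r + 1}" "Suc j \<in> {1..r + 1}" using j by auto
    have "R *v vt (Suc j) j = u *s vt j (Suc j)" using P j' by auto
    then show ?thesis
      using dual_step[OF j'(2) j] j j' \<phi>[OF j] q0
      by (simp add: mv_linear tensor_E E dual_E K dual_K vtensor_linear smult_simps K_eigval_def)
        (simp add: vec_eq_iff field_simps)
  qed
  have P: "?P j" if "1 \<le> j" "j \<le> r + 1" for j
    using that
  proof (induction j rule: nat_induct_at_least)
    case base
    have "R *v vt i 1 = u *s vt 1 i" if "i \<in> {1..r+1}" "i \<noteq> 1" for i
      using dual_braiding_first[of i] that by simp
    moreover have "R *v vt 1 1 = (u * inverse q) *s vt 1 1 + 0" using R0 by simp
    ultimately show ?case by (metis mv_linear(4))
  next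
    case (Suc j)
    then have P: "?P j" and j: "j \<in> {1..r}" "j \<in> {1..r + 1}" "Suc j \<in> {1..r + 1}" by auto
    obtain L where L: "R *v vt j j = (u * inverse q) *s vt j j + L"
      "\<And>m. m \<in> {1..r} \<Longrightarrow> j \<le> m \<Longrightarrow> Emat (tensor_module (dual_module X) X) (\<tau> m) *v L = 0"
      using P by blast
    have "R *v vt i (Suc j) = u *s vt (Suc j) i" if i: "i \<in> {1..r+1}" "i \<noteq> Suc j" for i
    proof (cases "i = j")
      case True
      then show ?thesis
        using dual_step[OF i(1) j(1)] L(2)[OF j(1)] j \<phi>[OF j(1)] q0
        by (simp add: L(1) mv_linear tensor_E E dual_E K dual_K vtensor_linear smult_simps K_eigval_def)
          (simp add: field_simps)
    next
      case False
      then have "R *v vt i j = u *s vt j i" using P i by auto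
      then show ?thesis
        using False dual_step[OF i(1) j(1)] i j \<phi>[OF j(1)] q0
        by (simp add: mv_linear tensor_E E dual_E K dual_K vtensor_linear smult_simps K_eigval_def)
          (simp add: field_simps)
    qed
    moreover have "\<exists>L. R *v vt (Suc j) (Suc j) = (u * inverse q) *s vt (Suc j) (Suc j) + L \<and>
       (\<forall>m\<in>{1..r}. Suc j \<le> m \<longrightarrow> Emat (tensor_module (dual_module X) X) (\<tau> m) *v L = 0)"
    proof (intro exI conjI ballI impI)
      let ?L = "(inverse q * inverse q) *s ((u * inverse q) *s vt j j + L) - (u * inverse q) *s vt j j"
      show "R *v vt (Suc j) (Suc j) = (u * inverse q) *s vt (Suc j) (Suc j) + ?L"
        unfolding rec[OF j(1) P] L(1) by (simp add: smult_simps)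
      fix m assume "m \<in> {1..r}" "Suc j \<le> m"
      then show "Emat (tensor_module (dual_module X) X) (\<tau> m) *v ?L = 0"
        using L(2)[of m] j by (simp add: mv_linear tensor_E E dual_E vtensor_linear smult_simps)
    qed
    ultimately show ?case by blast
  qed
  show "1 \<le> j \<Longrightarrow> j \<le> r + 1 \<Longrightarrow> ?P j" by (rule P)
  show "j \<in> {1..r} \<Longrightarrow> R *v vt (Suc j) (Suc j) = (u * inverse q) *s (vt (Suc j) (Suc j) - vt j j)
       + (inverse q * inverse q) *s (R *v vt j j)"
    using rec P by auto
qed

lemma dual_braiding:
  "i \<in> {1..r+1} \<Longrightarrow> j \<in> {1..r+1} \<Longrightarrow> i \<noteq> j \<Longrightarrow> R *v vt i j = u *s vt j i"
  using dual_braiding_aux[of j] by auto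

end

end

context chain
begin
text \<open>All three braidings of a chain and its dual, normalized by the scalar \<open>t\<close>. The sequence \<open>D\<close> is geometric with ratio \<open>q\<^sup>-\<^sup>2\<close>.\<close>

context
  fixes VV VD DD :: "complex^('n \<times> 'n)^('n \<times> 'n)" and t c :: complex and D :: "'n \<Rightarrow> complex"
  assumes VE: "\<forall>i\<in>{1..r}. VV ** Emat (tensor_module X X) i = Emat (tensor_module X X) i ** VV"
    and VF: "\<forall>i\<in>{1..r}. VV ** Fmat (tensor_module X X) i = Fmat (tensor_module X X) i ** VV"
    and V0: "VV *v vt 1 (r + 1) = t *s vt (r + 1) 1"
    and ME: "\<forall>i\<in>{1..r}. VD ** Emat (tensor_module X (dual_module X)) i = Emat (tensor_module (dual_module X) X) i ** VD"
    and MF: "\<forall>i\<in>{1..r}. VD ** Fmat (tensor_module X (dual_module X)) i = Fmat (tensor_module (dual_module X) X) i ** VD"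
    and M0: "VD *v vt 1 1 = (inverse t * inverse q) *s vt 1 1"
    and DE: "\<forall>i\<in>{1..r}. DD ** Emat (tensor_module (dual_module X) (dual_module X)) i = Emat (tensor_module (dual_module X) (dual_module X)) i ** DD"
    and DF: "\<forall>i\<in>{1..r}. DD ** Fmat (tensor_module (dual_module X) (dual_module X)) i = Fmat (tensor_module (dual_module X) (dual_module X)) i ** DD"
    and D0: "DD *v vt (r + 1) 1 = t *s vt 1 (r + 1)"
    and t: "t \<noteq> 0" and c: "c \<noteq> 0"
    and D_nonzero: "\<And>x. D x \<noteq> 0"
    and D_first: "c * D (b 1) = inverse t * inverse q"
    and D_rec: "\<And>k. k \<in> {1..r} \<Longrightarrow> D (b (Suc k)) = inverse q * inverse q * D (b k)"
begin

lemmas VV_entry = self_braiding_entry[OF VE VF V0]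
lemmas VV_inv = self_braiding_inv[OF VE VF V0 t]

lemma D0': "DD *v vtensor (axis (b (r + 2 - 1)) 1) (axis (b (r + 2 - (r + 1))) 1)
    = t *s vtensor (axis (b (r + 2 - (r + 1))) 1) (axis (b (r + 2 - 1)) 1)"
proof -
  have "r + 2 - 1 = r + 1" "r + 2 - (r + 1) = 1" by auto
  then show ?thesis using D0 by (simp only:)
qed

lemmas DD_inv = chain.self_braiding_inv[OF dual_chain DE DF D0' t]

lemma DD_entry:
  assumes ijkl: "i \<in> {1..r + 1}" "j \<in> {1..r + 1}" "k \<in> {1..r + 1}" "l \<in> {1..r + 1}"
  shows "DD $ (b k, b l) $ (b i, b j) = t * (if i = j then (if k = i \<and> l = i then q else 0)
    else (if k = j \<and> l = i then 1 else 0) + (if i < j \<and> k = i \<and> l = j then q - inverse q else 0))"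
proof -
  have rev: "\<exists>i'\<in>{1..r + 1}. i = r + 2 - i'" if "i \<in> {1..r + 1}" for i
    using that by (intro bexI[of _ "r + 2 - i"]) auto
  obtain i' where i': "i' \<in> {1..r + 1}" "i = r + 2 - i'" using rev[OF ijkl(1)] by blast
  obtain j' where j': "j' \<in> {1..r + 1}" "j = r + 2 - j'" using rev[OF ijkl(2)] by blast
  obtain k' where k': "k' \<in> {1..r + 1}" "k = r + 2 - k'" using rev[OF ijkl(3)] by blast
  obtain l' where l': "l' \<in> {1..r + 1}" "l = r + 2 - l'" using rev[OF ijkl(4)] by blast
  have eq: "r + 2 - i = r + 2 - j \<longleftrightarrow> i = j" "r + 2 - i < r + 2 - j \<longleftrightarrow> j < i"
    if "i \<in> {1..r + 1}" "j \<in> {1..r + 1}" for i j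
    using that by auto
  have "DD $ (b k, b l) $ (b i, b j) = t * (if i' = j' then (if k' = i' \<and> l' = i' then q else 0)
    else (if k' = j' \<and> l' = i' then 1 else 0) + (if j' < i' \<and> k' = i' \<and> l' = j' then q - inverse q else 0))"
    unfolding i'(2) j'(2) k'(2) l'(2)
    by (rule chain.self_braiding_entry[OF dual_chain DE DF D0' i'(1) j'(1) k'(1) l'(1)])
  then show ?thesis
    unfolding i'(2) j'(2) k'(2) l'(2)
    by (simp only: eq i'(1) j'(1) k'(1) l'(1))
qed

lemma VD_entry:
  assumes "i \<in> {1..r + 1}" "j \<in> {1..r + 1}" "k \<in> {1..r + 1}" "l \<in> {1..r + 1}"
  shows "i \<noteq> j \<Longrightarrow> VD $ (b k, b l) $ (b i, b j) = (if k = j \<and> l = i then inverse t else 0)"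
    and "VD $ (b k, b l) $ (b j, b j) = (if k \<noteq> l then 0 else inverse t *
      (if k = j then inverse q else if k < j then (inverse q - q) * (D (b j) / D (b k)) else 0))"
proof -
  note e = entry_mv[of VD]
  show "VD $ (b k, b l) $ (b i, b j) = (if k = j \<and> l = i then inverse t else 0)" if "i \<noteq> j"
  proof -
    have "VD *v vt i j = inverse t *s vt j i" by (rule dual_braiding[OF ME MF M0 assms(1,2) that])
    then show ?thesis unfolding e using assms by (simp add: vt_entry)
  qed
  have "1 \<le> j \<Longrightarrow> j \<le> r + 1 \<Longrightarrow> (VD *v vt j j) $ (b k, b l) = (if k \<noteq> l then 0 else inverse t *
      (if k = j then inverse q else if k < j then (inverse q - q) * (D (b j) / D (b k)) else 0))" for j
  proof (induction j rule: nat_induct_at_least)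
    case base
    have "vt 1 1 $ (b k, b l) = (if k = 1 \<and> l = 1 then 1 else 0)"
      using assms by (intro vt_entry) auto
    then show ?case unfolding M0 using assms by auto
  next
    case (Suc j)
    then have j: "j \<in> {1..r}" "j \<in> {1..r + 1}" "Suc j \<in> {1..r + 1}" by auto
    have IH: "(VD *v vt j j) $ (b k, b l) = (if k \<noteq> l then 0 else inverse t *
      (if k = j then inverse q else if k < j then (inverse q - q) * (D (b j) / D (b k)) else 0))"
      using Suc by simp
    have ax: "vt m m $ (b k, b l) = (if k = m \<and> l = m then 1 else 0)" if "m \<in> {1..r + 1}" for m
      using assms that by (simp add: vt_entry)
    show ?case
      unfolding dual_braiding_rec[OF ME MF M0 j(1)]
      using j D_nonzero[of "b j"] q0 t by (simp add: IH ax D_rec) (auto simp: field_simps)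
  qed
  then show "VD $ (b k, b l) $ (b j, b j) = (if k \<noteq> l then 0 else inverse t *
      (if k = j then inverse q else if k < j then (inverse q - q) * (D (b j) / D (b k)) else 0))"
    using assms unfolding e by simp
qed

text \<open>The inverse of the braiding of \<open>V\<close> with \<open>V\<^sup>*\<close> is the braiding of \<open>V\<close> with itself, with one strand bent around. Off the zero weight
  space both are transpositions up to scalars; on the diagonal vectors both satisfy recursions that match.\<close>

lemma VD_inv:
  "VD ** matrix_inv VD = mat 1" "matrix_inv VD ** VD = mat 1"
  "matrix_inv VD $ (i, e) $ (x, y) = VV $ (x, i) $ (y, e)"
proof -
  define N where "N = (\<chi> z w. VV $ (fst w, fst z) $ (snd w, snd z))"
  have entry: "(N *v vt k l) $ (b m, b n) = t * (if l = n then (if k = l \<and> m = l then q else 0)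
    else (if k = n \<and> m = l then 1 else 0) + (if n < l \<and> k = l \<and> m = n then q - inverse q else 0))"
    if "k \<in> {1..r + 1}" "l \<in> {1..r + 1}" "m \<in> {1..r + 1}" "n \<in> {1..r + 1}" for k l m n
    using that by (simp add: entry_mv[symmetric] N_def VV_entry)
  have ext: "x = y" if "\<And>m n. m \<in> {1..r + 1} \<Longrightarrow> n \<in> {1..r + 1} \<Longrightarrow> x $ (b m, b n) = y $ (b m, b n)"
    for x y :: "complex^('n \<times> 'n)"
  proof (unfold vec_eq_iff, rule)
    fix z
    obtain m n where "m \<in> {1..r + 1}" "n \<in> {1..r + 1}" "z = (b m, b n)" by (rule b_onto2)
    then show "x $ z = y $ z" using that by simp
  qed
  have off: "N *v vt k l = t *s vt l k" if "k \<in> {1..r + 1}" "l \<in> {1..r + 1}" "k \<noteq> l" for k l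
    by (rule ext) (use that in \<open>simp add: entry vt_entry\<close>)
  have first: "N *v vt 1 1 = (t * q) *s vt 1 1"
    by (rule ext) (use r1 in \<open>auto simp: entry vt_entry\<close>)
  have rec: "N *v vt (Suc j) (Suc j) = N *v vt j j + t *s (q *s vt (Suc j) (Suc j) - inverse q *s vt j j)"
    if "j \<in> {1..r}" for j
    by (rule ext) (use that in \<open>auto simp: entry vt_entry algebra_simps\<close>)
  have diag: "1 \<le> j \<Longrightarrow> j \<le> r + 1 \<Longrightarrow> N *v (VD *v vt j j) = vt j j" for j
  proof (induction j rule: nat_induct_at_least)
    case base
    have "inverse t * inverse q * (t * q) = 1" using t q0 by (simp add: field_simps)
    then show ?case unfolding M0 mv_linear first by (simp only: smult_simps)
  next
    case (Suc j)
    then have j: "j \<in> {1..r}" by auto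
    have "N *v (VD *v vt (Suc j) (Suc j)) = (inverse t * inverse q) *s (N *v vt (Suc j) (Suc j) - N *v vt j j)
        + (inverse q * inverse q) *s vt j j"
      using Suc by (simp add: dual_braiding_rec[OF ME MF M0 j] mv_linear)
    also have "\<dots> = vt (Suc j) (Suc j)"
      unfolding rec[OF j] using t q0 by (simp add: vec_eq_iff field_simps)
    finally show ?case .
  qed
  have "N ** VD = mat 1"
  proof (rule matrix_eq_axis)
    fix z :: "'n \<times> 'n"
    obtain i j where z: "i \<in> {1..r + 1}" "j \<in> {1..r + 1}" "z = (b i, b j)"
      by (rule b_onto2)
    have "N *v (VD *v vt i j) = vt i j"
      using z diag[of i] t by (cases "i = j") (simp_all add: dual_braiding[OF ME MF M0] mv_linear off smult_simps)
    then show "N ** VD *v axis z 1 = mat 1 *v axis z 1"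
      by (simp add: matrix_vector_mul_assoc[symmetric] z vtensor_axis)
  qed
  from invertible_inv[OF this] this
  show "VD ** matrix_inv VD = mat 1" "matrix_inv VD ** VD = mat 1"
    "matrix_inv VD $ (i, e) $ (x, y) = VV $ (x, i) $ (y, e)"
    by (simp_all add: N_def)
qed

text \<open>The functional \<open>E\<close> takes the same value on both new diagonal terms of the recursion, so that only the factor \<open>q\<^sup>-\<^sup>2\<close> is left.\<close>

lemma VD_twist: "(\<Sum>a\<in>UNIV. VD $ (a, a) $ (x, y)) = (if x = y then c * D x else 0)"
proof -
  define ev where "ev v = (\<Sum>a\<in>UNIV. v $ (a, a))" for v :: "complex^('n \<times> 'n)"
  have ev: "ev (a *s v) = a * ev v" "ev (v + w) = ev v + ev w" "ev (v - w) = ev v - ev w" for a v w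
    by (simp_all add: ev_def sum_distrib_left sum.distrib sum_subtractf)
  have vt: "ev (vt k l) = (if k = l then 1 else 0)" if "k \<in> {1..r + 1}" "l \<in> {1..r + 1}" for k l
  proof -
    have "ev (vt k l) = (\<Sum>a\<in>UNIV. if a = b k then (if b l = a then 1 else 0) else 0)"
      unfolding ev_def vtensor_axis by (intro sum.cong refl) (auto simp: axis_def)
    then show ?thesis using that by (auto simp: b_eq)
  qed
  obtain i j where "i \<in> {1..r + 1}" "j \<in> {1..r + 1}" "(x, y) = (b i, b j)"
    by (rule b_onto2)
  then have z: "i \<in> {1..r + 1}" "j \<in> {1..r + 1}" "x = b i" "y = b j" by auto
  have diag: "1 \<le> j \<Longrightarrow> j \<le> r + 1 \<Longrightarrow> ev (VD *v vt j j) = c * D (b j)" for j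
  proof (induction j rule: nat_induct_at_least)
    case base
    have "ev (vt 1 1) = 1" using vt[of 1 1] by simp
    then show ?case unfolding M0 ev D_first by simp
  next
    case (Suc j)
    then have j: "j \<in> {1..r}" by auto
    then show ?case using Suc by (simp add: dual_braiding_rec[OF ME MF M0 j] ev vt D_rec)
  qed
  have "(\<Sum>a\<in>UNIV. VD $ (a, a) $ (x, y)) = ev (VD *v vt i j)"
    by (simp add: ev_def entry_mv z)
  also have "\<dots> = (if x = y then c * D x else 0)"
    using z diag[of i] by (auto simp: dual_braiding[OF ME MF M0] ev vt b_eq)
  finally show ?thesis .
qed

lemma explicit_leg_data:
  "leg_data VV VD DD (matrix_inv VV) (matrix_inv VD) (matrix_inv DD) D c
     (t * t) (t * (q - inverse q)) (inverse (t * t)) (- inverse t * (q - inverse q))"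
proof
  fix i k x y
  obtain i' where i: "i' \<in> {1..r + 1}" "i = b i'" by (rule b_onto)
  obtain k' where k: "k' \<in> {1..r + 1}" "k = b k'" by (rule b_onto)
  obtain x' where x: "x' \<in> {1..r + 1}" "x = b x'" by (rule b_onto)
  obtain y' where y: "y' \<in> {1..r + 1}" "y = b y'" by (rule b_onto)
  have m: "(mat 1 :: complex^('n \<times> 'n)^('n \<times> 'n)) $ (b l, b n) $ (b l', b n') = (if l = l' \<and> n = n' then 1 else 0)"
    if "l \<in> {1..r + 1}" "n \<in> {1..r + 1}" "l' \<in> {1..r + 1}" "n' \<in> {1..r + 1}" for l n l' n'
    using that by (simp add: mat_def b_eq)
  have aux: "inverse (t * t) * (t * z) + - inverse t * d * n = inverse t * (z - d * n)" for z d n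
    using t by (simp add: field_simps)
  have VVi: "matrix_inv VV $ (b l, b n) $ (b l', b n') = inverse t * (if l' = n' then (if l = l' \<and> n = l' then inverse q else 0)
    else (if l = n' \<and> n = l' then 1 else 0) + (if l' < n' \<and> l = l' \<and> n = n' then inverse q - q else 0))"
    if "l \<in> {1..r + 1}" "n \<in> {1..r + 1}" "l' \<in> {1..r + 1}" "n' \<in> {1..r + 1}" for l n l' n'
    unfolding VV_inv(3) VV_entry[OF that(3,4,1,2)] m[OF that] aux by (auto simp: algebra_simps)
  have DDi: "matrix_inv DD $ (b l, b n) $ (b l', b n') = inverse t * (if l' = n' then (if l = l' \<and> n = l' then inverse q else 0)
    else (if l = n' \<and> n = l' then 1 else 0) + (if n' < l' \<and> l = l' \<and> n = n' then inverse q - q else 0))"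
    if "l \<in> {1..r + 1}" "n \<in> {1..r + 1}" "l' \<in> {1..r + 1}" "n' \<in> {1..r + 1}" for l n l' n'
    unfolding DD_inv(3) DD_entry[OF that(3,4,1,2)] m[OF that] aux by (auto simp: algebra_simps)
  have VD: "VD $ (b l, b n) $ (b l', b n') = inverse t * (if l' = n' then (if l \<noteq> n then 0
      else if l = l' then inverse q else if l < l' then (inverse q - q) * (D (b l') / D (b l)) else 0)
    else (if l = n' \<and> n = l' then 1 else 0))"
    if "l \<in> {1..r + 1}" "n \<in> {1..r + 1}" "l' \<in> {1..r + 1}" "n' \<in> {1..r + 1}" for l n l' n'
  proof (cases "l' = n'")
    case True
    then show ?thesis using VD_entry(2)[OF that(3,3,1,2)] by simp
  next
    case False
    then show ?thesis using VD_entry(1)[OF that(3,4,1,2) False] by simp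
  qed
  note in_range = i(1) k(1) x(1) y(1)
  show "D k * matrix_inv VV $ (i, k) $ (x, y) = D x * VD $ (x, i) $ (y, k)"
    unfolding i(2) k(2) x(2) y(2) VVi[OF i(1) k(1) x(1) y(1)] VD[OF x(1) i(1) y(1) k(1)]
    using D_nonzero by (auto simp: b_eq[OF x(1) k(1)] field_simps)
  show "D k * matrix_inv DD $ (k, i) $ (y, x) = D x * VD $ (i, x) $ (k, y)"
    unfolding i(2) k(2) x(2) y(2) DDi[OF k(1) i(1) y(1) x(1)] VD[OF i(1) x(1) k(1) y(1)]
    using D_nonzero by (auto simp: b_eq[OF x(1) k(1)] field_simps)
  show "matrix_inv VD $ (k, i) $ (y, x) = DD $ (i, x) $ (k, y)"
    unfolding VD_inv(3)
    unfolding i(2) k(2) x(2) y(2) VV_entry[OF x(1) i(1) y(1) k(1)] DD_entry[OF k(1) y(1) i(1) x(1)]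
    by auto
next
  fix x y
  show "VV $ x $ y = t * t * matrix_inv VV $ x $ y + t * (q - inverse q) * mat 1 $ x $ y"
    unfolding VV_inv(3) using t by (simp add: field_simps)
  show "matrix_inv DD $ x $ y = inverse (t * t) * DD $ x $ y + - inverse t * (q - inverse q) * mat 1 $ x $ y"
    by (rule DD_inv(3))
qed (use VV_inv DD_inv VD_inv VD_twist D_nonzero c in auto)

end

end

section \<open>Weights\<close>

text \<open>The \<open>i\<close>-th simple root paired with the \<open>k\<close>-th weight of the vector representation.\<close>

definition eps :: "nat \<Rightarrow> nat \<Rightarrow> real" where
  "eps i k = (if k = i then 1 else if k = i + 1 then - 1 else 0)"

lemma wform_sroot:
  assumes "i \<in> {1..r}"
  shows "wform r (sroot i) \<mu> = \<mu> i - \<mu> (i + 1)"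
proof -
  have "wform r (sroot i) \<mu> = (\<Sum>k = 1..r + 1. (if k = i then \<mu> k else 0) - (if k = i + 1 then \<mu> k else 0))"
    unfolding wform_def sroot_def by (intro sum.cong refl) auto
  also have "\<dots> = \<mu> i - \<mu> (i + 1)"
    unfolding sum_subtractf using assms by (simp add: sum.delta)
  finally show ?thesis .
qed

lemma wform_sroot_fund:
  assumes "i \<in> {1..r}"
  shows "wform r (sroot i) (fund_weight r s) = (if i = s then 1 else 0)"
  unfolding wform_sroot[OF assms] by (auto simp: fund_weight_def)

lemma sum_indicator: "finite S \<Longrightarrow> (\<Sum>k\<in>S. if Q k then 1 else 0 :: real) = real (card {k \<in> S. Q k})"
  by (simp flip: sum.inter_filter)

lemma sum_le_indicator: "i \<le> n \<Longrightarrow> (\<Sum>k = 1..n. if k \<le> i then 1 else 0 :: real) = real i"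
proof -
  assume "i \<le> n"
  then have "{k \<in> {1..n}. k \<le> i} = {1..i}" by auto
  then show ?thesis by (simp flip: sum.inter_filter)
qed

lemma is_weight_fund: "s \<in> {1..r} \<Longrightarrow> is_weight r (fund_weight r s)"
  using sum_le_indicator[of s "r + 1"] wform_sroot_fund
  by (simp add: is_weight_def fund_weight_def sum_subtractf wform_sroot_fund[unfolded fund_weight_def])

lemma wform_fund_longest:
  assumes "i \<in> {1..r}" "j \<in> {1..r}"
  shows "wform r (fund_weight r i) (longest r (fund_weight r j)) = real (i + j - (r + 1)) - real i * real j / real (r + 1)"
proof -
  let ?x = "\<lambda>k. if k \<le> i then 1 else 0 :: real" and ?y = "\<lambda>k. if r + 2 - k \<le> j then 1 else 0 :: real"
  let ?a = "real i / real (r + 1)" and ?b = "real j / real (r + 1)"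
  have y: "(\<Sum>k = 1..r + 1. ?y k) = real j"
  proof -
    have "{k \<in> {1..r + 1}. r + 2 - k \<le> j} = {r + 2 - j..r + 1}" using assms by auto
    moreover have "card {r + 2 - j..r + 1} = j" using assms by auto
    ultimately show ?thesis by (simp only: sum_indicator finite_atLeastAtMost)
  qed
  have xy: "(\<Sum>k = 1..r + 1. ?x k * ?y k) = real (i + j - (r + 1))"
  proof -
    have "(\<Sum>k = 1..r + 1. ?x k * ?y k) = (\<Sum>k = 1..r + 1. if k \<le> i \<and> r + 2 - k \<le> j then 1 else 0)"
      by (intro sum.cong refl) auto
    also have "\<dots> = real (card {k \<in> {1..r + 1}. k \<le> i \<and> r + 2 - k \<le> j})"
      by (simp only: sum_indicator finite_atLeastAtMost)
    also have "{k \<in> {1..r + 1}. k \<le> i \<and> r + 2 - k \<le> j} = {r + 2 - j..i}" using assms by auto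
    also have "card {r + 2 - j..i} = i + j - (r + 1)" using assms by auto
    finally show ?thesis .
  qed
  have "wform r (fund_weight r i) (longest r (fund_weight r j))
      = (\<Sum>k = 1..r + 1. ?x k * ?y k - ?b * ?x k - ?a * ?y k + ?a * ?b)"
    unfolding wform_def fund_weight_def longest_def by (intro sum.cong refl) (simp only: algebra_simps)
  also have "\<dots> = (\<Sum>k = 1..r + 1. ?x k * ?y k) - ?b * (\<Sum>k = 1..r + 1. ?x k) - ?a * (\<Sum>k = 1..r + 1. ?y k)
      + real (r + 1) * (?a * ?b)"
    by (simp only: sum.distrib sum_subtractf sum_distrib_left[symmetric]) simp
  also have "\<dots> = real (i + j - (r + 1)) - real i * real j / real (r + 1)"
  proof -
    have x: "(\<Sum>k = 1..r + 1. ?x k) = real i" using assms by (intro sum_le_indicator) auto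
    have "z - j / n * i - i / n * j + n * (i / n * (j / n)) = z - i * j / n" if "n \<noteq> 0" for n z i j :: real
      using that by (simp add: field_simps)
    then show ?thesis unfolding xy y x by (simp del: of_nat_add of_nat_Suc)
  qed
  finally show ?thesis .
qed

lemma wform_fund_fund:
  assumes "s \<in> {1..r}"
  shows "wform r (fund_weight r s) (fund_weight r s) = real s - real s * real s / real (r + 1)"
proof -
  let ?x = "\<lambda>k. if k \<le> s then 1 else 0 :: real" and ?a = "real s / real (r + 1)"
  have x: "(\<Sum>k = 1..r + 1. ?x k) = real s" using assms by (intro sum_le_indicator) auto
  have "wform r (fund_weight r s) (fund_weight r s) = (\<Sum>k = 1..r + 1. (1 - 2 * ?a) * ?x k + ?a * ?a)"
    unfolding wform_def fund_weight_def by (intro sum.cong refl) (auto simp: algebra_simps)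
  also have "\<dots> = (1 - 2 * ?a) * real s + real (r + 1) * (?a * ?a)"
    by (simp only: sum.distrib sum_distrib_left[symmetric] x) simp
  also have "\<dots> = real s - real s * real s / real (r + 1)"
  proof -
    have "n * (s / n * (s / n)) = s * s / n" "(1 - 2 * (s / n)) * s = s - 2 * (s * s / n)" if "n \<noteq> 0" for n s :: real
      using that by (simp_all add: field_simps)
    then show ?thesis by simp
  qed
  finally show ?thesis .
qed

lemma two_rho_eq:
  assumes "k \<in> {1..r + 1}"
  shows "two_rho r k = real r + 2 - 2 * real k"
proof -
  have "(\<Sum>i = 1..r. if k \<le> i then 1 else 0 :: real) = real (r + 1) - real k"
  proof -
    have "{i \<in> {1..r}. k \<le> i} = {k..r}" using assms by auto
    moreover have "real (card {k..r}) = real (r + 1) - real k" using assms by (auto simp: of_nat_diff)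
    ultimately show ?thesis by (simp only: sum_indicator finite_atLeastAtMost)
  qed
  moreover have "(\<Sum>i = 1..r. real i / real (r + 1)) = real r / 2"
  proof -
    have "(\<Sum>i = 1..r. real i) = real r * (real r + 1) / 2" by (induction r) (auto simp: field_simps)
    then show ?thesis by (simp add: sum_divide_distrib[symmetric] field_simps)
  qed
  ultimately show ?thesis
    by (simp add: two_rho_def rho_def fund_weight_def sum_subtractf)
qed

text \<open>This expresses \<open>2\<rho>\<close> as the sum of the \<open>i (r + 1 - i) \<alpha>\<^sub>i\<close>, so that \<open>(\<mu>,2\<rho>)\<close> is known from the pairings of \<open>\<mu>\<close> with the
  simple roots alone; the proof is summation by parts.\<close>

lemma wform_two_rho: "wform r \<mu> (two_rho r) = (\<Sum>i = 1..r. real i * (real (r + 1) - real i) * wform r (sroot i) \<mu>)"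
proof -
  have "1 \<le> n \<Longrightarrow> (\<Sum>k = 1..n. (real r + 2 - 2 * real k) * \<mu> k)
      = (\<Sum>i = 1..<n. real i * (real (r + 1) - real i) * (\<mu> i - \<mu> (i + 1))) + real n * (real (r + 1) - real n) * \<mu> n" for n
    by (induction n rule: nat_induct_at_least) (simp_all add: algebra_simps)
  from this[of "r + 1"] have "(\<Sum>k = 1..r + 1. (real r + 2 - 2 * real k) * \<mu> k)
      = (\<Sum>i = 1..<r + 1. real i * (real (r + 1) - real i) * (\<mu> i - \<mu> (i + 1)))" by simp
  moreover have "wform r \<mu> (two_rho r) = (\<Sum>k = 1..r + 1. (real r + 2 - 2 * real k) * \<mu> k)"
    unfolding wform_def by (intro sum.cong refl) (simp add: two_rho_eq mult.commute)
  moreover have "(\<Sum>i = 1..<r + 1. real i * (real (r + 1) - real i) * (\<mu> i - \<mu> (i + 1)))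
      = (\<Sum>i = 1..r. real i * (real (r + 1) - real i) * wform r (sroot i) \<mu>)"
    by (intro sum.cong) (auto simp: wform_sroot)
  ultimately show ?thesis by simp
qed

lemma sum_eps:
  assumes "k \<in> {1..r + 1}"
  shows "(\<Sum>i = 1..r. real i * (real (r + 1) - real i) * eps i k) = real r + 2 - 2 * real k"
proof -
  let ?f = "\<lambda>i. real i * (real (r + 1) - real i)"
  have "(\<Sum>i = 1..r. ?f i * eps i k) = (\<Sum>i = 1..r. (if i = k then ?f k else 0) - (if i = k - 1 then ?f (k - 1) else 0))"
    using assms by (intro sum.cong refl) (auto simp: eps_def)
  also have "\<dots> = ?f k - ?f (k - 1)"
  proof -
    have "(\<Sum>i = 1..r. if i = k then ?f k else 0) = ?f k"
      using assms by (cases "k \<le> r") (auto simp: sum.delta not_le le_Suc_eq)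
    moreover have "(\<Sum>i = 1..r. if i = k - 1 then ?f (k - 1) else 0) = ?f (k - 1)"
      using assms by (cases "k = 1") (auto simp: sum.delta)
    ultimately show ?thesis by (simp only: sum_subtractf)
  qed
  also have "\<dots> = real r + 2 - 2 * real k"
    using assms by (simp add: of_nat_diff algebra_simps)
  finally show ?thesis .
qed

text \<open>If two weights of the vector representation differ by the simple root \<open>\<alpha>\<^sub>i\<close>, they are the \<open>i\<close>-th and the next one. The function \<open>f\<close>
  lists the coordinates of the difference that should vanish: they are all equal by hypothesis and their sum is zero.\<close>

lemma eps_step:
  assumes l: "l \<in> {1..r + 1}" and k: "k \<in> {1..r + 1}" and i: "i \<in> {1..r}"
    and eq: "\<And>m. m \<in> {1..r} \<Longrightarrow> eps m l = eps m i - eps m (i + 1) + eps m k"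
  shows "k = i + 1 \<and> l = i"
proof -
  define f where "f t = (if l = t then 1 else 0) - (if k = t then 1 else 0) - (if i = t then 1 else 0)
    + (if i + 1 = t then 1 else 0 :: real)" for t
  have step: "f m = f (m + 1)" if "m \<in> {1..r}" for m
    using eq[OF that] by (auto simp: f_def eps_def split: if_splits)
  have const: "1 \<le> m \<Longrightarrow> m \<le> r + 1 \<Longrightarrow> f m = f 1" for m
  proof (induction m rule: nat_induct_at_least)
    case (Suc m)
    then have "f m = f 1" by simp
    moreover have "f m = f (m + 1)" using Suc by (intro step) auto
    ultimately show ?case by simp
  qed simp
  have "(\<Sum>m = 1..r + 1. f m) = 0"
  proof -
    have "(\<Sum>m = 1..r + 1. if x = m then 1 else 0 :: real) = 1" if "x \<in> {1..r + 1}" for x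
      using that by (simp add: sum.delta')
    then show ?thesis using l k i by (simp only: f_def sum.distrib sum_subtractf) simp
  qed
  moreover have "(\<Sum>m = 1..r + 1. f m) = (\<Sum>m = 1..r + 1. f 1)"
  proof (rule sum.cong[OF refl])
    fix m assume "m \<in> {1..r + 1}"
    then show "f m = f 1" by (intro const) auto
  qed
  ultimately have "f 1 = 0" by simp
  then have "f i = 0" "f (i + 1) = 0" using const[of i] const[of "i + 1"] i by auto
  then show ?thesis by (auto simp: f_def split: if_splits)
qed

lemma eps_inj:
  assumes "k \<in> {1..r + 1}" "l \<in> {1..r + 1}" and eq: "\<And>m. m \<in> {1..r} \<Longrightarrow> eps m k = eps m l"
  shows "k = l"
proof (rule ccontr)
  have *: False if "k < l" "k \<in> {1..r + 1}" "l \<in> {1..r + 1}" "\<And>m. m \<in> {1..r} \<Longrightarrow> eps m k = eps m l" for k l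
    using that(4)[of k] that(1-3) by (auto simp: eps_def split: if_splits)
  assume "k \<noteq> l"
  then show False using *[of k l] *[of l k] assms by force
qed

section \<open>The vector representation from its highest weight\<close>

lemma scaleR_mv: "(a *\<^sub>R M) *v x = complex_of_real a *s (M *v x)"
  by (simp add: vec_eq_iff matrix_vector_mult_def sum_distrib_left mult.assoc
      scaleR_conv_of_real[where 'a = complex])

lemma scaleR_vec: "a *\<^sub>R x = complex_of_real a *s (x :: complex^'n)"
  by (simp add: vec_eq_iff scaleR_conv_of_real[where 'a = complex])

definition qweight :: "'n::finite quantum_data \<Rightarrow> 'n \<Rightarrow> complex" where
  "qweight Q i = qpow Q (wform (rnk Q) (wt Q i) (two_rho (rnk Q)))"

locale quantum =
  fixes Q :: "'n::finite quantum_data"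
  assumes Q: "is_quantum_data Q"
begin

abbreviation "q \<equiv> qpar Q"
abbreviation "r \<equiv> rnk Q"
abbreviation "X \<equiv> Vmod Q"

lemma q: "0 < q" "q < 1" and r: "1 \<le> r" and card: "CARD('n) = r + 1" and node: "node Q \<in> {1, r}"
  and uq: "is_uq_module q r X" and wt: "has_weight q r X (wt Q i) (axis i 1)"
  using Q by (simp_all add: is_quantum_data_def)

lemma powr_eq: "q powr x = q powr y \<longleftrightarrow> x = y"
  using q by (simp add: powr_inj)

text \<open>For the last node the highest weight vector is lowered by \<open>F\<^sub>r\<close> first, then by \<open>F\<^sub>r\<^sub>-\<^sub>1\<close>, and so on. Numbering the generators in this
  order makes both cases look alike.\<close>

definition \<tau> :: "nat \<Rightarrow> nat" where
  "\<tau> i = (if node Q = 1 then i else r + 1 - i)"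

lemma \<tau>_mem: "i \<in> {1..r} \<Longrightarrow> \<tau> i \<in> {1..r}"
  and \<tau>_involutive: "i \<in> {1..r} \<Longrightarrow> \<tau> (\<tau> i) = i"
  by (auto simp: \<tau>_def)

lemma \<tau>_eq: "i \<in> {1..r} \<Longrightarrow> j \<in> {1..r} \<Longrightarrow> \<tau> i = \<tau> j \<longleftrightarrow> i = j"
  by (metis \<tau>_involutive)

lemma \<tau>_onto: "\<tau> ` {1..r} = {1..r}"
proof
  show "\<tau> ` {1..r} \<subseteq> {1..r}" using \<tau>_mem by blast
  show "{1..r} \<subseteq> \<tau> ` {1..r}"
  proof
    fix i assume i: "i \<in> {1..r}"
    show "i \<in> \<tau> ` {1..r}" by (rule image_eqI[of _ _ "\<tau> i"]) (simp_all only: \<tau>_mem[OF i] \<tau>_involutive[OF i])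
  qed
qed

lemma \<tau>_bij: "bij_betw \<tau> {1..r} {1..r}"
  unfolding bij_betw_def inj_on_def using \<tau>_onto \<tau>_eq by blast

lemma \<tau>_1: "\<tau> 1 = node Q"
  using node r by (auto simp: \<tau>_def)

lemma cartan:
  assumes "i \<in> {1..r}" "j \<in> {1..r}"
  shows "wform r (sroot (\<tau> i)) (sroot (\<tau> j)) = eps i j - eps i (j + 1)"
proof (cases "node Q = 1")
  case True
  then show ?thesis
    unfolding wform_sroot[OF \<tau>_mem[OF assms(1)]] by (simp add: \<tau>_def sroot_def eps_def)
next
  case False
  have "r + 1 - i = r + 1 - j \<longleftrightarrow> j = i" "r + 1 - i = r + 1 - j + 1 \<longleftrightarrow> j = i + 1"
    "r + 1 - i + 1 = r + 1 - j \<longleftrightarrow> j + 1 = i" "r + 1 - i + 1 = r + 1 - j + 1 \<longleftrightarrow> j = i"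
    using assms by auto
  then show ?thesis
    unfolding wform_sroot[OF \<tau>_mem[OF assms(1)]] using False by (simp only: \<tau>_def sroot_def eps_def) simp
qed

definition \<kappa> :: "nat \<Rightarrow> 'n \<Rightarrow> real" where
  "\<kappa> i a = wform r (sroot (\<tau> i)) (wt Q a)"

lemma K_axis:
  assumes "i \<in> {1..r}"
  shows "Kmat X (\<tau> i) *v axis a 1 = complex_of_real (q powr \<kappa> i a) *s axis a 1"
  using wt[of a] \<tau>_mem[OF assms] by (simp add: has_weight_def scaleR_vec \<kappa>_def)

lemma K_entry:
  assumes "i \<in> {1..r}"
  shows "Kmat X (\<tau> i) $ x $ a = (if x = a then complex_of_real (q powr \<kappa> i a) else 0)"
  using arg_cong[OF K_axis[OF assms, of a], of "\<lambda>v. v $ x"] unfolding mv_axis by (simp add: axis_def)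

lemma K_mult:
  assumes i: "i \<in> {1..r}"
  shows "(Kmat X (\<tau> i) ** M) $ a $ c = complex_of_real (q powr \<kappa> i a) * M $ a $ c"
    and "(M ** Kmat X (\<tau> i)) $ a $ c = M $ a $ c * complex_of_real (q powr \<kappa> i c)"
    and "(Kmat X (\<tau> i) *v v) $ a = complex_of_real (q powr \<kappa> i a) * v $ a"
proof -
  have "(\<Sum>k\<in>UNIV. (if a = k then complex_of_real (q powr \<kappa> i k) else 0) * f k) = complex_of_real (q powr \<kappa> i a) * f a" for f
    by (simp add: if_distrib[of "\<lambda>x. x * _"] cong: if_cong)
  then show "(Kmat X (\<tau> i) ** M) $ a $ c = complex_of_real (q powr \<kappa> i a) * M $ a $ c"
    "(Kmat X (\<tau> i) *v v) $ a = complex_of_real (q powr \<kappa> i a) * v $ a"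
    by (simp_all add: matrix_matrix_mult_def matrix_vector_mult_def K_entry[OF i])
  have "(\<Sum>k\<in>UNIV. f k * (if k = c then complex_of_real (q powr \<kappa> i c) else 0)) = f c * complex_of_real (q powr \<kappa> i c)" for f
    by (simp add: if_distrib[of "\<lambda>x. _ * x"] cong: if_cong)
  then show "(M ** Kmat X (\<tau> i)) $ a $ c = M $ a $ c * complex_of_real (q powr \<kappa> i c)"
    by (simp add: matrix_matrix_mult_def K_entry[OF i])
qed

lemma Kinv:
  assumes "i \<in> {1..r}"
  shows "matrix_inv (Kmat X (\<tau> i)) ** Kmat X (\<tau> i) = mat 1"
proof -
  have "invertible (Kmat X (\<tau> i))" using uq \<tau>_mem[OF assms] by (simp add: is_uq_module_def)
  then show ?thesis unfolding invertible_def matrix_inv_def by (metis (mono_tags, lifting) someI_ex)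
qed

text \<open>The matrices of \<open>E\<close> and \<open>F\<close> have entries only between weights that differ by a root.\<close>

lemma graded:
  assumes i: "i \<in> {1..r}" and j: "j \<in> {1..r}"
  shows "Emat X (\<tau> j) $ a $ c \<noteq> 0 \<Longrightarrow> \<kappa> i a = eps i j - eps i (j + 1) + \<kappa> i c"
    and "Fmat X (\<tau> j) $ a $ c \<noteq> 0 \<Longrightarrow> \<kappa> i c = eps i j - eps i (j + 1) + \<kappa> i a"
proof -
  have aux: "Kmat X (\<tau> i) ** M = (x *\<^sub>R M) ** Kmat X (\<tau> i)"
    if "Kmat X (\<tau> i) ** M ** matrix_inv (Kmat X (\<tau> i)) = x *\<^sub>R M" for M x
    using arg_cong[OF that, of "\<lambda>N. N ** Kmat X (\<tau> i)"]
    by (simp add: matrix_mul_assoc[symmetric] Kinv[OF i])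
  have KE: "Kmat X (\<tau> i) ** Emat X (\<tau> j) = ((q powr (eps i j - eps i (j + 1))) *\<^sub>R Emat X (\<tau> j)) ** Kmat X (\<tau> i)"
    by (rule aux) (use uq \<tau>_mem[OF i] \<tau>_mem[OF j] cartan[OF i j] in \<open>simp add: is_uq_module_def\<close>)
  have KF: "Kmat X (\<tau> i) ** Fmat X (\<tau> j) = ((q powr (- (eps i j - eps i (j + 1)))) *\<^sub>R Fmat X (\<tau> j)) ** Kmat X (\<tau> i)"
    by (rule aux) (use uq \<tau>_mem[OF i] \<tau>_mem[OF j] cartan[OF i j] in \<open>simp add: is_uq_module_def\<close>)
  have *: "x = y + z" if "complex_of_real (q powr x) * e = (q powr y) *\<^sub>R e * complex_of_real (q powr z)" "e \<noteq> 0" for x y z e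
  proof -
    have "complex_of_real (q powr x) = complex_of_real (q powr y * q powr z)"
      using that by (simp add: scaleR_conv_of_real)
    then have "q powr x = q powr (y + z)" by (simp only: of_real_eq_iff powr_add)
    then show ?thesis by (simp add: powr_eq)
  qed
  show "Emat X (\<tau> j) $ a $ c \<noteq> 0 \<Longrightarrow> \<kappa> i a = eps i j - eps i (j + 1) + \<kappa> i c"
    using arg_cong[OF KE, of "\<lambda>M. M $ a $ c"] unfolding K_mult[OF i] by (intro *) simp_all
  have "Fmat X (\<tau> j) $ a $ c \<noteq> 0 \<Longrightarrow> \<kappa> i a = - (eps i j - eps i (j + 1)) + \<kappa> i c"
    using arg_cong[OF KF, of "\<lambda>M. M $ a $ c"] unfolding K_mult[OF i] by (intro *) simp_all
  then show "Fmat X (\<tau> j) $ a $ c \<noteq> 0 \<Longrightarrow> \<kappa> i c = eps i j - eps i (j + 1) + \<kappa> i a" by simp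
qed

lemma EF:
  assumes i: "i \<in> {1..r}" and j: "j \<in> {1..r}"
  shows "Emat X (\<tau> i) *v (Fmat X (\<tau> j) *v x) = Fmat X (\<tau> j) *v (Emat X (\<tau> i) *v x)
    + (if i = j then complex_of_real (1 / (q - inverse q)) *s (Kmat X (\<tau> i) *v x - matrix_inv (Kmat X (\<tau> i)) *v x) else 0)"
proof -
  have "Emat X (\<tau> i) ** Fmat X (\<tau> j) - Fmat X (\<tau> j) ** Emat X (\<tau> i)
         = (if i = j then (1 / (q - inverse q)) *\<^sub>R (Kmat X (\<tau> i) - matrix_inv (Kmat X (\<tau> i))) else 0)"
    using uq \<tau>_mem[OF i] \<tau>_mem[OF j] \<tau>_eq[OF i j] by (simp add: is_uq_module_def)
  from arg_cong[OF this, of "\<lambda>M. M *v x"] show ?thesis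
    by (auto simp: matrix_vector_mult_diff_rdistrib matrix_vector_mul_assoc[symmetric] scaleR_mv algebra_simps
        split: if_splits)
qed

text \<open>A vector on which \<open>K\<close> acts by \<open>q\<close> has \<open>[K] = 1\<close>.\<close>

lemma EF_weight:
  assumes i: "i \<in> {1..r}" and K: "Kmat X (\<tau> i) *v x = complex_of_real q *s x"
  shows "Emat X (\<tau> i) *v (Fmat X (\<tau> i) *v x) = Fmat X (\<tau> i) *v (Emat X (\<tau> i) *v x) + x"
proof -
  have "x = matrix_inv (Kmat X (\<tau> i)) *v (Kmat X (\<tau> i) *v x)"
    by (simp add: matrix_vector_mul_assoc Kinv[OF i])
  also have "\<dots> = complex_of_real q *s (matrix_inv (Kmat X (\<tau> i)) *v x)"
    by (simp add: K mv_linear)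
  finally have "complex_of_real (inverse q) *s x = complex_of_real (inverse q * q) *s (matrix_inv (Kmat X (\<tau> i)) *v x)"
    by (metis of_real_mult smult_simps(1))
  then have Ki: "matrix_inv (Kmat X (\<tau> i)) *v x = complex_of_real (inverse q) *s x"
    using q by (simp add: smult_simps)
  have "q - inverse q \<noteq> 0"
    using q by (metis less_irrefl one_less_inverse order.strict_trans right_minus_eq)
  then have "1 / (q - inverse q) * (q - inverse q) = 1" by simp
  then have "complex_of_real (1 / (q - inverse q)) * complex_of_real (q - inverse q) = 1"
    by (simp only: of_real_mult[symmetric] of_real_1)
  then have "complex_of_real (1 / (q - inverse q)) *s (Kmat X (\<tau> i) *v x - matrix_inv (Kmat X (\<tau> i)) *v x) = x"
    unfolding K Ki vector_sub_rdistrib[symmetric] of_real_diff[symmetric] smult_simps(1)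
    by (simp add: smult_simps)
  then show ?thesis using EF[OF i i, of x] by simp
qed

lemma K_support:
  assumes "i \<in> {1..r}" "\<And>a. v $ a \<noteq> 0 \<Longrightarrow> \<kappa> i a = x"
  shows "Kmat X (\<tau> i) *v v = complex_of_real (q powr x) *s v"
  using assms(2) by (auto simp: vec_eq_iff K_mult(3)[OF assms(1)])

text \<open>Apply the lowering operators to the highest weight vector in turn. The commutation of \<open>E\<close> and \<open>F\<close> shows that none of the \<open>r + 1\<close> vectors
  vanishes, and their weights are distinct. Any basis vector occurring in the \<open>j\<close>-th one has its weight; as there are only \<open>r + 1\<close>
  basis vectors, this is a bijection.\<close>

lemma weight_basis:
  obtains b where "bij_betw b {1..r + 1} UNIV" "\<And>i j. i \<in> {1..r} \<Longrightarrow> j \<in> {1..r + 1} \<Longrightarrow> \<kappa> i (b j) = eps i j"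
proof -
  obtain v0 where v0: "highest_vec q r X (fund_weight r (node Q)) v0"
    using Q by (auto simp: is_quantum_data_def)
  define w where "w = rec_nat v0 (\<lambda>k v. Fmat X (\<tau> (Suc k)) *v v)"
  have w: "w 0 = v0" "w (Suc k) = Fmat X (\<tau> (Suc k)) *v w k" for k
    by (simp_all add: w_def)
  have supp: "k \<le> r \<Longrightarrow> \<forall>i\<in>{1..r}. \<forall>a. w k $ a \<noteq> 0 \<longrightarrow> \<kappa> i a = eps i (k + 1)" for k
  proof (induction k)
    case 0
    show ?case
    proof (intro ballI allI impI)
      fix i a assume i: "i \<in> {1..r}" and a: "w 0 $ a \<noteq> 0"
      have "Kmat X (\<tau> i) *v v0 = complex_of_real (q powr wform r (sroot (\<tau> i)) (fund_weight r (node Q))) *s v0"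
        using v0 \<tau>_mem[OF i] by (simp add: highest_vec_def has_weight_def scaleR_vec)
      from arg_cong[OF this, of "\<lambda>v. v $ a"] a
      have "\<kappa> i a = wform r (sroot (\<tau> i)) (fund_weight r (node Q))"
        by (simp add: K_mult(3)[OF i] w powr_eq)
      also have "\<dots> = eps i 1"
        using i r \<tau>_eq[OF i, of 1] \<tau>_1 by (auto simp: wform_sroot_fund[OF \<tau>_mem[OF i]] eps_def)
      finally show "\<kappa> i a = eps i (0 + 1)" by simp
    qed
  next
    case (Suc k)
    show ?case
    proof (intro ballI allI impI)
      fix i a assume i: "i \<in> {1..r}" and a: "w (Suc k) $ a \<noteq> 0"
      then have "(\<Sum>c\<in>UNIV. Fmat X (\<tau> (Suc k)) $ a $ c * w k $ c) \<noteq> 0"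
        by (simp add: w matrix_vector_mult_def)
      then obtain c where "Fmat X (\<tau> (Suc k)) $ a $ c * w k $ c \<noteq> 0"
        by (rule sum.not_neutral_contains_not_neutral)
      then have c: "Fmat X (\<tau> (Suc k)) $ a $ c \<noteq> 0" "w k $ c \<noteq> 0" by auto
      have "\<kappa> i c = eps i (k + 1)" using Suc i c by auto
      moreover have "\<kappa> i c = eps i (Suc k) - eps i (Suc k + 1) + \<kappa> i a"
        using Suc by (intro graded(2)[OF i _ c(1)]) auto
      ultimately show "\<kappa> i a = eps i (Suc k + 1)" by simp
    qed
  qed
  have nz: "k \<le> r \<Longrightarrow> w k \<noteq> 0 \<and> (\<forall>i\<in>{1..r}. k < i \<longrightarrow> Emat X (\<tau> i) *v w k = 0)" for k
  proof (induction k)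
    case 0
    show ?case using v0 \<tau>_mem by (simp add: w highest_vec_def has_weight_def)
  next
    case (Suc k)
    then have k: "Suc k \<in> {1..r}" and IH: "w k \<noteq> 0" "\<And>i. i \<in> {1..r} \<Longrightarrow> k < i \<Longrightarrow> Emat X (\<tau> i) *v w k = 0"
      by auto
    have "Kmat X (\<tau> (Suc k)) *v w k = complex_of_real (q powr 1) *s w k"
      using supp[of k] Suc k by (intro K_support) (auto simp: eps_def)
    then have "Emat X (\<tau> (Suc k)) *v w (Suc k) = w k"
      unfolding w using q EF_weight[OF k, of "w k"] IH(2)[OF k] by (simp add: mv_linear)
    then have "w (Suc k) \<noteq> 0" using IH(1) by (auto simp: mv_linear)
    moreover have "Emat X (\<tau> i) *v w (Suc k) = 0" if i: "i \<in> {1..r}" "Suc k < i" for i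
      unfolding w using EF[OF i(1) k, of "w k"] IH(2)[OF i(1)] i by (simp add: mv_linear)
    ultimately show ?case by blast
  qed
  define b where "b j = (SOME a. w (j - 1) $ a \<noteq> 0)" for j
  have b: "w (j - 1) $ b j \<noteq> 0" if "j \<in> {1..r + 1}" for j
  proof -
    have "j - 1 \<le> r" using that by auto
    then have "w (j - 1) \<noteq> 0" using nz by blast
    then have "\<exists>a. w (j - 1) $ a \<noteq> 0" by (auto simp: vec_eq_iff)
    then show ?thesis unfolding b_def by (rule someI_ex)
  qed
  have \<kappa>: "\<kappa> i (b j) = eps i j" if "i \<in> {1..r}" "j \<in> {1..r + 1}" for i j
  proof -
    have "j - 1 \<le> r" "j - 1 + 1 = j" using that(2) by auto
    then show ?thesis using supp[of "j - 1"] b[OF that(2)] that(1) by metis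
  qed
  have "inj_on b {1..r + 1}"
  proof (rule inj_onI)
    fix k l assume kl: "k \<in> {1..r + 1}" "l \<in> {1..r + 1}" "b k = b l"
    show "k = l"
    proof (rule eps_inj[OF kl(1,2)])
      fix m assume "m \<in> {1..r}"
      then show "eps m k = eps m l" using \<kappa>[of m k] \<kappa>[of m l] kl by simp
    qed
  qed
  then have "bij_betw b {1..r + 1} UNIV"
    using card by (simp add: bij_betw_def card_image card_eq_UNIV_imp_eq_UNIV)
  then show thesis using \<kappa> by (rule that)
qed

lemma chain_exists:
  obtains b \<phi> where "chain (complex_of_real q) r X b \<tau> \<phi>"
    "\<And>i j. i \<in> {1..r} \<Longrightarrow> j \<in> {1..r + 1} \<Longrightarrow> \<kappa> i (b j) = eps i j"
proof -
  obtain b where bij: "bij_betw b {1..r + 1} UNIV"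
    and \<kappa>: "\<And>i j. i \<in> {1..r} \<Longrightarrow> j \<in> {1..r + 1} \<Longrightarrow> \<kappa> i (b j) = eps i j"
    by (rule weight_basis) blast
  have onto: "\<exists>l\<in>{1..r + 1}. x = b l" for x
    using bij by (metis UNIV_I bij_betw_def imageE)
  have b_eq: "b k = b l \<longleftrightarrow> k = l" if "k \<in> {1..r + 1}" "l \<in> {1..r + 1}" for k l
    using bij that by (auto simp: bij_betw_def inj_on_def)
  define \<phi> where "\<phi> i = Fmat X (\<tau> i) $ b (i + 1) $ b i" for i
  define \<eta> where "\<eta> i = Emat X (\<tau> i) $ b i $ b (i + 1)" for i
  have E: "Emat X (\<tau> i) *v axis (b j) 1 = (if j = i + 1 then \<eta> i *s axis (b i) 1 else 0)"
    if i: "i \<in> {1..r}" and j: "j \<in> {1..r + 1}" for i j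
  proof (unfold vec_eq_iff, rule)
    fix x
    obtain l where l: "l \<in> {1..r + 1}" "x = b l" using onto by blast
    have i': "i \<in> {1..r + 1}" using i by auto
    have nz: "j = i + 1 \<and> l = i" if "Emat X (\<tau> i) $ b l $ b j \<noteq> 0"
    proof (rule eps_step[OF l(1) j i])
      fix m assume m: "m \<in> {1..r}"
      show "eps m l = eps m i - eps m (i + 1) + eps m j"
        using graded(1)[OF m i that] unfolding \<kappa>[OF m l(1)] \<kappa>[OF m j] .
    qed
    have "(\<eta> i *s axis (b i) 1) $ x = (if l = i then \<eta> i else 0)"
      using b_eq[OF l(1) i'] by (simp add: l(2) axis_def)
    then show "(Emat X (\<tau> i) *v axis (b j) 1) $ x = (if j = i + 1 then \<eta> i *s axis (b i) 1 else 0) $ x"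
      unfolding mv_axis l(2) using nz by (auto simp: \<eta>_def)
  qed
  have F: "Fmat X (\<tau> i) *v axis (b j) 1 = (if j = i then \<phi> i *s axis (b (i + 1)) 1 else 0)"
    if i: "i \<in> {1..r}" and j: "j \<in> {1..r + 1}" for i j
  proof (unfold vec_eq_iff, rule)
    fix x
    obtain l where l: "l \<in> {1..r + 1}" "x = b l" using onto by blast
    have i': "i + 1 \<in> {1..r + 1}" using i by auto
    have nz: "l = i + 1 \<and> j = i" if "Fmat X (\<tau> i) $ b l $ b j \<noteq> 0"
    proof (rule eps_step[OF j l(1) i])
      fix m assume m: "m \<in> {1..r}"
      show "eps m j = eps m i - eps m (i + 1) + eps m l"
        using graded(2)[OF m i that] unfolding \<kappa>[OF m l(1)] \<kappa>[OF m j] .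
    qed
    have "(\<phi> i *s axis (b (i + 1)) 1) $ x = (if l = i + 1 then \<phi> i else 0)"
      using b_eq[OF l(1) i'] by (simp add: l(2) axis_def)
    then show "(Fmat X (\<tau> i) *v axis (b j) 1) $ x = (if j = i then \<phi> i *s axis (b (i + 1)) 1 else 0) $ x"
      unfolding mv_axis l(2) using nz by (auto simp: \<phi>_def)
  qed
  have K: "Kmat X (\<tau> i) *v axis (b j) 1 = K_eigval (complex_of_real q) i j *s axis (b j) 1"
    if i: "i \<in> {1..r}" and j: "j \<in> {1..r + 1}" for i j
    unfolding K_axis[OF i] \<kappa>[OF i j] using q by (simp add: eps_def K_eigval_def powr_minus)
  have \<phi>\<eta>: "\<phi> i * \<eta> i = 1" if i: "i \<in> {1..r}" for i
  proof -
    have i': "i \<in> {1..r + 1}" "i + 1 \<in> {1..r + 1}" using i by auto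
    have "Kmat X (\<tau> i) *v axis (b i) 1 = complex_of_real q *s axis (b i) 1"
      by (simp add: K[OF i i'(1)] K_eigval_def)
    from EF_weight[OF i this] have "(\<phi> i * \<eta> i) *s axis (b i) (1 :: complex) = axis (b i) 1"
      using E[OF i i'(1)] E[OF i i'(2)] F[OF i i'(1)] by (simp add: mv_linear smult_simps)
    from arg_cong[OF this, of "\<lambda>v. v $ b i"] show ?thesis by simp
  qed
  then have "\<phi> i \<noteq> 0" "\<eta> i = inverse (\<phi> i)" if "i \<in> {1..r}" for i
    using \<phi>\<eta>[OF that] inverse_unique[OF \<phi>\<eta>[OF that]] by auto
  then have "chain (complex_of_real q) r X b \<tau> \<phi>"
    using q r bij \<tau>_mem \<tau>_onto K E F by unfold_locales simp_all
  then show thesis using \<kappa> by (rule that)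
qed

text \<open>The extremal vectors on which the braidings are normalized. The highest weight of the dual is the fundamental weight at the other
  end of the diagram.\<close>

lemma highest_V:
  assumes "chain (complex_of_real q) r X b \<tau> \<phi>" and \<kappa>: "\<And>i j. i \<in> {1..r} \<Longrightarrow> j \<in> {1..r + 1} \<Longrightarrow> \<kappa> i (b j) = eps i j"
  shows "highest_vec q r X (fund_weight r (node Q)) (axis (b 1) 1)" "lowest_vec q r X (axis (b (r + 1)) 1)"
    and "highest_vec q r (dual_module X) (fund_weight r (\<tau> r)) (axis (b (r + 1)) 1)"
    and "lowest_vec q r (dual_module X) (axis (b 1) 1)"
proof -
  interpret chain "complex_of_real q" r X b \<tau> \<phi> by fact
  have 1: "1 \<in> {1..r + 1}" "r + 1 \<in> {1..r + 1}" "1 \<in> {1..r}" "r \<in> {1..r}" using r by auto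
  have all: "\<forall>i\<in>{1..r}. P i" if P: "\<And>i. i \<in> {1..r} \<Longrightarrow> P (\<tau> i)" for P
  proof
    fix i assume "i \<in> {1..r}"
    then show "P i" using P[of "\<tau> i"] \<tau>_mem[of i] \<tau>_involutive[of i] by simp
  qed
  have K_eigval: "K_eigval (complex_of_real q) i j = complex_of_real (q powr eps i j)" for i j
    using q by (simp add: K_eigval_def eps_def powr_minus)
  have fund: "wform r (sroot (\<tau> i)) (fund_weight r (\<tau> j)) = (if i = j then 1 else 0)" if "i \<in> {1..r}" "j \<in> {1..r}" for i j
    using wform_sroot_fund[OF \<tau>_mem[OF that(1)]] \<tau>_eq[OF that] by simp
  have nz: "axis x (1 :: complex) \<noteq> 0" for x :: 'n by (simp add: axis_eq_0_iff)
  have "Kmat X (\<tau> i) *v axis (b 1) 1 = complex_of_real (q powr wform r (sroot (\<tau> i)) (fund_weight r (\<tau> 1))) *s axis (b 1) 1"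
    if i: "i \<in> {1..r}" for i
    unfolding K[OF i 1(1)] fund[OF i 1(3)] K_eigval using i by (simp add: eps_def)
  then have "has_weight q r X (fund_weight r (node Q)) (axis (b 1) 1)"
    unfolding has_weight_def scaleR_vec \<tau>_1[symmetric]
    by (intro conjI all is_weight_fund \<tau>_mem 1(3) nz)
  moreover have "Emat X (\<tau> i) *v axis (b 1) 1 = 0" if i: "i \<in> {1..r}" for i
    unfolding E[OF i 1(1)] using i by simp
  ultimately show "highest_vec q r X (fund_weight r (node Q)) (axis (b 1) 1)"
    unfolding highest_vec_def by (intro conjI all)
  have "Fmat X (\<tau> i) *v axis (b (r + 1)) 1 = 0" if i: "i \<in> {1..r}" for i
    unfolding F[OF i 1(2)] using i by simp
  then show "lowest_vec q r X (axis (b (r + 1)) 1)"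
    unfolding lowest_vec_def using wt by (intro conjI all exI)
  have "Kmat (dual_module X) (\<tau> i) *v axis (b (r + 1)) 1
      = complex_of_real (q powr wform r (sroot (\<tau> i)) (fund_weight r (\<tau> r))) *s axis (b (r + 1)) 1"
    if i: "i \<in> {1..r}" for i
    unfolding dual_K[OF i 1(2)] fund[OF i 1(4)] using i q by (simp add: K_eigval_def)
  then have "has_weight q r (dual_module X) (fund_weight r (\<tau> r)) (axis (b (r + 1)) 1)"
    unfolding has_weight_def scaleR_vec by (intro conjI all is_weight_fund \<tau>_mem 1(4) nz)
  moreover have "Emat (dual_module X) (\<tau> i) *v axis (b (r + 1)) 1 = 0" if i: "i \<in> {1..r}" for i
    unfolding dual_E[OF i 1(2)] using i by simp
  ultimately show "highest_vec q r (dual_module X) (fund_weight r (\<tau> r)) (axis (b (r + 1)) 1)"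
    unfolding highest_vec_def by (intro conjI all)
  have "is_weight r (\<lambda>k. - wt Q (b 1) k)"
  proof -
    have w: "is_weight r (wt Q (b 1))" using wt by (simp add: has_weight_def)
    have "wform r (sroot i) (\<lambda>k. - wt Q (b 1) k) = - wform r (sroot i) (wt Q (b 1))" for i
      by (simp add: wform_def sum_negf)
    then show ?thesis using w by (simp add: is_weight_def sum_negf)
  qed
  moreover have "Kmat (dual_module X) (\<tau> i) *v axis (b 1) 1
      = complex_of_real (q powr wform r (sroot (\<tau> i)) (\<lambda>k. - wt Q (b 1) k)) *s axis (b 1) 1" if i: "i \<in> {1..r}" for i
  proof -
    have "wform r (sroot (\<tau> i)) (\<lambda>k. - wt Q (b 1) k) = - eps i 1"
      using \<kappa>[OF i 1(1)] by (simp add: \<kappa>_def wform_def sum_negf)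
    then show ?thesis unfolding dual_K[OF i 1(1)] K_eigval by (simp add: powr_minus)
  qed
  ultimately have "has_weight q r (dual_module X) (\<lambda>k. - wt Q (b 1) k) (axis (b 1) 1)"
    unfolding has_weight_def scaleR_vec by (intro conjI all nz)
  moreover have "Fmat (dual_module X) (\<tau> i) *v axis (b 1) 1 = 0" if i: "i \<in> {1..r}" for i
    unfolding dual_F[OF i 1(1)] using i by simp
  ultimately show "lowest_vec q r (dual_module X) (axis (b 1) 1)"
    unfolding lowest_vec_def by (intro conjI all exI)
qed

lemma qpow: "qpow Q x * qpow Q y = qpow Q (x + y)" "inverse (qpow Q x) = qpow Q (- x)" "qpow Q 0 = 1"
  "qpow Q x \<noteq> 0" "complex_of_real q = qpow Q 1"
  using q by (simp_all add: qpow_def powr_add powr_minus)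

lemma a_num: "a_num Q = 2"
proof -
  have "node Q \<in> {1..r}" using \<tau>_mem[of 1] \<tau>_1 r by auto
  from wform_sroot[OF this] show ?thesis by (simp add: a_num_def sroot_def)
qed

lemma w_num: "w_num Q = real r / real (r + 1)"
proof -
  have n: "node Q \<in> {1..r}" using \<tau>_mem[of 1] \<tau>_1 r by auto
  have "s - s * s / n = (n - 1) / n" if "s = 1 \<or> s = n - 1" "n \<noteq> 0" for s n :: real
    using that by (auto simp: field_simps)
  from this[of "real (node Q)" "real (r + 1)"] show ?thesis
    unfolding w_num_def wform_fund_fund[OF n] using node by auto
qed

text \<open>The coefficients of \<open>2\<rho>\<close> are symmetric under the diagram automorphism.\<close>

lemma \<tau>_weight: "i \<in> {1..r} \<Longrightarrow> real (\<tau> i) * (real (r + 1) - real (\<tau> i)) = real i * (real (r + 1) - real i)"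
  by (auto simp: \<tau>_def of_nat_diff)

lemma two_rho_\<tau>: "wform r \<mu> (two_rho r) = (\<Sum>i = 1..r. real i * (real (r + 1) - real i) * wform r (sroot (\<tau> i)) \<mu>)"
proof -
  let ?g = "\<lambda>i. real i * (real (r + 1) - real i) * wform r (sroot i) \<mu>"
  have "wform r \<mu> (two_rho r) = (\<Sum>i = 1..r. ?g i)" by (rule wform_two_rho)
  also have "\<dots> = (\<Sum>i = 1..r. ?g (\<tau> i))" by (rule sum.reindex_bij_betw[OF \<tau>_bij, symmetric])
  also have "\<dots> = (\<Sum>i = 1..r. real i * (real (r + 1) - real i) * wform r (sroot (\<tau> i)) \<mu>)"
    by (intro sum.cong refl) (simp only: \<tau>_weight)
  finally show ?thesis .
qed

lemma m_num: "m_num Q = real r"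
proof -
  have "m_num Q = (\<Sum>i = 1..r. real i * (real (r + 1) - real i) * eps i 1)"
    unfolding m_num_def two_rho_\<tau>
  proof (intro sum.cong refl)
    fix i assume i: "i \<in> {1..r}"
    have "wform r (sroot (\<tau> i)) (fund_weight r (node Q)) = eps i 1"
      using i r \<tau>_eq[OF i, of 1] \<tau>_1 by (auto simp: wform_sroot_fund[OF \<tau>_mem[OF i]] eps_def)
    then show "real i * (real (r + 1) - real i) * wform r (sroot (\<tau> i)) (fund_weight r (node Q))
        = real i * (real (r + 1) - real i) * eps i 1" by simp
  qed
  also have "\<dots> = real r" using sum_eps[of 1 r] by simp
  finally show ?thesis .
qed

lemma exponents:
  "wform r (fund_weight r (node Q)) (longest r (fund_weight r (node Q))) = - 1 / real (r + 1)"
  "wform r (fund_weight r (\<tau> r)) (longest r (fund_weight r (\<tau> r))) = - 1 / real (r + 1)"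
  "wform r (fund_weight r (node Q)) (longest r (fund_weight r (\<tau> r))) = 1 / real (r + 1) - 1"
proof -
  have n: "node Q \<in> {1..r}" "\<tau> r \<in> {1..r}" using \<tau>_mem[of 1] \<tau>_mem[of r] \<tau>_1 r by auto
  have self: "real (s + s - (r + 1)) - real s * real s / real (r + 1) = - 1 / real (r + 1)" if "s = 1 \<or> s = r" for s
    using that
  proof
    assume s: "s = r"
    then have "real (s + s - (r + 1)) = real r - 1" using r by (simp add: of_nat_diff)
    then show ?thesis using s by (simp add: field_simps)
  qed (use r in simp)
  have "\<tau> r = 1 \<or> \<tau> r = r" by (auto simp: \<tau>_def)
  then show "wform r (fund_weight r (node Q)) (longest r (fund_weight r (node Q))) = - 1 / real (r + 1)"
    "wform r (fund_weight r (\<tau> r)) (longest r (fund_weight r (\<tau> r))) = - 1 / real (r + 1)"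
    using self node unfolding wform_fund_longest[OF n(1) n(1)] wform_fund_longest[OF n(2) n(2)] by auto
  have "node Q + \<tau> r = r + 1" "real (node Q) * real (\<tau> r) = real r" using node r by (auto simp: \<tau>_def)
  then show "wform r (fund_weight r (node Q)) (longest r (fund_weight r (\<tau> r))) = 1 / real (r + 1) - 1"
    unfolding wform_fund_longest[OF n] by (simp add: field_simps)
qed

text \<open>The invariant form normalizes all three braidings by \<open>t = q\<close> to the power \<open>- 1 / (r + 1)\<close>. The numbers \<open>(\<lambda>\<^sub>i,2\<rho>)\<close> are
  \<open>r, r - 2, \<dots>, - r\<close>; they are symmetric about \<open>0\<close>, so the inverses that come from \<open>C'\<close> also add up to the quantum
  dimension.\<close>

lemma quantum_leg_data:
  obtains h1 h0 k0 where
    "leg_data (VV Q) (VD Q) (DD Q) (matrix_inv (VV Q)) (matrix_inv (VD Q)) (matrix_inv (DD Q)) (qweight Q)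
       (qpow Q (- w_num Q - m_num Q)) h1 h0 (qpow Q (2 - 2 * w_num Q)) k0"
    and "(\<Sum>i\<in>UNIV. inverse (qweight Q i)) = qdim Q"
proof -
  obtain b \<phi> where ch: "chain (complex_of_real q) r X b \<tau> \<phi>"
    and \<kappa>: "\<And>i j. i \<in> {1..r} \<Longrightarrow> j \<in> {1..r + 1} \<Longrightarrow> \<kappa> i (b j) = eps i j"
    by (rule chain_exists) blast
  interpret chain "complex_of_real q" r X b \<tau> \<phi> by (rule ch)
  note hw = highest_V[OF ch \<kappa>]
  define t where "t = qpow Q (- 1 / real (r + 1))"
  have D: "qweight Q (b k) = qpow Q (real r + 2 - 2 * real k)" if k: "k \<in> {1..r + 1}" for k
  proof -
    have "wform r (wt Q (b k)) (two_rho r) = (\<Sum>i = 1..r. real i * (real (r + 1) - real i) * eps i k)"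
      unfolding two_rho_\<tau> by (intro sum.cong refl) (simp add: \<kappa>[OF _ k, symmetric] \<kappa>_def)
    then show ?thesis by (simp only: qweight_def sum_eps[OF k])
  qed
  have braid: "is_braiding q r X X (VV Q)" "is_braiding q r X (dual_module X) (VD Q)"
    "is_braiding q r (dual_module X) (dual_module X) (DD Q)"
    using Q by (simp_all add: is_quantum_data_def)
  have "leg_data (VV Q) (VD Q) (DD Q) (matrix_inv (VV Q)) (matrix_inv (VD Q)) (matrix_inv (DD Q)) (qweight Q)
       (qpow Q (- w_num Q - m_num Q)) (t * t) (t * (complex_of_real q - inverse (complex_of_real q)))
       (inverse (t * t)) (- inverse t * (complex_of_real q - inverse (complex_of_real q)))"
  proof (rule explicit_leg_data)
    show "VV Q *v vt 1 (r + 1) = t *s vt (r + 1) 1"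
      using braid(1) hw(1,2) exponents(1) unfolding is_braiding_def t_def qpow_def scaleR_vec by metis
    show "DD Q *v vt (r + 1) 1 = t *s vt 1 (r + 1)"
      using braid(3) hw(3,4) exponents(2) unfolding is_braiding_def t_def qpow_def scaleR_vec by metis
    have "VD Q *v vt 1 1 = qpow Q (1 / real (r + 1) - 1) *s vt 1 1"
      using braid(2) hw(1,3,4) exponents(3) unfolding is_braiding_def qpow_def scaleR_vec by metis
    then show "VD Q *v vt 1 1 = (inverse t * inverse (complex_of_real q)) *s vt 1 1"
      by (simp add: t_def qpow del: of_nat_Suc of_nat_add)
    have "1 \<in> {1..r + 1}" by simp
    from D[OF this] have "qweight Q (b 1) = qpow Q (real r)" by simp
    moreover have "- w_num Q - m_num Q + real r = 1 / real (r + 1) - 1"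
      unfolding w_num m_num by (simp add: field_simps)
    ultimately show "qpow Q (- w_num Q - m_num Q) * qweight Q (b 1) = inverse t * inverse (complex_of_real q)"
      by (simp add: t_def qpow del: of_nat_Suc of_nat_add)
    show "qweight Q (b (Suc k)) = inverse (complex_of_real q) * inverse (complex_of_real q) * qweight Q (b k)" if "k \<in> {1..r}" for k
      using that by (simp add: D qpow)
  qed (use braid in \<open>simp_all add: is_braiding_def t_def qpow qweight_def\<close>)
  moreover have "inverse (t * t) = qpow Q (2 - 2 * w_num Q)"
  proof -
    have "- (- 1 / real (r + 1) + - 1 / real (r + 1)) = 2 - 2 * w_num Q"
      unfolding w_num by (simp add: field_simps)
    then show ?thesis by (simp only: t_def qpow)
  qed
  moreover have "(\<Sum>i\<in>UNIV. inverse (qweight Q i)) = qdim Q"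
  proof -
    have "(\<Sum>i\<in>UNIV. inverse (qweight Q i)) = (\<Sum>k = 1..r + 1. qpow Q (- (real r + 2 - 2 * real k)))"
      unfolding sum.reindex_bij_betw[OF bij, symmetric] by (intro sum.cong refl) (simp add: D qpow)
    also have "\<dots> = (\<Sum>k = 1..r + 1. qpow Q (real r + 2 - 2 * real k))"
      by (rule sum.reindex_bij_witness[where i = "\<lambda>k. r + 2 - k" and j = "\<lambda>k. r + 2 - k"])
        (auto simp: of_nat_diff algebra_simps)
    also have "\<dots> = (\<Sum>i\<in>UNIV. qweight Q i)"
      unfolding sum.reindex_bij_betw[OF bij, symmetric] by (intro sum.cong refl) (simp add: D)
    finally show ?thesis by (simp add: qdim_def qweight_def)
  qed
  ultimately show thesis using that by metis
qed

end

section \<open>Families on index lists\<close>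

lemma sum_lists_2: "(\<Sum>J | length J = 2. f J) = (\<Sum>k\<in>UNIV. \<Sum>l\<in>UNIV. f [k, l :: 'n::finite])"
proof -
  have "{J :: 'n list. length J = 2} = (\<lambda>(k, l). [k, l]) ` UNIV"
    by (auto simp: image_iff length_Suc_conv numeral_2_eq_2)
  moreover have "inj (\<lambda>(k :: 'n, l :: 'n). [k, l])" by (auto simp: inj_def)
  ultimately show ?thesis
    by (simp add: sum.reindex split_def sum.cartesian_product flip: UNIV_Times_UNIV)
qed

lemma on_legs_braid:
  "on_legs 1 2 2 (braid_map M) x (i # j # I) = braid M (\<lambda>i j. x (i # j # I)) i j"
  "on_legs 2 2 2 (braid_map M) x (h # i # j # I) = braid M (\<lambda>i j. x (h # i # j # I)) i j"
  "on_legs 3 2 2 (braid_map M) x (g # h # i # j # I) = braid M (\<lambda>i j. x (g # h # i # j # I)) i j"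
  by (simp_all add: on_legs_def sum_lists_2 braid_map_def braid_def)

lemma on_legs_contract:
  "E23 x (i # I) = cap (\<lambda>j k. x (i # j # k # I))"
  "E'12 Q x I = qcap (qweight Q) (\<lambda>i j. x (i # j # I))"
  "C'2 Q x (i # j # k # I) = qcup (qweight Q) (x (i # I)) j k"
proof -
  have d: "(\<Sum>k\<in>UNIV. \<Sum>l\<in>UNIV. (if k = l then f l else 0) *\<^sub>C y k l) = (\<Sum>k\<in>UNIV. f k *\<^sub>C y k k)"
    for f :: "'n::finite \<Rightarrow> complex" and y :: "'n \<Rightarrow> 'n \<Rightarrow> 'x::complex_vector"
  proof (intro sum.cong refl)
    fix k
    have "(\<Sum>l\<in>UNIV. (if k = l then f l else 0) *\<^sub>C y k l) = (\<Sum>l\<in>UNIV. if k = l then f k *\<^sub>C y k k else 0)"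
      by (intro sum.cong refl) auto
    then show "(\<Sum>l\<in>UNIV. (if k = l then f l else 0) *\<^sub>C y k l) = f k *\<^sub>C y k k" by simp
  qed
  show "E23 x (i # I) = cap (\<lambda>j k. x (i # j # k # I))"
    using d[of "\<lambda>k. 1"] by (simp add: E23_def on_legs_def sum_lists_2 cap_def)
  show "E'12 Q x I = qcap (qweight Q) (\<lambda>i j. x (i # j # I))"
    by (simp add: E'12_def on_legs_def sum_lists_2 qcap_def d qweight_def cong: if_cong)
  show "C'2 Q x (i # j # k # I) = qcup (qweight Q) (x (i # I)) j k"
  proof (cases "qpar Q = 0")
    case False
    then show ?thesis
      by (auto simp: C'2_def on_legs_def qcup_def qweight_def qpow_def powr_minus numeral_2_eq_2)
  next
    case True
    then show ?thesis
      by (auto simp: C'2_def on_legs_def qcup_def qweight_def qpow_def powr_minus numeral_2_eq_2)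
  qed
qed

text \<open>The leg maps of a family on index lists, with arbitrary further legs \<open>I\<close>, in terms of the curried ones.\<close>

locale quantum_legs = leg_data "VV Q" "VD Q" "DD Q" "matrix_inv (VV Q)" "matrix_inv (VD Q)" "matrix_inv (DD Q)"
    "qweight Q" c h1 h0 k1 k0
  for Q :: "'n::finite quantum_data" and c h1 h0 k1 k0
begin

lemma leg_maps:
  "S123 Q x (i # j # k # I) = S (\<lambda>i j k. x (i # j # k # I)) i j k"
  "S123_inv Q x (i # j # k # I) = Sinv (\<lambda>i j k. x (i # j # k # I)) i j k"
  "St234 Q x (i # j # k # l # I) = St (\<lambda>j k l. x (i # j # k # l # I)) j k l"
  "St234_inv Q x (i # j # k # l # I) = Stinv (\<lambda>j k l. x (i # j # k # l # I)) j k l"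
proof -
  have *: "braid M F i = (\<lambda>j k. braid M (\<lambda>i j. F i j k) i j)" for M i and F :: "'n \<Rightarrow> 'n \<Rightarrow> 'n \<Rightarrow> 'z::complex_vector"
    by (intro ext braid_apply)
  show "S123 Q x (i # j # k # I) = S (\<lambda>i j k. x (i # j # k # I)) i j k"
    "S123_inv Q x (i # j # k # I) = Sinv (\<lambda>i j k. x (i # j # k # I)) i j k"
    unfolding S123_def S123_inv_def on23_def on_legs_braid S_def Sinv_def * by (rule refl)+
  show "St234 Q x (i # j # k # l # I) = St (\<lambda>j k l. x (i # j # k # l # I)) j k l"
    "St234_inv Q x (i # j # k # l # I) = Stinv (\<lambda>j k l. x (i # j # k # l # I)) j k l"
    unfolding St234_def St234_inv_def on23_def on_legs_braid St_def Stinv_def * by (rule refl)+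
qed

lemma S_all: "S (\<lambda>i j k. x i j k l) i j k = S x i j k l"
  by (rule S_clinear[OF clinear_apply, symmetric])

lemma Sinv_all: "Sinv (\<lambda>i j k. x i j k l) i j k = Sinv x i j k l"
proof -
  have "S (\<lambda>i j k. Sinv x i j k l) = (\<lambda>i j k. S (Sinv x) i j k l)"
    by (rule S_pointwise[OF clinear_apply, symmetric])
  then have "(\<lambda>i j k. Sinv x i j k l) = Sinv (\<lambda>i j k. x i j k l)"
    using S_Sinv(2)[of "\<lambda>i j k. Sinv x i j k l"] by simp
  then show ?thesis by (simp add: fun_eq_iff)
qed

lemma T1234_eq: "T1234 Q x (i # j # k # l # I) = T (\<lambda>i j k l. x (i # j # k # l # I)) i j k l"
  using S_all[of "\<lambda>i. St (\<lambda>j k l. x (i # j # k # l # I))" l i j k]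
  by (simp add: T1234_def leg_maps T_def)

end

lemma fam_prod_4: "fam_prod f (fam x) (fam y) [i, j, k, l] = f (x i j) (y k l)"
  by (simp add: fam_prod_def fam_def)

lemma presented_left_module_generator:
  assumes "presented_left_module N B e rels" "is_bimodule N"
  shows "e x \<in> B"
proof -
  have "left_eval N e (Poly_Mapping.single x 1) = e x"
    using assms(2) by (simp add: left_eval_single is_bimodule_def)
  moreover have "left_eval N e (Poly_Mapping.single x 1) \<in> B"
    using assms(1) unfolding presented_left_module_def by blast
  ultimately show ?thesis by simp
qed

context quantum_legs
begin

lemma algebra_relation:
  assumes p: "presented_algebra (\<lambda>(i, j). p i j) (algebra_relations Q)"
  shows "St (\<lambda>j k l. p i j * p k l) j k l = qpow Q (- w_num Q) *\<^sub>C (p i j * p k l)"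
    and "qcap (qweight Q) p = qpow Q (m_num Q) *\<^sub>C 1"
proof -
  let ?p = "\<lambda>(i, j). p i j"
  define g :: "('n, ('n \<times> 'n) list \<Rightarrow>\<^sub>0 complex) family" where "g = fam (\<lambda>i j. Poly_Mapping.single [(i, j)] 1)"
  note L = clinear_alg_eval[of ?p]
  note rel = presented_algebra_relation[OF p]
  have gg: "alg_eval ?p (fam_prod (*) g g [i, j, k, l]) = p i j * p k l" for i j k l
    by (simp add: g_def fam_prod_4 mult_single plus_list_def alg_eval_single)
  have e: "x = y" if "alg_eval ?p (X - c *\<^sub>C Y) = 0" "alg_eval ?p X = x" "c *\<^sub>C alg_eval ?p Y = y" for X Y c x y
    using that by (simp add: clinear_diff[OF L] clinear_scaleC[OF L])
  show "St (\<lambda>j k l. p i j * p k l) j k l = qpow Q (- w_num Q) *\<^sub>C (p i j * p k l)"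
  proof (rule e[OF rel])
    show "St234 Q (fam_prod (*) g g) [i, j, k, l] - qpow Q (- w_num Q) *\<^sub>C fam_prod (*) g g [i, j, k, l] \<in> algebra_relations Q"
      unfolding algebra_relations_def g_def Let_def
      by (intro UnI1 UnI2 CollectI exI[of _ "[i, j, k, l]"]) simp
  qed (simp_all add: leg_maps St_clinear[OF L] gg)
  show "qcap (qweight Q) p = qpow Q (m_num Q) *\<^sub>C 1"
  proof (rule e[OF rel])
    show "E'12 Q g [] - qpow Q (m_num Q) *\<^sub>C 1 \<in> algebra_relations Q"
      unfolding algebra_relations_def g_def Let_def by (intro UnI2) simp
    show "alg_eval ?p (E'12 Q g []) = qcap (qweight Q) p"
      by (simp add: on_legs_contract(2) qcap_clinear[OF L] g_def fam_def alg_eval_single)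
    have "alg_eval ?p (Poly_Mapping.single [] 1) = 1" by (simp add: alg_eval_single)
    moreover have "Poly_Mapping.single ([] :: ('n \<times> 'n) list) (1 :: complex) = 1"
      by (simp add: single_one zero_list_def[symmetric])
    ultimately show "qpow Q (m_num Q) *\<^sub>C alg_eval ?p 1 = qpow Q (m_num Q) *\<^sub>C 1" by simp
  qed
qed

lemma plus_relation:
  fixes A :: "('n, 'b::complex_algebra_1, 'w::complex_vector, 't, 'v, 'u) calculus"
  assumes pm: "presented_left_module (Om A) B (\<lambda>(i, j). dp i j) (plus_relations Q A)" and b: "is_bimodule (Om A)"
  shows "St (\<lambda>j k l. lact (Om A) (gen A i j) (dp k l)) j k l = qpow Q (- w_num Q) *\<^sub>C lact (Om A) (gen A i j) (dp k l)"
    and "qcap (qweight Q) dp = 0"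
proof -
  let ?e = "\<lambda>(i, j). dp i j"
  define e :: "('n, 'n \<times> 'n \<Rightarrow>\<^sub>0 'b) family" where "e = fam (\<lambda>i j. Poly_Mapping.single (i, j) 1)"
  note L = clinear_left_eval[OF b, of ?e]
  note rel = presented_left_module_relation[OF pm]
  have pe: "left_eval (Om A) ?e (fam_prod free_lact (pfam A) e [i, j, k, l]) = lact (Om A) (gen A i j) (dp k l)" for i j k l
    by (simp add: e_def pfam_def fam_prod_4 free_lact_single left_eval_single[OF b])
  have *: "x = y" if "left_eval (Om A) ?e (X - c *\<^sub>C Y) = 0" "left_eval (Om A) ?e X = x" "c *\<^sub>C left_eval (Om A) ?e Y = y" for X Y c x y
    using that by (simp add: clinear_diff[OF L] clinear_scaleC[OF L])
  show "St (\<lambda>j k l. lact (Om A) (gen A i j) (dp k l)) j k l = qpow Q (- w_num Q) *\<^sub>C lact (Om A) (gen A i j) (dp k l)"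
  proof (rule *[OF rel])
    show "St234 Q (fam_prod free_lact (pfam A) e) [i, j, k, l] - qpow Q (- w_num Q) *\<^sub>C fam_prod free_lact (pfam A) e [i, j, k, l]
        \<in> plus_relations Q A"
      unfolding plus_relations_def e_def Let_def
      by (intro UnI1 CollectI exI[of _ "[i, j, k, l]"]) simp
  qed (simp_all add: leg_maps St_clinear[OF L] pe)
  have "E'12 Q e [] \<in> plus_relations Q A"
    unfolding plus_relations_def e_def Let_def by (intro UnI2) simp
  from rel[OF this] show "qcap (qweight Q) dp = 0"
    using b by (simp add: on_legs_contract(2) qcap_clinear[OF L] e_def fam_def left_eval_single[OF b] is_bimodule_def)
qed

lemma minus_relation:
  fixes A :: "('n, 'b::complex_algebra_1, 'w::complex_vector, 't, 'v, 'u) calculus"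
  assumes pm: "presented_left_module (Om A) B (\<lambda>(i, j). db i j) (minus_relations Q A)" and b: "is_bimodule (Om A)"
  shows "S (\<lambda>i j k l. lact (Om A) (gen A i j) (db k l)) i j k l = qpow Q (w_num Q) *\<^sub>C lact (Om A) (gen A i j) (db k l)"
    and "qcap (qweight Q) db = 0"
proof -
  let ?e = "\<lambda>(i, j). db i j"
  define e :: "('n, 'n \<times> 'n \<Rightarrow>\<^sub>0 'b) family" where "e = fam (\<lambda>i j. Poly_Mapping.single (i, j) 1)"
  note L = clinear_left_eval[OF b, of ?e]
  note rel = presented_left_module_relation[OF pm]
  have pe: "left_eval (Om A) ?e (fam_prod free_lact (pfam A) e [i, j, k, l]) = lact (Om A) (gen A i j) (db k l)" for i j k l
    by (simp add: e_def pfam_def fam_prod_4 free_lact_single left_eval_single[OF b])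
  have *: "x = y" if "left_eval (Om A) ?e (X - c *\<^sub>C Y) = 0" "left_eval (Om A) ?e X = x" "c *\<^sub>C left_eval (Om A) ?e Y = y" for X Y c x y
    using that by (simp add: clinear_diff[OF L] clinear_scaleC[OF L])
  show "S (\<lambda>i j k l. lact (Om A) (gen A i j) (db k l)) i j k l = qpow Q (w_num Q) *\<^sub>C lact (Om A) (gen A i j) (db k l)"
  proof (rule *[OF rel])
    show "S123 Q (fam_prod free_lact (pfam A) e) [i, j, k, l] - qpow Q (w_num Q) *\<^sub>C fam_prod free_lact (pfam A) e [i, j, k, l]
        \<in> minus_relations Q A"
      unfolding minus_relations_def e_def Let_def
      by (intro UnI1 CollectI exI[of _ "[i, j, k, l]"]) simp
  qed (simp_all add: leg_maps S_clinear[OF L] pe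
      S_all[of "\<lambda>i j k l. lact (Om A) (gen A i j) (db k l)", symmetric])
  have "E'12 Q e [] \<in> minus_relations Q A"
    unfolding minus_relations_def e_def Let_def by (intro UnI2) simp
  from rel[OF this] show "qcap (qweight Q) db = 0"
    using b by (simp add: on_legs_contract(2) qcap_clinear[OF L] e_def fam_def left_eval_single[OF b] is_bimodule_def)
qed

end

section \<open>The Ricci tensor\<close>

theorem lemma6p3:
  fixes Q :: "'n::finite quantum_data"
    and A :: "('n, 'b::complex_algebra_1, 'w::complex_vector, 't::complex_vector,
                'v::complex_vector, 'u::complex_vector) calculus"
    and ip :: "'t \<Rightarrow> 'b" and nabla :: "'w \<Rightarrow> 't" and \<sigma> :: "'t \<Rightarrow> 't" and s :: "'v \<Rightarrow> 't"
    and c_pm c_mp :: complex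
  assumes "is_quantum_data Q"
    and "is_hk_calculus Q A"
    and "is_universal_calculus A"
    and "is_inverse_metric Q A ip"
    and "is_levi_civita Q A nabla"
    and "is_generalized_braiding Q A \<sigma>"
    and "c_pm + c_mp = 1"
    and "is_splitting_map Q A \<sigma> c_pm c_mp s"
  shows "Ricci_mp Q A ip nabla s = (- c_pm * qpow Q (a_num Q) * qdim Q) *\<^sub>C g_mp Q A"
proof -
  note quantum = assms(1) and hk = assms(2) and univ = assms(3) and inverse_metric = assms(4)
    and levi_civita = assms(5) and braiding = assms(6) and splitting = assms(8)
  interpret quantum Q by unfold_locales (rule quantum)
  obtain h1 h0 k0 where legs: "leg_data (VV Q) (VD Q) (DD Q) (matrix_inv (VV Q)) (matrix_inv (VD Q))
      (matrix_inv (DD Q)) (qweight Q) (qpow Q (- w_num Q - m_num Q)) h1 h0 (qpow Q (2 - 2 * w_num Q)) k0"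
    and qdim: "(\<Sum>i\<in>UNIV. inverse (qweight Q i)) = qdim Q"
    by (rule quantum_leg_data)
  interpret quantum_legs Q "qpow Q (- w_num Q - m_num Q)" h1 h0 "qpow Q (2 - 2 * w_num Q)" k0
    unfolding quantum_legs_def by (rule legs)
  let ?qa = "qpow Q (a_num Q)" and ?qw = "qpow Q (w_num Q)" and ?qm = "qpow Q (m_num Q)"
  interpret calculus_legs "VV Q" "VD Q" "DD Q" "matrix_inv (VV Q)" "matrix_inv (VD Q)" "matrix_inv (DD Q)"
    "qweight Q" "qpow Q (- w_num Q - m_num Q)" h1 h0 "qpow Q (2 - 2 * w_num Q)" k0 A ?qa ?qw ?qm
    unfolding calculus_legs_def by (rule legs)

  have Om: "is_bimodule (Om A)"
    and plus: "presented_left_module (Om A) (Om_plus A) (\<lambda>(i, j). dp i j) (plus_relations Q A)"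
    and minus: "presented_left_module (Om A) (Om_minus A) (\<lambda>(i, j). db i j) (minus_relations Q A)"
    and alg: "presented_algebra (\<lambda>(i, j). p i j) (algebra_relations Q)"
    using hk by (simp_all add: is_hk_calculus_def)
  have fam_eqs: "pfam A = fam p" "delp A = fam dp" "delbp A = fam db"
    by (simp_all add: pfam_def delp_def delbp_def)
  note alg_rel = algebra_relation[OF alg]
    and plus_rel = plus_relation[OF plus Om]
    and minus_rel = minus_relation[OF minus Om]
  have len: "length [i, j, k, l :: 'n] = 4" for i j k l by simp
  have len2: "length [i, j :: 'n] = 2" for i j by simp
  have cap_fun: "cap f = (\<lambda>l. cap (\<lambda>j k. f j k l))" for f :: "'n \<Rightarrow> 'n \<Rightarrow> 'n \<Rightarrow> 't"
    by (intro ext cap_apply)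
  have gmp: "g_mp Q A = gmp"
    by (simp add: g_mp_def on_legs_contract fam_eqs fam_prod_4 gmp_def M_def cap_fun)
  have gpm: "g_pm Q A = gpm"
    by (simp add: g_pm_def on_legs_contract fam_eqs fam_prod_4 gpm_def P_def cap_fun)

  interpret first_order_calculus "VV Q" "VD Q" "DD Q" "matrix_inv (VV Q)" "matrix_inv (VD Q)" "matrix_inv (DD Q)"
    "qweight Q" "qpow Q (- w_num Q - m_num Q)" h1 h0 "qpow Q (2 - 2 * w_num Q)" k0 A ?qa ?qw ?qm
  proof
    show "?qa \<noteq> 0" "?qw \<noteq> 0" "?qm \<noteq> 0" by (simp_all add: qpow)
    show "qpow Q (- w_num Q - m_num Q) * (?qw * ?qm) = 1" by (simp add: qpow)
    show "qpow Q (2 - 2 * w_num Q) * (?qw * ?qw) = ?qa" by (simp add: qpow a_num)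
    show "is_bimodule (Om A)" by (rule Om)
    show "is_derivation (Om A) (del A)" "is_derivation (Om A) (delb A)"
      using hk by (simp_all add: is_hk_calculus_def)
    show "(\<lambda>i. St (pp i)) = inverse ?qw *\<^sub>C pp" "qcap (qweight Q) p = ?qm *\<^sub>C 1"
      using alg_rel by (simp_all add: fun_eq_iff pp_def qpow)
    show "(\<lambda>i. St (pdp i)) = inverse ?qw *\<^sub>C pdp" "qcap (qweight Q) dp = 0"
      using plus_rel by (simp_all add: fun_eq_iff pdp_def qpow)
    show "S pdb = ?qw *\<^sub>C pdb" "qcap (qweight Q) db = 0"
      using minus_rel by (simp_all add: fun_eq_iff pdb_def qpow)
    have "fam_prod (ract (Om A)) (delp A) (pfam A) [i, j, k, l]
        = ?qa *\<^sub>C T1234 Q (fam_prod (lact (Om A)) (pfam A) (delp A)) [i, j, k, l]" for i j k l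
      using hk len by (simp add: is_hk_calculus_def)
    then show "dpp = ?qa *\<^sub>C T pdp"
      by (simp add: fun_eq_iff dpp_def pdp_def fam_eqs fam_prod_4 T1234_eq)
    have "fam_prod (ract (Om A)) (delbp A) (pfam A) [i, j, k, l]
        = qpow Q (- a_num Q) *\<^sub>C T1234 Q (fam_prod (lact (Om A)) (pfam A) (delbp A)) [i, j, k, l]" for i j k l
      using hk len by (simp add: is_hk_calculus_def)
    then show "dbp = inverse ?qa *\<^sub>C T pdb"
      by (simp add: fun_eq_iff dbp_def pdb_def fam_eqs fam_prod_4 T1234_eq qpow)
    show "is_tensor_product (Om A) (Om A) (OmOm A) (ten A)"
      using univ by (simp add: is_universal_calculus_def)
  qed

  interpret geometry "VV Q" "VD Q" "DD Q" "matrix_inv (VV Q)" "matrix_inv (VD Q)" "matrix_inv (DD Q)"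
    "qweight Q" "qpow Q (- w_num Q - m_num Q)" h1 h0 "qpow Q (2 - 2 * w_num Q)" k0 A ?qa ?qw ?qm
    ip nabla \<sigma> s c_pm c_mp "1 / (1 + ?qa)" "qpow Q (2 * a_num Q - 2 * w_num Q)" "(1 - ?qa) * ?qa * qpow Q (- m_num Q)"
  proof
    fix i j k l
    show "is_universal_calculus A" by (rule univ)
    show "range (left_eval (Om A) (\<lambda>(i, j). dp i j)) = Om_plus A"
      "range (left_eval (Om A) (\<lambda>(i, j). db i j)) = Om_minus A"
      by (simp_all add: Om_plus_def Om_minus_def)
    show "\<exists>y\<in>Om_plus A. \<exists>z\<in>Om_minus A. x = y + z" for x
      using hk by (simp add: is_hk_calculus_def)
    show "bimodule_map (OmOm A) base_bimod ip" using inverse_metric by (simp add: is_inverse_metric_def)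
    show "ip (db i j \<otimes> db k l) = 0"
      using inverse_metric len[of i j k l] unfolding is_inverse_metric_def Let_def fam_eqs
      by (metis fam_prod_4)
    have "ip (db i j \<otimes> dp k l) = C'2 Q (fam p) [i, j, k, l] - qpow Q (- m_num Q) *\<^sub>C fam_prod (*) (fam p) (fam p) [i, j, k, l]"
      using inverse_metric len[of i j k l] unfolding is_inverse_metric_def Let_def fam_eqs
      by (metis fam_prod_4)
    then show "ip (db i j \<otimes> dp k l) = qcup (qweight Q) (p i l) j k - inverse ?qm *\<^sub>C (p i j * p k l)"
      by (simp add: on_legs_contract fam_prod_4 qpow) (simp add: fam_def)
    show "clinear nabla" "\<And>b x. nabla (b \<rhd> x) = dB A b \<otimes> x + b \<rhd>\<rhd> nabla x"
      using levi_civita by (simp_all add: is_levi_civita_def)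
    have "nabla (delp A [i, l]) = ?qa *\<^sub>C E23 (T1234 Q (fam_prod (ten A) (delbp A) (delp A))) [i, l]
         - (?qa * qpow Q (- m_num Q)) *\<^sub>C lact (OmOm A) (pfam A [i, l]) (g_mp Q A)"
      using levi_civita len2 by (simp add: is_levi_civita_def)
    then show "nabla (dp i l) = ?qa *\<^sub>C cap (T (\<lambda>i j k l. db i j \<otimes> dp k l) i) l
        - (?qa * inverse ?qm) *\<^sub>C (p i l \<rhd>\<rhd> gmp)"
      by (simp add: on_legs_contract fam_eqs T1234_eq fam_prod_4 gmp qpow cap_apply) (simp add: fam_def)
    show "bimodule_map (OmOm A) (OmOm A) \<sigma>" using braiding by (simp add: is_generalized_braiding_def)
    have sig: "\<sigma> (fam_prod (ten A) (delbp A) (delbp A) [i, j, k, l])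
         = qpow Q (- a_num Q) *\<^sub>C S123 Q (St234 Q (fam_prod (ten A) (delbp A) (delbp A))) [i, j, k, l]"
      "\<sigma> (fam_prod (ten A) (delp A) (delbp A) [i, j, k, l])
         = qpow Q (2 * a_num Q - 2 * w_num Q) *\<^sub>C S123 Q (St234_inv Q (fam_prod (ten A) (delbp A) (delp A))) [i, j, k, l]
           + ((1 - qpow Q (a_num Q)) * qpow Q (a_num Q) * qpow Q (- m_num Q)) *\<^sub>C
             fam_prod (\<lambda>b c. lact (OmOm A) b (ract (OmOm A) (g_mp Q A) c)) (pfam A) (pfam A) [i, j, k, l]"
      "\<sigma> (fam_prod (ten A) (delbp A) (delp A) [i, j, k, l])
         = qpow Q (2 * w_num Q - 2 * a_num Q) *\<^sub>C S123_inv Q (St234 Q (fam_prod (ten A) (delp A) (delbp A))) [i, j, k, l]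
           + ((1 - qpow Q (- a_num Q)) * qpow Q (- m_num Q)) *\<^sub>C
             fam_prod (\<lambda>b c. lact (OmOm A) b (ract (OmOm A) (g_pm Q A) c)) (pfam A) (pfam A) [i, j, k, l]"
      using braiding len[of i j k l] unfolding is_generalized_braiding_def Let_def by blast+
    show "\<sigma> (db i j \<otimes> db k l) = inverse ?qa *\<^sub>C T (\<lambda>i j k l. db i j \<otimes> db k l) i j k l"
      using sig(1) by (simp add: fam_eqs fam_prod_4 T1234_eq T1234_def[symmetric] qpow)
    show "\<sigma> (dp i j \<otimes> db k l) = qpow Q (2 * a_num Q - 2 * w_num Q) *\<^sub>C
          S (\<lambda>i. Stinv (\<lambda>j k l. db i j \<otimes> dp k l)) i j k l
          + ((1 - ?qa) * ?qa * qpow Q (- m_num Q)) *\<^sub>C (p i j \<rhd>\<rhd> (gmp \<lhd>\<lhd> p k l))"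
      using sig(2) S_all[of "\<lambda>i. Stinv (\<lambda>j k l. db i j \<otimes> dp k l)" l i j k]
      by (simp add: fam_eqs fam_prod_4 leg_maps gmp)
    have "?qw * ?qw / (?qa * ?qa) = qpow Q (2 * w_num Q - 2 * a_num Q)"
      by (simp add: divide_inverse qpow)
    then show "\<sigma> (db i j \<otimes> dp k l) = (?qw * ?qw / (?qa * ?qa)) *\<^sub>C
          Sinv (\<lambda>i. St (\<lambda>j k l. dp i j \<otimes> db k l)) i j k l
          + ((1 - inverse ?qa) * inverse ?qm) *\<^sub>C (p i j \<rhd>\<rhd> (gpm \<lhd>\<lhd> p k l))"
      using sig(3) Sinv_all[of "\<lambda>i. St (\<lambda>j k l. dp i j \<otimes> db k l)" l i j k]
      by (simp add: fam_eqs fam_prod_4 leg_maps gpm qpow)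
    show "bimodule_map (Om2 A) (OmOm A) s" using splitting by (simp add: is_splitting_map_def)
    have mem: "dp i j \<in> Om_plus A" "db i j \<in> Om_minus A" for i j
      using presented_left_module_generator[OF plus Om, of "(i, j)"]
        presented_left_module_generator[OF minus Om, of "(i, j)"] by simp_all
    show "s (quo A (db i j \<otimes> db k l)) = (1 / (1 + ?qa)) *\<^sub>C (db i j \<otimes> db k l - ?qa *\<^sub>C \<sigma> (db i j \<otimes> db k l))"
      "s (quo A (dp i j \<otimes> db k l)) = c_pm *\<^sub>C (dp i j \<otimes> db k l) - c_mp *\<^sub>C \<sigma> (dp i j \<otimes> db k l)"
      "s (quo A (db i j \<otimes> dp k l)) = c_mp *\<^sub>C (db i j \<otimes> dp k l) - c_pm *\<^sub>C \<sigma> (db i j \<otimes> dp k l)"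
      using splitting mem unfolding is_splitting_map_def Let_def wedge_def by blast+
  qed
  show ?thesis
    using ricci_gmp by (simp add: Ricci_mp_def gmp qdim)
qed

end
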